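(* Let $N\ge 2$ and $p\in(1,p^*_N)$, where $p^*_N=\frac{N}{N-2}$ if $N\ge 3$ and $p^*_N=+\infty$ if $N=2$. Let $Q:\mathbb{R}^N\to\mathbb{R}$ be a Hölder continuous function with $Q(0)>0$. Suppose $u\in C^2(\mathbb{R}^N\setminus\{0\})$ is a real-valued classical solution of $$-\Delta u-u=Q|u|^{p-1}u\quad\text{in }\mathbb{R}^N\setminus\{0\},\qquad \lim_{|x|\to0^+}u(x)=+\infty .$$ Then $u\in L^1_{loc}(\mathbb{R}^N)$, $Q|u|^{p-1}u\in L^1_{loc}(\mathbb{R}^N)$, and there exists $k>0$ such that $$\int_{\mathbb{R}^N}\big[u(-\Delta\xi)-u\xi-Q|u|^{p-1}u\,\xi\big]\,dx=k\,\xi(0)\qquad\text{for all }\xi\in C^\infty_c(\mathbb{R}^N),$$ i.e. $u$ is a weak solution of $-\Delta u-u=Q|u|^{p-1}u+k\delta_0$ in $\mathbb{R}^N$ ($\delta_0$ the Dirac mass at the origin), and moreover $$\lim_{|x|\to0^+}\frac{u(x)}{\Phi(x)}=k .$$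
   Context: $\Phi$ denotes the real radially symmetric fundamental solution of the Helmholtz operator $-\Delta-1$: $\Phi=\operatorname{Re}\Phi_c$, where $\Phi_c(x)=\frac{i}{4}(2\pi|x|)^{\frac{2-N}{2}}H^{(1)}_{\frac{N-2}{2}}(|x|)$ for $x\neq0$, with $H^{(1)}_\nu$ the Hankel function of the first kind of order $\nu$. It satisfies $-\Delta\Phi-\Phi=\delta_0$ in the sense of distributions, $-\Delta\Phi-\Phi=0$ pointwise in $\mathbb{R}^N\setminus\{0\}$, $\Phi(x)=c_N|x|^{2-N}+O(|x|^{3-N})$ as $|x|\to0$ if $N\ge3$, $\Phi(x)=-c_N\ln|x|+O(|x|)$ as $|x|\to0$ if $N=2$ (with a normalizing constant $c_N>0$), and $|\Phi(x)|\le C|x|^{-\frac{N-1}{2}}$ for $|x|\ge1$. *)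

theory Defs
  imports "HOL-Analysis.Analysis"
begin

definition has_partial :: "'n::finite \<Rightarrow> (real^'n \<Rightarrow> real) \<Rightarrow> real^'n \<Rightarrow> bool" where
  "has_partial i f x \<longleftrightarrow> (\<lambda>t. f (x + t *\<^sub>R axis i 1)) differentiable (at 0)"

definition partial :: "'n::finite \<Rightarrow> (real^'n \<Rightarrow> real) \<Rightarrow> real^'n \<Rightarrow> real" where
  "partial i f x = deriv (\<lambda>t. f (x + t *\<^sub>R axis i 1)) 0"

definition laplacian :: "(real^'n::finite \<Rightarrow> real) \<Rightarrow> real^'n \<Rightarrow> real" where
  "laplacian f x = (\<Sum>i\<in>UNIV. partial i (partial i f) x)"

definition C2_on :: "(real^'n::finite) set \<Rightarrow> (real^'n \<Rightarrow> real) \<Rightarrow> bool" where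
  "C2_on S f \<longleftrightarrow> continuous_on S f \<and>
     (\<forall>i. (\<forall>x\<in>S. has_partial i f x) \<and> continuous_on S (partial i f)) \<and>
     (\<forall>i j. (\<forall>x\<in>S. has_partial j (partial i f) x) \<and> continuous_on S (partial j (partial i f)))"

fun partial_iter :: "'n::finite list \<Rightarrow> (real^'n \<Rightarrow> real) \<Rightarrow> real^'n \<Rightarrow> real" where
  "partial_iter [] f = f"
| "partial_iter (i # is) f = partial i (partial_iter is f)"

definition smooth :: "(real^'n::finite \<Rightarrow> real) \<Rightarrow> bool" where
  "smooth f \<longleftrightarrow> (\<forall>is. continuous_on UNIV (partial_iter is f) \<and>
                       (\<forall>i x. has_partial i (partial_iter is f) x))"

definition test_function :: "(real^'n::finite \<Rightarrow> real) \<Rightarrow> bool" where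
  "test_function f \<longleftrightarrow> smooth f \<and> compact (closure {x. f x \<noteq> 0})"

definition holder_continuous :: "('a::metric_space \<Rightarrow> real) \<Rightarrow> bool" where
  "holder_continuous f \<longleftrightarrow>
     (\<exists>\<alpha> C. 0 < \<alpha> \<and> \<alpha> \<le> 1 \<and> (\<forall>x y. \<bar>f x - f y\<bar> \<le> C * dist x y powr \<alpha>))"

definition locally_integrable :: "(real^'n::finite \<Rightarrow> real) \<Rightarrow> bool" where
  "locally_integrable f \<longleftrightarrow> (\<forall>K. compact K \<longrightarrow> set_integrable lborel K f)"

text \<open>Bessel function Y_nu for real order nu and x > 0, via the integral representation
  (DLMF 10.9.7), valid for every real order.\<close>
definition BesselY :: "real \<Rightarrow> real \<Rightarrow> real" where
  "BesselY \<nu> x =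
     (1/pi) * integral {0..pi} (\<lambda>\<theta>. sin (x * sin \<theta> - \<nu> * \<theta>))
   - (1/pi) * integral {0..} (\<lambda>t. (exp (\<nu> * t) + exp (- \<nu> * t) * cos (\<nu> * pi)) * exp (- x * sinh t))"

text \<open>Phi = Re Phi_c, Phi_c(x) = (i/4)(2 pi |x|)^((2-N)/2) H^(1)_{(N-2)/2}(|x|);
  since H^(1) = J + iY with J, Y real, Re Phi_c = -(1/4)(2 pi |x|)^((2-N)/2) Y_{(N-2)/2}(|x|).\<close>
definition Phi :: "real^'n::finite \<Rightarrow> real" where
  "Phi x = (if x = 0 then 0 else
     - (1/4) * (2 * pi * norm x) powr ((2 - real CARD('n)) / 2)
       * BesselY ((real CARD('n) - 2) / 2) (norm x))"

end

(* Write h for the radial fundamental solution of -Laplace. Near 0 the source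
   src = u + Q |u|^(p-1) u is positive, so u is superharmonic there. Testing with concave
   truncations of h (they vanish near 0, so only Green's identity for compactly supported
   functions is needed) shows that src is integrable and that u has mass O(r^(2N-2) h(r)^2) on
   balls of radius comparable to r at distance r from 0. A doubling argument and the mean value
   property turn this into u = O(|x|^(-b)) for every b > N - 2; here subcriticality of p enters.
   The defect in the weak equation is then a functional that kills every test function vanishing
   at 0, i.e. k times the Dirac mass. Testing with differences of regularised fundamental solutions
   centred at x, with regularisation radius |x|/2, yields u / h -> k / (N vol(B_1)), using only that
   src is integrable. If k were 0, then u = o(h), and comparison for the linear operator
   -Laplace - src/u, whose potential is O(|x|^(-2+delta)), would make u bounded. Finally Phi is
   asymptotic to h / (N vol(B_1)), by comparing the integral for Y_nu with a Gamma integral. *)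
theory Submission
  imports Defs "HOL-Real_Asymp.Real_Asymp"
begin

section \<open>Partial derivatives\<close>

text \<open>The only integral theorem in play is that a partial derivative of a compactly supported
  function integrates to zero; boundary integrals and spherical means never occur. Hence the
  auxiliary test functions are explicit C^2 functions of \<open>|x - c|^2\<close>, and averages are
  taken against \<open>eta\<close>, minus the Laplacian of a regularised fundamental solution. The
  mass bound is a curvature effect. For a concave truncation of h at level n, minus the Laplacian is
  of size |grad h|^2 / n^2 = |x|^(2-2N) / n^2 on the shell where h is of order n; taking n of order
  h(x) selects the shell through x. Dividing by the volume r^N yields averages of u of order r^(2-N)
  if N >= 3, but of order log^2 r if N = 2. This is why an arbitrary exponent b > N - 2 is carried
  along. Such a bound is enough because each use leaves a strict gap: b < N - 1 kills the cutoff
  errors, b p < N makes the mean value error negligible against h, and b (p - 1) < 2 makes the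
  potential src/u less singular than |x|^(-2). An exponent b > N - 2 meeting either of the last two
  conditions exists exactly when p (N - 2) < N.\<close>

definition has_pd :: "'n::finite \<Rightarrow> (real^'n \<Rightarrow> real) \<Rightarrow> real \<Rightarrow> real^'n \<Rightarrow> bool" where
  "has_pd i f D x \<longleftrightarrow> ((\<lambda>t. f (x + t *\<^sub>R axis i 1)) has_real_derivative D) (at 0)"

lemma has_pd_imp:
  assumes "has_pd i f D x"
  shows "has_partial i f x" "partial i f x = D"
  using assms unfolding has_pd_def has_partial_def partial_def
  by (auto simp: real_differentiable_def intro: DERIV_imp_deriv)

lemma has_partial_imp_has_pd: "has_partial i f x \<Longrightarrow> has_pd i f (partial i f x) x"
  unfolding has_pd_def has_partial_def partial_def
  by (simp add: DERIV_deriv_iff_real_differentiable)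

lemma has_pd_unique: "has_pd i f D x \<Longrightarrow> has_pd i f E x \<Longrightarrow> D = E"
  unfolding has_pd_def by (rule DERIV_unique)

lemma has_pd_shift:
  assumes "has_pd i f D (x + t *\<^sub>R axis i 1)"
  shows "((\<lambda>t. f (x + t *\<^sub>R axis i 1)) has_real_derivative D) (at t)"
proof -
  have "((\<lambda>s. f (x + (s + t) *\<^sub>R axis i 1)) has_real_derivative D) (at 0)"
    using assms by (simp add: has_pd_def scaleR_left_distrib add_ac)
  from this[unfolded has_field_derivative_def] show ?thesis
    using DERIV_shift[of "\<lambda>t. f (x + t *\<^sub>R axis i 1)" D 0 t]
    by (simp add: has_field_derivative_def)
qed

lemma has_pd_const: "has_pd i (\<lambda>_. c) 0 x"
  by (simp add: has_pd_def)

lemma has_pd_add: "has_pd i f D x \<Longrightarrow> has_pd i g E x \<Longrightarrow> has_pd i (\<lambda>x. f x + g x) (D + E) x"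
  unfolding has_pd_def by (rule DERIV_add)

lemma has_pd_diff: "has_pd i f D x \<Longrightarrow> has_pd i g E x \<Longrightarrow> has_pd i (\<lambda>x. f x - g x) (D - E) x"
  unfolding has_pd_def by (rule DERIV_diff)

lemma has_pd_cmult: "has_pd i f D x \<Longrightarrow> has_pd i (\<lambda>x. c * f x) (c * D) x"
  unfolding has_pd_def by (rule DERIV_cmult)

lemma has_pd_mult:
  "has_pd i f D x \<Longrightarrow> has_pd i g E x \<Longrightarrow> has_pd i (\<lambda>x. f x * g x) (D * g x + E * f x) x"
  unfolding has_pd_def by (drule (1) DERIV_mult) simp

lemma has_pd_chain:
  assumes "(F has_real_derivative F') (at (f x))" "has_pd i f D x"
  shows "has_pd i (\<lambda>x. F (f x)) (F' * D) x"
proof -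
  have "((\<lambda>t. F (f (x + t *\<^sub>R axis i 1))) has_real_derivative F' * D) (at 0)"
    by (rule DERIV_chain2[where g="\<lambda>t. f (x + t *\<^sub>R axis i 1)" and x=0])
       (use assms in \<open>simp_all add: has_pd_def\<close>)
  then show ?thesis by (simp add: has_pd_def)
qed

lemma has_pd_coord: "has_pd j (\<lambda>x. (x - c) $ i) (if i = j then 1 else 0) x"
  unfolding has_pd_def
  by (auto simp: axis_def intro!: derivative_eq_intros)

lemma norm_sq_line: "(norm (z + t *\<^sub>R axis i 1))\<^sup>2 = (norm z)\<^sup>2 + 2 * t * z $ i + (t::real)\<^sup>2"
  unfolding power2_norm_eq_inner by (simp add: algebra_simps inner_axis inner_axis' power2_eq_square)

lemma has_pd_norm_sq: "has_pd i (\<lambda>x. (norm (x - c))\<^sup>2) (2 * (x - c) $ i) x"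
proof -
  have e: "x + t *\<^sub>R axis i 1 - c = (x - c) + t *\<^sub>R axis i 1" for t by simp
  show ?thesis
    unfolding has_pd_def e norm_sq_line by (auto intro!: derivative_eq_intros)
qed

lemma tendsto_line: "((\<lambda>t. x + t *\<^sub>R (axis i 1 :: real^'n::finite)) \<longlongrightarrow> x) (at 0)"
  by (auto intro!: tendsto_eq_intros)

lemma has_pd_cong_open:
  assumes "open S" "x \<in> S" "\<And>y. y \<in> S \<Longrightarrow> f y = g y"
  shows "has_pd i f D x \<longleftrightarrow> has_pd i g D x"
proof -
  have "\<forall>\<^sub>F t in at 0. x + t *\<^sub>R axis i 1 \<in> S"
    by (rule topological_tendstoD[OF tendsto_line assms(1,2)])
  then have "\<forall>\<^sub>F t in nhds (0::real). x + t *\<^sub>R axis i 1 \<in> S"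
    using assms(2) by (auto simp: eventually_nhds_conv_at)
  then have "\<forall>\<^sub>F t in nhds 0. f (x + t *\<^sub>R axis i 1) = g (x + t *\<^sub>R axis i 1)"
    by eventually_elim (use assms in auto)
  then show ?thesis
    unfolding has_pd_def by (intro DERIV_cong_ev) auto
qed

lemma partial_cong_open:
  assumes "open S" "x \<in> S" "\<And>y. y \<in> S \<Longrightarrow> f y = g y"
  shows "partial i f x = partial i g x" "has_partial i f x \<longleftrightarrow> has_partial i g x"
proof -
  have c: "has_pd i f D x \<longleftrightarrow> has_pd i g D x" for D by (rule has_pd_cong_open[OF assms])
  then show "has_partial i f x \<longleftrightarrow> has_partial i g x"
    by (metis has_partial_imp_has_pd has_pd_imp(1))
  show "partial i f x = partial i g x"
    using c unfolding has_pd_def partial_def deriv_def by simp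
qed

lemma laplacian_cong_open:
  assumes "open S" "x \<in> S" "\<And>y. y \<in> S \<Longrightarrow> f y = g y"
  shows "laplacian f x = laplacian g x"
  unfolding laplacian_def
  by (intro sum.cong refl partial_cong_open(1)[OF assms(1,2)] partial_cong_open(1)[OF assms(1)] assms(3))

lemma laplacian_zero_open:
  assumes "open S" "x \<in> S" "\<And>y. y \<in> S \<Longrightarrow> f y = 0"
  shows "laplacian f x = 0"
proof -
  have "partial i (\<lambda>_. 0) = (\<lambda>_. 0)" for i :: 'a
    using has_pd_imp(2)[OF has_pd_const] by fastforce
  then have "laplacian (\<lambda>_. 0) x = 0" by (simp add: laplacian_def)
  with laplacian_cong_open[OF assms(1,2), of f "\<lambda>_. 0"] assms(3) show ?thesis by simp
qed

lemma partial_zero_open: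
  assumes "open S" "x \<in> S" "\<And>y. y \<in> S \<Longrightarrow> f y = 0"
  shows "partial i f x = 0"
  using partial_cong_open(1)[OF assms(1,2), of f "\<lambda>_. 0"] assms(3) has_pd_imp(2)[OF has_pd_const]
  by fastforce

text \<open>It suffices to guess the derivatives: as \<open>S\<close> is open,
  \<open>partial i f\<close> coincides with \<open>g i\<close> near each point, so its own
  derivatives are those of \<open>g i\<close>. The relation \<open>has_pd\<close> is used because it
  carries existence and value together, whereas \<open>partial\<close> alone guarantees no
  existence.\<close>

lemma C2_onI:
  fixes S :: "(real^'n::finite) set"
  assumes S: "open S" and f: "continuous_on S f"
    and g: "\<And>i. continuous_on S (g i)" and k: "\<And>i j. continuous_on S (k i j)"
    and fg: "\<And>i x. x \<in> S \<Longrightarrow> has_pd i f (g i x) x"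
    and gk: "\<And>i j x. x \<in> S \<Longrightarrow> has_pd j (g i) (k i j x) x"
  shows "C2_on S f" and "\<And>x. x \<in> S \<Longrightarrow> laplacian f x = (\<Sum>i\<in>UNIV. k i i x)"
    and "\<And>i x. x \<in> S \<Longrightarrow> partial i f x = g i x"
proof -
  have 1: "partial i f x = g i x" if "x \<in> S" for i x using has_pd_imp(2)[OF fg[OF that]] .
  have 2: "has_pd j (partial i f) (k i j x) x" if "x \<in> S" for i j x
    using has_pd_cong_open[OF S that, of "partial i f" "g i"] gk[OF that] 1 by simp
  have 3: "partial j (partial i f) x = k i j x" if "x \<in> S" for i j x using has_pd_imp(2)[OF 2[OF that]] .
  show "C2_on S f"
    unfolding C2_on_def
    using f g k has_pd_imp(1)[OF fg] has_pd_imp(1)[OF 2] 1 3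
    by (auto cong: continuous_on_cong_simp)
  show "\<And>x. x \<in> S \<Longrightarrow> laplacian f x = (\<Sum>i\<in>UNIV. k i i x)"
    by (simp add: laplacian_def 3)
  show "\<And>i x. x \<in> S \<Longrightarrow> partial i f x = g i x" by (rule 1)
qed

lemma C2_onD:
  assumes "C2_on S f"
  shows "continuous_on S f" "continuous_on S (partial i f)" "continuous_on S (partial j (partial i f))"
    and "\<And>x. x \<in> S \<Longrightarrow> has_pd i f (partial i f x) x"
    and "\<And>x. x \<in> S \<Longrightarrow> has_pd j (partial i f) (partial j (partial i f) x) x"
  using assms unfolding C2_on_def by (auto intro: has_partial_imp_has_pd)

lemma C2_on_subset: "C2_on S f \<Longrightarrow> T \<subseteq> S \<Longrightarrow> C2_on T f"
  unfolding C2_on_def by (meson continuous_on_subset subsetD)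

lemma C2_on_continuous_laplacian: "C2_on S f \<Longrightarrow> continuous_on S (laplacian f)"
  unfolding laplacian_def[abs_def] by (intro continuous_on_sum C2_onD(3))

lemma C2_on_const: "C2_on S (\<lambda>_. c)"
proof -
  have e: "partial i (\<lambda>_. d) = (\<lambda>_. 0)" for i :: 'a and d
    using has_pd_imp(2)[OF has_pd_const] by fastforce
  show ?thesis unfolding C2_on_def e using has_pd_imp(1)[OF has_pd_const] by auto
qed

lemma C2_on_diff:
  assumes S: "open S" and f: "C2_on S f" and g: "C2_on S g"
  shows "C2_on S (\<lambda>x. f x - g x)"
    and "\<And>x. x \<in> S \<Longrightarrow> laplacian (\<lambda>x. f x - g x) x = laplacian f x - laplacian g x"
proof -
  note R = C2_onI[OF S, where f="\<lambda>x. f x - g x" and g="\<lambda>i x. partial i f x - partial i g x"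
    and k="\<lambda>i j x. partial j (partial i f) x - partial j (partial i g) x"]
  show "C2_on S (\<lambda>x. f x - g x)"
    by (rule R(1)) (intro continuous_intros has_pd_diff C2_onD[OF f] C2_onD[OF g]; assumption)+
  fix x assume "x \<in> S"
  then have "laplacian (\<lambda>x. f x - g x) x = (\<Sum>i\<in>UNIV. partial i (partial i f) x - partial i (partial i g) x)"
    by (intro R(2)) (intro continuous_intros has_pd_diff C2_onD[OF f] C2_onD[OF g]; assumption)+
  then show "laplacian (\<lambda>x. f x - g x) x = laplacian f x - laplacian g x"
    by (simp add: laplacian_def sum_subtractf)
qed

lemma C2_on_cmult:
  assumes S: "open S" and f: "C2_on S f"
  shows "C2_on S (\<lambda>x. c * f x)"
    and "\<And>x. x \<in> S \<Longrightarrow> laplacian (\<lambda>x. c * f x) x = c * laplacian f x"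
proof -
  note R = C2_onI[OF S, where f="\<lambda>x. c * f x" and g="\<lambda>i x. c * partial i f x"
    and k="\<lambda>i j x. c * partial j (partial i f) x"]
  show "C2_on S (\<lambda>x. c * f x)"
    by (rule R(1)) (intro continuous_intros has_pd_cmult C2_onD[OF f]; assumption)+
  fix x assume "x \<in> S"
  then have "laplacian (\<lambda>x. c * f x) x = (\<Sum>i\<in>UNIV. c * partial i (partial i f) x)"
    by (intro R(2)) (intro continuous_intros has_pd_cmult C2_onD[OF f]; assumption)+
  then show "laplacian (\<lambda>x. c * f x) x = c * laplacian f x"
    by (simp add: laplacian_def sum_distrib_left)
qed

lemma C2_on_mult:
  assumes S: "open S" and f: "C2_on S f" and g: "C2_on S g"
  shows "C2_on S (\<lambda>x. f x * g x)"
    and "\<And>x. x \<in> S \<Longrightarrow> laplacian (\<lambda>x. f x * g x) x =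
      f x * laplacian g x + 2 * (\<Sum>i\<in>UNIV. partial i f x * partial i g x) + g x * laplacian f x"
proof -
  note R = C2_onI[OF S, where f="\<lambda>x. f x * g x"
    and g="\<lambda>i x. partial i f x * g x + partial i g x * f x"
    and k="\<lambda>i j x. (partial j (partial i f) x * g x + partial j g x * partial i f x) +
      (partial j (partial i g) x * f x + partial j f x * partial i g x)"]
  show "C2_on S (\<lambda>x. f x * g x)"
    by (rule R(1)) (intro continuous_intros has_pd_add has_pd_mult C2_onD[OF f] C2_onD[OF g]; assumption)+
  fix x assume "x \<in> S"
  have "laplacian (\<lambda>x. f x * g x) x = (\<Sum>i\<in>UNIV. (partial i (partial i f) x * g x + partial i g x * partial i f x) +
      (partial i (partial i g) x * f x + partial i f x * partial i g x))"
    using \<open>x \<in> S\<close>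
    by (intro R(2)) (intro continuous_intros has_pd_add has_pd_mult C2_onD[OF f] C2_onD[OF g]; assumption)+
  also have "\<dots> = f x * laplacian g x + 2 * (\<Sum>i\<in>UNIV. partial i f x * partial i g x) + g x * laplacian f x"
    by (simp add: laplacian_def sum.distrib sum_distrib_left algebra_simps)
  finally show "laplacian (\<lambda>x. f x * g x) x = \<dots>" .
qed

text \<open>Profiles are functions of \<open>|x - c|^2\<close>, a polynomial in the coordinates, so
  the centre \<open>c\<close> needs no separate treatment. The i-th pure second derivative is
  \<open>4 F2 (x - c)_i^2 + 2 F1\<close>, and the squares of the coordinates sum to
  \<open>|x - c|^2\<close>.\<close>

lemma radial_C2:
  fixes c :: "real^'n::finite" and F F1 F2 :: "real \<Rightarrow> real"
  assumes S: "open S"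
    and F: "\<And>x. x \<in> S \<Longrightarrow> (F has_real_derivative F1 ((norm (x - c))\<^sup>2)) (at ((norm (x - c))\<^sup>2))"
    and F1: "\<And>x. x \<in> S \<Longrightarrow> (F1 has_real_derivative F2 ((norm (x - c))\<^sup>2)) (at ((norm (x - c))\<^sup>2))"
    and F2: "continuous_on S (\<lambda>x. F2 ((norm (x - c))\<^sup>2))"
  shows "C2_on S (\<lambda>x. F ((norm (x - c))\<^sup>2))"
    and "\<And>x. x \<in> S \<Longrightarrow> laplacian (\<lambda>x. F ((norm (x - c))\<^sup>2)) x =
      4 * (norm (x - c))\<^sup>2 * F2 ((norm (x - c))\<^sup>2) + 2 * real CARD('n) * F1 ((norm (x - c))\<^sup>2)"
    and "\<And>i x. x \<in> S \<Longrightarrow> partial i (\<lambda>x. F ((norm (x - c))\<^sup>2)) x = F1 ((norm (x - c))\<^sup>2) * (2 * (x - c) $ i)"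
proof -
  let ?s = "\<lambda>x::real^'n. (norm (x - c))\<^sup>2"
  have sc: "continuous_on S ?s" by (intro continuous_intros)
  have cF: "continuous_on S (\<lambda>x. F (?s x))"
    by (rule continuous_at_imp_continuous_on, intro ballI isCont_o2[where f="?s" and g=F])
       (auto intro!: continuous_intros DERIV_isCont[OF F])
  have cF1: "continuous_on S (\<lambda>x. F1 (?s x))"
    by (rule continuous_at_imp_continuous_on, intro ballI isCont_o2[where f="?s" and g=F1])
       (auto intro!: continuous_intros DERIV_isCont[OF F1])
  let ?g = "\<lambda>i x. F1 (?s x) * (2 * (x - c) $ i)"
  let ?k = "\<lambda>i j x. (F2 (?s x) * (2 * (x - c) $ j)) * (2 * (x - c) $ i) + (2 * (if i = j then 1 else 0)) * F1 (?s x)"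
  have g: "continuous_on S (?g i)" for i by (intro continuous_intros cF1)
  have k: "continuous_on S (?k i j)" for i j by (intro continuous_intros cF1 F2)
  have fg: "has_pd i (\<lambda>x. F (?s x)) (?g i x) x" if "x \<in> S" for i x
    by (rule has_pd_chain[OF F[OF that] has_pd_norm_sq])
  have gk: "has_pd j (?g i) (?k i j x) x" if "x \<in> S" for i j x
    by (intro has_pd_mult has_pd_cmult has_pd_coord has_pd_chain[OF F1[OF that] has_pd_norm_sq])
  note R = C2_onI[OF S cF, where g="?g" and k="?k"]
  show "C2_on S (\<lambda>x. F (?s x))" by (rule R(1)) (rule g k | erule fg | erule gk)+
  show "\<And>i x. x \<in> S \<Longrightarrow> partial i (\<lambda>x. F (?s x)) x = ?g i x"
    by (rule R(3)) (rule g k | erule fg | erule gk | assumption)+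
  fix x assume "x \<in> S"
  then have "laplacian (\<lambda>x. F (?s x)) x = (\<Sum>i\<in>UNIV. ?k i i x)"
    by (intro R(2)) (rule g k | erule fg | erule gk | assumption)+
  also have "\<dots> = (\<Sum>i\<in>UNIV. 4 * F2 (?s x) * ((x - c) $ i)\<^sup>2 + 2 * F1 (?s x))"
    by (intro sum.cong refl) (simp add: power2_eq_square algebra_simps)
  also have "\<dots> = 4 * F2 (?s x) * (\<Sum>i\<in>UNIV. ((x - c) $ i)\<^sup>2) + 2 * real CARD('n) * F1 (?s x)"
    by (simp only: sum.distrib sum_distrib_left[symmetric]) simp
  also have "(\<Sum>i\<in>UNIV. ((x - c) $ i)\<^sup>2) = ?s x"
    by (simp add: norm_vec_def L2_set_def sum_nonneg)
  finally show "laplacian (\<lambda>x. F (?s x)) x = 4 * ?s x * F2 (?s x) + 2 * real CARD('n) * F1 (?s x)"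
    by (simp add: algebra_simps)
qed

section \<open>Integration by parts\<close>

lemma integrable_compact_support:
  fixes g :: "'a::euclidean_space \<Rightarrow> real"
  assumes "continuous_on UNIV g" "compact K" "\<And>x. x \<notin> K \<Longrightarrow> g x = 0"
  shows "integrable lborel g"
proof -
  have "integrable lborel (\<lambda>x. indicator K x *\<^sub>R g x)"
    using assms by (intro borel_integrable_compact) (auto intro: continuous_on_subset)
  moreover have "(\<lambda>x. indicator K x *\<^sub>R g x) = g"
    using assms(3) by (auto simp: indicator_def fun_eq_iff)
  ultimately show ?thesis by simp
qed

lemma integrable_indicator_cball:
  "integrable lborel (indicat_real (cball (c::'a::euclidean_space) r))"
  by (rule integrable_real_indicator[OF _ emeasure_lborel_cball_finite]) simp

lemma bounded_compact_support:
  fixes g :: "'a::euclidean_space \<Rightarrow> real"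
  assumes "continuous_on UNIV g" "compact K" "\<And>x. x \<notin> K \<Longrightarrow> g x = 0"
  obtains M where "M > 0" "\<And>x. \<bar>g x\<bar> \<le> M"
proof -
  have "bounded (g ` K)"
    using assms by (meson compact_continuous_image compact_imp_bounded continuous_on_subset subset_UNIV)
  then obtain M where "M > 0" "\<And>y. y \<in> g ` K \<Longrightarrow> norm y \<le> M" by (auto simp: bounded_pos)
  moreover have "\<bar>g x\<bar> \<le> M" for x
    using calculation assms(3)[of x] by (cases "x \<in> K") auto
  ultimately show ?thesis by (intro that)
qed

text \<open>Translation invariance of Lebesgue measure makes every difference quotient of
  \<open>g\<close> integrate to zero. The mean value theorem bounds the quotients by the maximum of
  \<open>g'\<close>, so dominated convergence passes this to the limit.\<close>

lemma integral_partial_eq_0: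
  fixes g g' :: "real^'n::finite \<Rightarrow> real"
  assumes pd: "\<And>x. has_pd i g (g' x) x"
    and cg: "continuous_on UNIV g" and cg': "continuous_on UNIV g'"
    and K: "compact K" "\<And>x. x \<notin> K \<Longrightarrow> g x = 0"
  shows "integrable lborel g'" "integral\<^sup>L lborel g' = 0"
proof -
  have z: "g' x = 0" if "x \<notin> K" for x
  proof -
    have "has_pd i g 0 x"
      using has_pd_cong_open[of "-K" x g "\<lambda>_. 0" i 0] K that
      by (simp add: open_Compl compact_imp_closed has_pd_const)
    with pd show ?thesis by (rule has_pd_unique)
  qed
  show "integrable lborel g'" by (rule integrable_compact_support[OF cg' K(1) z])
  obtain M where M: "M > 0" "\<And>x. \<bar>g' x\<bar> \<le> M" using bounded_compact_support[OF cg' K(1) z] by blast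
  obtain B where "\<forall>x\<in>K. norm x \<le> B" using compact_imp_bounded[OF K(1)] unfolding bounded_iff by blast
  then have B: "K \<subseteq> cball 0 B" by auto
  define e :: "real^'n" where "e = axis i 1"
  \<comment> \<open>The steps \<open>1 / Suc n\<close> are at most 1, so all difference quotients
    vanish outside \<open>cball 0 (B + 1)\<close>, which gives an integrable majorant.\<close>
  define q where "q n x = (g (x + (1 / real (Suc n)) *\<^sub>R e) - g x) * real (Suc n)" for n x
  have ig: "integrable lborel g" by (rule integrable_compact_support[OF cg K])
  have tr: "integrable lborel (\<lambda>x. g (x + c)) \<and> integral\<^sup>L lborel (\<lambda>x. g (x + c)) = integral\<^sup>L lborel g" for c
  proof -
    have m: "(+) c \<in> lborel \<rightarrow>\<^sub>M borel" by simp
    have mg: "g \<in> borel_measurable borel" using cg by (simp add: borel_measurable_continuous_onI)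
    show ?thesis
      using integral_distr[OF m mg] integrable_distr_eq[OF m mg] ig by (simp add: lborel_distr_plus add.commute)
  qed
  have q0: "integral\<^sup>L lborel (q n) = 0" for n
    unfolding q_def[abs_def] using tr[of "(1 / real (Suc n)) *\<^sub>R e"] ig by simp
  have "(\<lambda>n. integral\<^sup>L lborel (q n)) \<longlonglongrightarrow> integral\<^sup>L lborel g'"
  proof (rule integral_dominated_convergence[where w="\<lambda>x. M * indicator (cball 0 (B + 1)) x"])
    show "g' \<in> borel_measurable lborel" using cg' by (simp add: borel_measurable_continuous_onI)
    have "continuous_on UNIV (q n)" for n
      unfolding q_def[abs_def]
      by (intro continuous_intros continuous_on_compose2[OF cg]) auto
    then show "q n \<in> borel_measurable lborel" for n by (simp add: borel_measurable_continuous_onI)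
    show "integrable lborel (\<lambda>x::real^'n. M * indicator (cball 0 (B + 1)) x)"
      by (intro integrable_mult_right integrable_indicator_cball)
    have t0: "(\<lambda>n. 1 / real (Suc n)) \<longlonglongrightarrow> 0" by real_asymp
    show "AE x in lborel. (\<lambda>n. q n x) \<longlonglongrightarrow> g' x"
    proof (rule AE_I2)
      fix x
      have "((\<lambda>t. (g (x + t *\<^sub>R e) - g x) / t) \<longlongrightarrow> g' x) (at 0)"
        using pd[of x] unfolding has_pd_def DERIV_def e_def by simp
      moreover have "filterlim (\<lambda>n. 1 / real (Suc n)) (at 0) sequentially"
        using t0 by (auto simp: filterlim_at)
      ultimately have "(\<lambda>n. (g (x + (1 / real (Suc n)) *\<^sub>R e) - g x) / (1 / real (Suc n))) \<longlonglongrightarrow> g' x"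
        by (rule filterlim_compose)
      then show "(\<lambda>n. q n x) \<longlonglongrightarrow> g' x" by (simp add: q_def)
    qed
    show "AE x in lborel. norm (q n x) \<le> M * indicator (cball 0 (B + 1)) x" for n
    proof (rule AE_I2)
      fix x
      let ?t = "1 / real (Suc n)"
      have t: "0 < ?t" "?t \<le> 1" by auto
      show "norm (q n x) \<le> M * indicator (cball 0 (B + 1)) x"
      proof (cases "x \<in> cball 0 (B + 1)")
        case True
        have "\<exists>z>0. z < ?t \<and> g (x + ?t *\<^sub>R e) - g (x + 0 *\<^sub>R e) = (?t - 0) * g' (x + z *\<^sub>R e)"
          by (rule MVT2[where f="\<lambda>t. g (x + t *\<^sub>R e)"])
             (use t pd in \<open>auto simp: e_def intro!: has_pd_shift\<close>)
        then obtain z where "g (x + ?t *\<^sub>R e) - g x = ?t * g' (x + z *\<^sub>R e)" by auto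
        then have "q n x = g' (x + z *\<^sub>R e)" by (simp add: q_def)
        with M(2) True show ?thesis by simp
      next
        case False
        then have n: "norm x > B + 1" by auto
        have "norm (?t *\<^sub>R e) \<le> 1" using t by (simp add: e_def)
        moreover have "norm x - norm (?t *\<^sub>R e) \<le> norm (x + ?t *\<^sub>R e)"
          by (rule norm_diff_ineq)
        ultimately have "norm (x + ?t *\<^sub>R e) > B" using n by linarith
        then have "x + ?t *\<^sub>R e \<notin> K" "x \<notin> K" using B n by auto
        then show ?thesis using K(2) False by (simp add: q_def)
      qed
    qed
  qed
  then show "integral\<^sup>L lborel g' = 0" by (simp add: q0 LIMSEQ_const_iff)
qed

text \<open>The field \<open>u grad \<phi> - \<phi> grad u\<close> vanishes off \<open>K\<close>,
  and \<open>S\<close> together with the complement of \<open>K\<close> covers the space, so its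
  components are globally C^1 and their divergence is the integrand. Regularity of \<open>u\<close>
  is required on \<open>S\<close> only, which is what admits a singularity of \<open>u\<close>
  outside \<open>S\<close>.\<close>

lemma green_identity:
  fixes u \<phi> :: "real^'n::finite \<Rightarrow> real"
  assumes S: "open S" and K: "compact K" "K \<subseteq> S" and z: "\<And>x. x \<notin> K \<Longrightarrow> \<phi> x = 0"
    and u: "C2_on S u" and \<phi>: "C2_on S \<phi>"
  shows "integrable lborel (\<lambda>x. u x * laplacian \<phi> x - \<phi> x * laplacian u x)"
    and "(\<integral>x. (u x * laplacian \<phi> x - \<phi> x * laplacian u x) \<partial>lborel) = 0"
proof -
  have oK: "open (- K)" using K by (simp add: open_Compl compact_imp_closed)
  have UN: "S \<union> - K = UNIV" using K by auto
  have pz: "partial i \<phi> x = 0" if "x \<notin> K" for i x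
    by (rule partial_zero_open[OF oK]) (use that z in auto)
  have ppz: "partial j (partial i \<phi>) x = 0" if "x \<notin> K" for i j x
    by (rule partial_zero_open[OF oK]) (use that pz in auto)
  define v where "v i x = u x * partial i \<phi> x - \<phi> x * partial i u x" for i x
  define w where "w i x = u x * partial i (partial i \<phi>) x - \<phi> x * partial i (partial i u) x" for i x
  have vz: "v i x = 0" and wz: "w i x = 0" if "x \<notin> K" for i x
    using that z pz ppz by (auto simp: v_def w_def)
  have cont: "continuous_on UNIV h" if "continuous_on S h" "\<And>x. x \<notin> K \<Longrightarrow> h x = 0" for h :: "real^'n \<Rightarrow> real"
  proof -
    have "continuous_on (- K) h" using that(2) by (simp cong: continuous_on_cong_simp)
    from continuous_on_open_Un[OF S oK that(1) this] UN show ?thesis by simp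
  qed
  have "continuous_on S (v i)" for i
    unfolding v_def[abs_def] by (intro continuous_intros C2_onD(1-3)[OF u] C2_onD(1-3)[OF \<phi>])
  then have cv: "continuous_on UNIV (v i)" for i by (rule cont) (rule vz)
  have "continuous_on S (w i)" for i
    unfolding w_def[abs_def] by (intro continuous_intros C2_onD(1-3)[OF u] C2_onD(1-3)[OF \<phi>])
  then have cw: "continuous_on UNIV (w i)" for i by (rule cont) (rule wz)
  have pd: "has_pd i (v i) (w i x) x" for i x
  proof (cases "x \<in> S")
    case True
    have "has_pd i (v i) ((partial i u x * partial i \<phi> x + partial i (partial i \<phi>) x * u x) -
        (partial i \<phi> x * partial i u x + partial i (partial i u) x * \<phi> x)) x"
      unfolding v_def[abs_def]
      by (intro has_pd_diff has_pd_mult C2_onD(4-5)[OF u True] C2_onD(4-5)[OF \<phi> True])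
    then show ?thesis by (simp add: w_def algebra_simps)
  next
    case False
    then have "x \<in> - K" using K by auto
    moreover have "has_pd i (v i) 0 x"
      using has_pd_cong_open[OF oK \<open>x \<in> - K\<close>, of "v i" "\<lambda>_. 0" i 0] vz by (simp add: has_pd_const)
    ultimately show ?thesis using wz by simp
  qed
  note I = integral_partial_eq_0[OF pd cv cw K(1) vz]
  have e: "(\<lambda>x. u x * laplacian \<phi> x - \<phi> x * laplacian u x) = (\<lambda>x. \<Sum>i\<in>UNIV. w i x)"
    by (auto simp: w_def laplacian_def sum_distrib_left sum_subtractf)
  show "integrable lborel (\<lambda>x. u x * laplacian \<phi> x - \<phi> x * laplacian u x)"
    unfolding e using I(1) by auto
  show "(\<integral>x. (u x * laplacian \<phi> x - \<phi> x * laplacian u x) \<partial>lborel) = 0"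
    unfolding e using I by (subst Bochner_Integration.integral_sum) auto
qed

section \<open>One-dimensional profiles\<close>

lemma DERIV_glue:
  fixes f g f' g' :: "real \<Rightarrow> real"
  assumes g: "t \<ge> S \<Longrightarrow> (g has_real_derivative g' t) (at t)"
    and f: "t \<le> S \<Longrightarrow> (f has_real_derivative f' t) (at t)"
    and eq: "g S = f S" "g' S = f' S"
  shows "((\<lambda>s. if s \<ge> S then g s else f s) has_real_derivative (if t \<ge> S then g' t else f' t)) (at t)"
    (is "(?h has_real_derivative _) _")
proof -
  consider "t < S" | "t > S" | "t = S" by linarith
  then show ?thesis
  proof cases
    case 1
    then have "(f has_real_derivative f' t) (at t)" using f by simp
    then have "(?h has_real_derivative f' t) (at t)"
      by (rule has_field_derivative_transform_within_open[where S="{..<S}"]) (use 1 in auto)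
    with 1 show ?thesis by simp
  next
    case 2
    then have "(g has_real_derivative g' t) (at t)" using g by simp
    then have "(?h has_real_derivative g' t) (at t)"
      by (rule has_field_derivative_transform_within_open[where S="{S<..}"]) (use 2 in auto)
    with 2 show ?thesis by simp
  next
    case 3
    have "(?h has_real_derivative g' S) (at S within {S..})"
      by (rule has_field_derivative_transform_within[where f=g and d=1])
        (use g 3 in \<open>auto intro: has_field_derivative_at_within\<close>)
    moreover have "(?h has_real_derivative g' S) (at S within {..S})"
      by (rule has_field_derivative_transform_within[where f=f and d=1])
        (use f 3 eq in \<open>auto intro: has_field_derivative_at_within\<close>)
    ultimately have "(?h has_real_derivative g' S) (at S within {S..} \<union> {..S})"
      unfolding has_field_derivative_iff Lim_within_Un by blast
    moreover have "{S..} \<union> {..S} = UNIV" by auto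
    ultimately show ?thesis using 3 by simp
  qed
qed

definition posp :: "real \<Rightarrow> nat \<Rightarrow> real \<Rightarrow> real" where
  "posp c n t = (max 0 (t - c)) ^ n"

text \<open>The exponent zero is excluded because \<open>posp c 0\<close> is constantly 1, whereas
  \<open>posp c 1\<close> has slope 0 to the left of \<open>c\<close> and a kink at
  \<open>c\<close>.\<close>

lemma DERIV_posp:
  assumes "n > 0"
  shows "(posp c (Suc n) has_real_derivative real (Suc n) * posp c n t) (at t)"
proof -
  have "((\<lambda>s. if s \<ge> c then (s - c) ^ Suc n else 0) has_real_derivative
     (if t \<ge> c then real (Suc n) * (t - c) ^ n else 0)) (at t)"
    using assms by (intro DERIV_glue[where g'="\<lambda>t. real (Suc n) * (t - c) ^ n" and f'="\<lambda>_. 0"])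
       (auto intro!: derivative_eq_intros simp: power_Suc2[symmetric] algebra_simps zero_power simp flip: power_Suc)
  moreover have "(\<lambda>s. if s \<ge> c then (s - c) ^ Suc n else 0) = posp c (Suc n)"
    by (auto simp: posp_def max_def fun_eq_iff)
  moreover have "(if t \<ge> c then real (Suc n) * (t - c) ^ n else 0) = real (Suc n) * posp c n t"
    using assms by (auto simp: posp_def max_def)
  ultimately show ?thesis by simp
qed

text \<open>A concave C^2 cubic spline, the identity up to 1 and constant from 2 on. Its second
  derivative is minus a tent on [1, 2] of height 2 with peak at 3/2: area 1 brings the slope from 1
  down to 0, and the symmetry of the tent puts the plateau at 3/2.\<close>

definition kap :: "real \<Rightarrow> real" where
  "kap t = t - 2/3 * (posp 1 3 t - 2 * posp (3/2) 3 t + posp 2 3 t)"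
definition kap1 :: "real \<Rightarrow> real" where
  "kap1 t = 1 - 2 * (posp 1 2 t - 2 * posp (3/2) 2 t + posp 2 2 t)"
definition kap2 :: "real \<Rightarrow> real" where
  "kap2 t = - 4 * (posp 1 1 t - 2 * posp (3/2) 1 t + posp 2 1 t)"

lemma DERIV_kap: "(kap has_real_derivative kap1 t) (at t)"
proof -
  have p: "(posp c 3 has_real_derivative 3 * posp c 2 t) (at t)" for c
    using DERIV_posp[of 2 c t] by (simp add: numeral_3_eq_3 numeral_2_eq_2)
  show ?thesis unfolding kap_def[abs_def] kap1_def
    by (rule derivative_eq_intros p refl)+ (simp add: field_simps)
qed

lemma DERIV_kap1: "(kap1 has_real_derivative kap2 t) (at t)"
proof -
  have p: "(posp c 2 has_real_derivative 2 * posp c 1 t) (at t)" for c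
    using DERIV_posp[of 1 c t] by (simp add: numeral_2_eq_2)
  show ?thesis unfolding kap1_def[abs_def] kap2_def
    by (rule derivative_eq_intros p refl)+ (simp add: field_simps)
qed

lemma continuous_kap2: "continuous_on S kap2"
  unfolding kap2_def[abs_def] posp_def by (intro continuous_intros)

lemma kap_low: "t \<le> 1 \<Longrightarrow> kap t = t" "t \<le> 1 \<Longrightarrow> kap1 t = 1" "t \<le> 1 \<Longrightarrow> kap2 t = 0"
  by (auto simp: kap_def kap1_def kap2_def posp_def max_def)

lemma kap_high:
  assumes "t \<ge> 2" shows "kap t = 3/2" "kap1 t = 0" "kap2 t = 0"
proof -
  have e: "posp 1 n t = (t - 1) ^ n" "posp (3/2) n t = (t - 3/2) ^ n" "posp 2 n t = (t - 2) ^ n" for n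
    using assms by (auto simp: posp_def max_def)
  show "kap t = 3/2" "kap1 t = 0" "kap2 t = 0"
    unfolding kap_def kap1_def kap2_def e
    by (simp_all add: power2_eq_square power3_eq_cube field_simps)
qed

text \<open>The interval [5/4, 7/4] is where the tent has at least half its height. It is the range
  of the rescaled fundamental solution on the balls of the mass bound.\<close>

lemma kap2_bounds: "kap2 t \<le> 0" "- 2 \<le> kap2 t" "5/4 \<le> t \<Longrightarrow> t \<le> 7/4 \<Longrightarrow> kap2 t \<le> -1"
  by (auto simp: kap2_def posp_def max_def)

lemma kap1_bounds: "0 \<le> kap1 t" "kap1 t \<le> 1"
proof -
  have d: "kap1 b \<le> kap1 a" if "a \<le> b" for a b
    by (rule DERIV_nonpos_imp_nonincreasing[OF that]) (use DERIV_kap1 kap2_bounds(1) in blast)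
  show "0 \<le> kap1 t" using d[of t "max t 2"] kap_high(2)[of "max t 2"] by simp
  show "kap1 t \<le> 1" using d[of "min t 1" t] kap_low(2)[of "min t 1"] by simp
qed

lemma kap_mono: "a \<le> b \<Longrightarrow> kap a \<le> kap b"
  by (rule DERIV_nonneg_imp_nondecreasing[where f=kap]) (use DERIV_kap kap1_bounds(1) in blast)+

lemma kap_le: "kap t \<le> 3/2"
  using kap_mono[of t "max t 2"] kap_high(1)[of "max t 2"] by simp

lemma kap_nonneg: "0 \<le> t \<Longrightarrow> 0 \<le> kap t"
  using kap_mono[of 0 t] kap_low(1)[of 0] by simp

text \<open>The combination vanishes for \<open>t \<le> 1\<close> and for \<open>t \<ge> 2 * n\<close>, and beyond \<open>t = 4\<close> it descends convexly
  from \<open>3/2\<close>; composed with the fundamental solution it gives test functions that are subharmonic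
  near the singularity.\<close>
definition psi :: "real \<Rightarrow> real \<Rightarrow> real" where
  "psi n t = (2 - n)/n * kap t + 2*(n - 1)/n * kap (t/2) - kap (t/n)"
definition psi1 :: "real \<Rightarrow> real \<Rightarrow> real" where
  "psi1 n t = (2 - n)/n * kap1 t + (n - 1)/n * kap1 (t/2) - kap1 (t/n) / n"
definition psi2 :: "real \<Rightarrow> real \<Rightarrow> real" where
  "psi2 n t = (2 - n)/n * kap2 t + (n - 1)/(2*n) * kap2 (t/2) - kap2 (t/n) / n\<^sup>2"

lemma DERIV_psi:
  assumes "n > 0" shows "(psi n has_real_derivative psi1 n t) (at t)"
proof -
  have k: "((\<lambda>t. kap (t/c)) has_real_derivative kap1 (t/c) / c) (at t)" if "c \<noteq> 0" for c
    using DERIV_chain2[of kap, OF DERIV_kap, of "\<lambda>t. t/c" "1/c" t UNIV] that DERIV_cdivide[OF DERIV_ident, where c=c]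
    by simp
  show ?thesis
    unfolding psi_def[abs_def] psi1_def
    by (rule DERIV_cong[OF DERIV_diff[OF DERIV_add[OF DERIV_cmult[OF DERIV_kap] DERIV_cmult[OF k[of 2]]] k[of n]]])
      (use assms in \<open>simp_all add: field_simps\<close>)
qed

lemma DERIV_psi1:
  assumes "n > 0" shows "(psi1 n has_real_derivative psi2 n t) (at t)"
proof -
  have k: "((\<lambda>t. kap1 (t/c)) has_real_derivative kap2 (t/c) / c) (at t)" if "c \<noteq> 0" for c
    using DERIV_chain2[of kap1, OF DERIV_kap1, of "\<lambda>t. t/c" "1/c" t UNIV] that DERIV_cdivide[OF DERIV_ident, where c=c]
    by simp
  show ?thesis
    unfolding psi1_def[abs_def] psi2_def
    by (rule DERIV_cong[OF DERIV_diff[OF DERIV_add[OF DERIV_cmult[OF DERIV_kap1] DERIV_cmult[OF k[of 2]]] DERIV_cdivide[OF k[of n]]]])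
      (use assms in \<open>simp_all add: field_simps power2_eq_square\<close>)
qed

lemma continuous_psi2: "n > 0 \<Longrightarrow> continuous_on S (psi2 n)"
  unfolding psi2_def[abs_def]
  by (intro continuous_intros continuous_kap2 continuous_on_compose2[OF continuous_kap2[of UNIV]]) auto

text \<open>For small arguments the three summands have slopes \<open>(2 - n)/n\<close>,
  \<open>(n - 1)/n\<close> and \<open>- 1/n\<close>, which cancel; for large ones the plateaus,
  proportional to \<open>(2 - n)/n\<close>, \<open>2*(n - 1)/n\<close> and \<open>- 1\<close>,
  cancel as well (\<open>psi_top\<close>). With \<open>n \<ge> 4\<close> the last summand starts to
  bend, on [n, 2n], only after the first two have settled at \<open>t = 4\<close>.\<close>

lemma psi_low:
  assumes "n \<ge> 4" "t \<le> 1" shows "psi n t = 0" "psi2 n t = 0"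
proof -
  have "t/n \<le> 1" "t / 2 \<le> 1" using assms by (auto simp: divide_le_eq)
  then show "psi n t = 0" "psi2 n t = 0"
    using assms by (auto simp: psi_def psi2_def kap_low field_simps)
qed

lemma psi_top:
  assumes "n \<ge> 4" "t \<ge> 2 * n" shows "psi n t = 0"
proof -
  have "t/n \<ge> 2" "t / 2 \<ge> 2" "t \<ge> 2" using assms by (auto simp: field_simps)
  then show ?thesis using assms by (simp add: psi_def kap_high field_simps)
qed

lemma psi_high:
  assumes "n \<ge> 4" "t \<ge> 4" shows "psi n t = 3/2 - kap (t/n)" "psi2 n t = - kap2 (t/n) / n\<^sup>2"
  using assms by (auto simp: psi_def psi2_def kap_high field_simps)

text \<open>The point is that the bounds do not depend on \<open>n\<close>: they control the
  transition zone, which stays in place while \<open>n\<close> varies.\<close>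

lemma psi_mid:
  assumes "n \<ge> 4" "0 \<le> t" shows "\<bar>psi n t\<bar> \<le> 6" "\<bar>psi2 n t\<bar> \<le> 4"
proof -
  have c: "\<bar>(2 - n)/n\<bar> \<le> 1" "\<bar>2*(n - 1)/n\<bar> \<le> 2" "\<bar>(n - 1)/(2*n)\<bar> \<le> 1" "\<bar>1/n\<^sup>2\<bar> \<le> 1"
    using assms by (auto simp: abs_le_iff field_simps)
  have k: "\<bar>kap s\<bar> \<le> 3/2" if "s \<ge> 0" for s using kap_le[of s] kap_nonneg[OF that] by simp
  have k2: "\<bar>kap2 s\<bar> \<le> 2" for s using kap2_bounds[of s] by simp
  have p: "\<bar>(2 - n)/n * kap t\<bar> \<le> 1 * (3/2)" "\<bar>2*(n - 1)/n * kap (t/2)\<bar> \<le> 2 * (3/2)" "\<bar>kap (t/n)\<bar> \<le> 3/2"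
    unfolding abs_mult using c k assms by (intro mult_mono; simp)+ (use k assms in auto)
  then show "\<bar>psi n t\<bar> \<le> 6" unfolding psi_def by linarith
  have e: "n * n \<ge> 16" using mult_mono[of 4 n 4 n] assms by simp
  have "\<bar>(2 - n)/n * kap2 t\<bar> \<le> 1 * 2" "\<bar>(n - 1)/(2*n) * kap2 (t/2)\<bar> \<le> 1/2 * 2"
    unfolding abs_mult using c k2 assms by (intro mult_mono; simp add: field_simps)+
  moreover have "\<bar>kap2 (t/n) / n\<^sup>2\<bar> \<le> 2 / 16"
    unfolding abs_divide using k2 e by (intro frac_le) (auto simp: power2_eq_square)
  ultimately show "\<bar>psi2 n t\<bar> \<le> 4" unfolding psi2_def by linarith
qed

section \<open>The fundamental solution of the Laplacian\<close>

text \<open>The radial fundamental solution is \<open>fsol m |x|\<^sup>2\<close>, normalised so that its radial derivative is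
  \<open>- |x| powr (1 - m)\<close>; at the origin it takes the junk value 0.\<close>
definition fsol :: "real \<Rightarrow> real \<Rightarrow> real" where
  "fsol m s = (if m = 2 then - ln s / 2 else s powr (1 - m/2) / (m - 2))"

lemma fsol_0 [simp]: "fsol m 0 = 0" by (simp add: fsol_def)

lemma DERIV_fsol:
  assumes "s > 0" shows "(fsol m has_real_derivative - (1/2) * s powr (- m/2)) (at s)"
proof (cases "m = 2")
  case True
  then have "fsol m = (\<lambda>s. - ln s / 2)" by (auto simp: fsol_def)
  moreover have "((\<lambda>s. - ln s / 2) has_real_derivative - (1/s) / 2) (at s)"
    using assms by (auto intro!: derivative_eq_intros)
  moreover have "s powr (- m/2) = 1/s"
  proof -
    have "- m/2 = - 1" using True by simp
    then show ?thesis using powr_minus_divide[of s 1] assms by (simp only: powr_one)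
  qed
  then have "- (1/s) / 2 = - (1/2) * s powr (- m/2)" by (simp only:) simp
  ultimately show ?thesis by (simp only:)
next
  case False
  then have "fsol m = (\<lambda>s. s powr (1 - m/2) / (m - 2))" by (auto simp: fsol_def)
  moreover have "((\<lambda>s. s powr (1 - m/2) / (m - 2)) has_real_derivative
      ((1 - m/2) * s powr (1 - m/2 - 1)) / (m - 2)) (at s)"
    by (rule DERIV_cdivide[OF has_real_derivative_powr[OF assms]])
  moreover have "((1 - m/2) * s powr (1 - m/2 - 1)) / (m - 2) = - (1/2) * s powr (- m/2)"
    using False by (simp add: field_simps)
  ultimately show ?thesis by simp
qed

lemma DERIV_fsol1:
  assumes "s > 0"
  shows "((\<lambda>s. - (1/2) * s powr (- m/2)) has_real_derivative m/4 * s powr (- m/2 - 1)) (at s)"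
  using assms by (auto intro!: derivative_eq_intros)

lemma fsol_antimono: "0 < s \<Longrightarrow> s \<le> t \<Longrightarrow> fsol m t \<le> fsol m s"
  by (rule DERIV_nonpos_imp_nonincreasing)
     (auto intro!: exI[of _ "- (1/2) * _ powr (- m/2)"] DERIV_fsol)

lemma fsol_tendsto:
  assumes "m \<ge> 2" shows "filterlim (fsol m) at_top (at_right 0)"
proof (cases "m = 2")
  case True
  then have "fsol m = (\<lambda>s. - ln s / 2)" by (auto simp: fsol_def)
  then show ?thesis by (simp, real_asymp)
next
  case False
  with assms have "1 - m/2 < 0" "m - 2 > 0" by auto
  moreover from False have "fsol m = (\<lambda>s. s powr (1 - m/2) / (m - 2))" by (auto simp: fsol_def)
  ultimately show ?thesis by (simp only:, real_asymp)
qed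

text \<open>The factors 5/6 and 7/6 carry 3/2 to 5/4 and 7/4, the window of
  \<open>kap2_bounds\<close>. For \<open>m = 2\<close> a bounded ratio of the arguments changes the
  logarithm by a bounded amount, so \<theta> = 1/2 works once \<open>s\<close> is small; otherwise
  the function is a pure power and a small \<theta> works for all \<open>s\<close>.\<close>

lemma fsol_slowly_varying:
  assumes "m \<ge> 2"
  obtains \<theta> r where "0 < \<theta>" "\<theta> \<le> 1/2" "0 < r" "r \<le> 1"
    "\<And>s t. 0 < s \<Longrightarrow> s < r \<Longrightarrow> (1 - \<theta>)\<^sup>2 * s \<le> t \<Longrightarrow> t \<le> (1 + \<theta>)\<^sup>2 * s \<Longrightarrow>
      5/6 * fsol m s \<le> fsol m t \<and> fsol m t \<le> 7/6 * fsol m s"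
proof (cases "m = 2")
  case True
  have l: "\<forall>\<^sub>F s in at_right 0. - ln s / 2 > 6 * ln (2::real)" by real_asymp
  then obtain r where r: "r > 0" "\<And>s. 0 < s \<Longrightarrow> s < r \<Longrightarrow> - ln s / 2 > 6 * ln (2::real)"
    unfolding eventually_at_right_field by auto
  show ?thesis
  proof (rule that[of "1/2" "min r 1"])
    fix s t :: real
    assume s: "0 < s" "s < min r 1" and t: "(1 - 1/2)\<^sup>2 * s \<le> t" "t \<le> (1 + 1/2)\<^sup>2 * s"
    have t': "s / 4 \<le> t" "t \<le> 4 * s" using t s by (auto simp: power2_eq_square)
    have "ln (s/4) \<le> ln t" "ln t \<le> ln (4 * s)" using t' s by (auto intro!: ln_mono)
    moreover have "ln (s/4) = ln s - 2 * ln 2" "ln (4 * s) = 2 * ln 2 + ln s"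
      using s ln_realpow[of 2 2] by (auto simp: ln_div ln_mult)
    ultimately show "5/6 * fsol m s \<le> fsol m t \<and> fsol m t \<le> 7/6 * fsol m s"
      using r(2)[of s] s True by (simp add: fsol_def)
  qed (use r in auto)
next
  case False
  define a where "a = 1 - m/2"
  have a: "a < 0" using False assms by (auto simp: a_def)
  have c: "((\<lambda>\<theta>::real. (1 + \<theta>) powr (2 * a)) \<longlongrightarrow> 1) (at_right 0)"
    "((\<lambda>\<theta>::real. (1 - \<theta>) powr (2 * a)) \<longlongrightarrow> 1) (at_right 0)"
    by real_asymp+
  have "\<forall>\<^sub>F \<theta> in at_right 0. (1 + \<theta>) powr (2 * a) > 5/6" "\<forall>\<^sub>F \<theta> in at_right 0. (1 - \<theta>) powr (2 * a) < 7/6"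
    by (rule order_tendstoD[OF c(1)], simp, rule order_tendstoD[OF c(2)], simp)
  moreover have "\<forall>\<^sub>F \<theta> in at_right 0. \<theta> < 1/2 \<and> \<theta> > (0::real)"
    unfolding eventually_at_right_field by (auto intro!: exI[of _ "1/2"])
  ultimately have "\<forall>\<^sub>F \<theta> in at_right 0. (1 + \<theta>) powr (2 * a) > 5/6 \<and> (1 - \<theta>) powr (2 * a) < 7/6 \<and> \<theta> < 1/2 \<and> \<theta> > (0::real)"
    by eventually_elim auto
  then obtain \<theta> :: real where \<theta>: "(1 + \<theta>) powr (2 * a) > 5/6" "(1 - \<theta>) powr (2 * a) < 7/6" "\<theta> < 1/2" "\<theta> > 0"
    using eventually_happens'[OF trivial_limit_at_right_real] by blast
  show ?thesis
  proof (rule that[of \<theta> 1])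
    fix s t :: real
    assume s: "0 < s" "s < 1" and t: "(1 - \<theta>)\<^sup>2 * s \<le> t" "t \<le> (1 + \<theta>)\<^sup>2 * s"
    have sq: "q\<^sup>2 powr a = q powr (2 * a)" if "q > 0" for q :: real
      using that by (simp add: powr_powr flip: powr_numeral)
    have p: "(1 - \<theta>)\<^sup>2 * s > 0" "(1 + \<theta>)\<^sup>2 * s > 0" using s \<theta> by auto
    with t have "t > 0" by linarith
    have "t powr a \<le> ((1 - \<theta>)\<^sup>2 * s) powr a" "((1 + \<theta>)\<^sup>2 * s) powr a \<le> t powr a"
      using a t p \<open>t > 0\<close> by (auto intro!: powr_mono2')
    then have "t powr a \<le> (1 - \<theta>) powr (2 * a) * s powr a" "(1 + \<theta>) powr (2 * a) * s powr a \<le> t powr a"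
      using \<theta> s by (auto simp: powr_mult sq)
    moreover have "(1 - \<theta>) powr (2 * a) * s powr a \<le> 7/6 * s powr a" "5/6 * s powr a \<le> (1 + \<theta>) powr (2 * a) * s powr a"
      using \<theta> mult_right_mono[of "(1 - \<theta>) powr (2 * a)" "7/6" "s powr a"]
        mult_right_mono[of "5/6" "(1 + \<theta>) powr (2 * a)" "s powr a"] by auto
    ultimately have "5/6 * s powr a \<le> t powr a" "t powr a \<le> 7/6 * s powr a" by auto
    moreover have "m - 2 > 0" using False assms by auto
    ultimately have "5/6 * s powr a / (m - 2) \<le> t powr a / (m - 2)" "t powr a / (m - 2) \<le> 7/6 * s powr a / (m - 2)"
      by (intro divide_right_mono; linarith)+
    then show "5/6 * fsol m s \<le> fsol m t \<and> fsol m t \<le> 7/6 * fsol m s"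
      using False by (simp add: fsol_def a_def[symmetric])
  qed (use \<theta> in auto)
qed

lemma fsol_le_powr:
  assumes "m \<ge> 2" "a > m - 2"
  obtains r where "r > 0" "\<And>s. 0 < s \<Longrightarrow> s < r \<Longrightarrow> fsol m s \<le> s powr (- a/2)"
proof -
  have "\<forall>\<^sub>F s in at_right 0. fsol m s \<le> s powr (- a/2)"
  proof (cases "m = 2")
    case True
    then have "a > 0" "fsol m = (\<lambda>s. - ln s / 2)" using assms by (auto simp: fsol_def)
    then show ?thesis by (simp only:, real_asymp)
  next
    case False
    then have "fsol m = (\<lambda>s. s powr (1 - m/2) / (m - 2))" "m - 2 > 0" using assms by (auto simp: fsol_def)
    moreover have "((\<lambda>s. s powr (a/2 + 1 - m/2)) \<longlongrightarrow> 0) (at_right 0)"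
    proof -
      have "a/2 + 1 - m/2 > 0" using assms by auto
      then show ?thesis by real_asymp
    qed
    then have "\<forall>\<^sub>F s in at_right 0. s powr (a/2 + 1 - m/2) < m - 2"
      using \<open>m - 2 > 0\<close> by (intro order_tendstoD) auto
    then have "\<forall>\<^sub>F s in at_right 0. s powr (1 - m/2) / (m - 2) \<le> s powr (- a/2)"
      using eventually_at_right_less[of "0::real"]
    proof eventually_elim
      case (elim s)
      have "s powr (1 - m/2) = s powr (a/2 + 1 - m/2) * s powr (- a/2)"
        by (simp flip: powr_add)
      also have "\<dots> \<le> (m - 2) * s powr (- a/2)" using elim by (intro mult_right_mono) auto
      finally show ?case using \<open>m - 2 > 0\<close> by (simp add: field_simps)
    qed
    ultimately show ?thesis by simp
  qed
  then show ?thesis using that unfolding eventually_at_right_field by auto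
qed


section \<open>Regularised fundamental solutions\<close>

definition tay :: "real \<Rightarrow> real \<Rightarrow> real \<Rightarrow> real" where
  "tay m S s = fsol m S - 1/2 * S powr (- m/2) * (s - S) + m/8 * S powr (- m/2 - 1) * (s - S)\<^sup>2"

text \<open>Replacing the singular part below \<open>S\<close> by the second-order Taylor polynomial keeps the function
  twice continuously differentiable and makes \<open>- \<Delta>\<close> a nonnegative multiple of \<open>(S - |x|\<^sup>2)\<^sub>+\<close>.\<close>
definition gam :: "real \<Rightarrow> real \<Rightarrow> real \<Rightarrow> real" where
  "gam m S s = (if s \<ge> S then fsol m s else tay m S s)"
definition gam1 :: "real \<Rightarrow> real \<Rightarrow> real \<Rightarrow> real" where
  "gam1 m S s = (if s \<ge> S then - (1/2) * s powr (- m/2)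
     else - (1/2) * S powr (- m/2) + m/4 * S powr (- m/2 - 1) * (s - S))"
definition gam2 :: "real \<Rightarrow> real \<Rightarrow> real \<Rightarrow> real" where
  "gam2 m S s = (m/4) * (max S s) powr (- m/2 - 1)"

lemma DERIV_gam:
  assumes "S > 0" shows "(gam m S has_real_derivative gam1 m S s) (at s)"
proof -
  have t: "(tay m S has_real_derivative - (1/2) * S powr (- m/2) + m/4 * S powr (- m/2 - 1) * (s - S)) (at s)"
    unfolding tay_def[abs_def] by (auto intro!: derivative_eq_intros simp: field_simps)
  have "fsol m S = tay m S S" by (simp add: tay_def)
  then show ?thesis unfolding gam_def[abs_def] gam1_def
    by (intro DERIV_glue[where g'="\<lambda>s. - (1/2) * s powr (- m/2)"
        and f'="\<lambda>s. - (1/2) * S powr (- m/2) + m/4 * S powr (- m/2 - 1) * (s - S)"])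
       (use t assms DERIV_fsol[of s m] in auto)
qed

lemma DERIV_gam1:
  assumes "S > 0" shows "(gam1 m S has_real_derivative gam2 m S s) (at s)"
proof -
  have e: "gam2 m S s = (if s \<ge> S then m/4 * s powr (- m/2 - 1) else m/4 * S powr (- m/2 - 1))"
    by (auto simp: gam2_def max_def)
  have t: "((\<lambda>s. - (1/2) * S powr (- m/2) + m/4 * S powr (- m/2 - 1) * (s - S)) has_real_derivative
    m/4 * S powr (- m/2 - 1)) (at s)"
    by (auto intro!: derivative_eq_intros simp: field_simps)
  show ?thesis unfolding gam1_def[abs_def] e
    by (rule DERIV_glue[where g'="\<lambda>s. m/4 * s powr (- m/2 - 1)" and f'="\<lambda>s. m/4 * S powr (- m/2 - 1)"])
       (use t assms DERIV_fsol1[of s m] in auto)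
qed

lemma continuous_gam2: "S > 0 \<Longrightarrow> continuous_on A (gam2 m S)"
  unfolding gam2_def[abs_def] by (intro continuous_intros) auto

lemma gam_laplacian:
  assumes "S > 0" "s \<ge> 0"
  shows "4 * s * gam2 m S s + 2 * m * gam1 m S s = - (m * (m + 2) / 2) * S powr (- m/2 - 1) * max 0 (S - s)"
proof -
  have p: "t powr (- m/2) = t * t powr (- m/2 - 1)" if "t > 0" for t :: real
    using that by (simp add: powr_diff)
  show ?thesis
  proof (cases "s \<ge> S")
    case True
    then have "s > 0" using assms by simp
    have "4 * s * gam2 m S s + 2 * m * gam1 m S s = m * (s * s powr (- m/2 - 1)) - m * s powr (- m/2)"
      using True by (simp add: gam2_def gam1_def max_def)
    also have "\<dots> = 0" using p[OF \<open>s > 0\<close>] by simp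
    finally show ?thesis using True by simp
  next
    case False
    obtain P where P: "S powr (- m/2 - 1) = P" "S powr (- m/2) = S * P" using p[OF assms(1)] by simp
    have "gam2 m S s = m/4 * P" using False P(1) by (simp add: gam2_def max_def)
    moreover have "max 0 (S - s) = S - s" using False by simp
    moreover have "gam1 m S s = - (1/2) * (S * P) + m/4 * P * (s - S)"
      using False unfolding gam1_def P by simp
    ultimately show ?thesis unfolding P by (simp only:) (simp add: field_simps)
  qed
qed

text \<open>Differentiating a Taylor polynomial with respect to its point of expansion makes all
  terms telescope except the one with the next derivative, here f'''(S) (s - S)^2 / 2, and the third
  derivative of the fundamental solution is nonpositive.\<close>

lemma tay_antimono:
  assumes "m \<ge> 0" "0 < S" "S \<le> T" shows "tay m T s \<le> tay m S s"
proof (rule DERIV_nonpos_imp_nonincreasing[where f="\<lambda>S. tay m S s", OF assms(3)])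
  fix x assume "S \<le> x" "x \<le> T"
  then have x: "x > 0" using assms by simp
  define P where "P = x powr (- m/2)"
  define R where "R = x powr (- m/2 - 1)"
  define W where "W = x powr (- m/2 - 1 - 1)"
  have d1: "((\<lambda>S. s - S) has_real_derivative - 1) (at x)" by (auto intro!: derivative_eq_intros)
  have d2: "((\<lambda>S. (s - S)\<^sup>2) has_real_derivative - 2 * (s - x)) (at x)"
    by (auto intro!: derivative_eq_intros)
  have d3: "((\<lambda>S. S powr (- m/2 - 1)) has_real_derivative (- m/2 - 1) * W) (at x)"
    unfolding W_def using x by (rule has_real_derivative_powr)
  have e: "(\<lambda>S. tay m S s) = (\<lambda>S. fsol m S + (- (1/2) * S powr (- m/2)) * (s - S) + m/8 * (S powr (- m/2 - 1) * (s - S)\<^sup>2))"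
    by (auto simp: tay_def)
  have "((\<lambda>S. tay m S s) has_real_derivative m/8 * ((- m/2 - 1) * W * (s - x)\<^sup>2)) (at x)"
    unfolding e
    by (rule DERIV_cong[OF DERIV_add[OF DERIV_add[OF DERIV_fsol[OF x] DERIV_mult[OF DERIV_fsol1[OF x] d1]]
        DERIV_cmult[OF DERIV_mult[OF d3 d2]]]])
       (simp only: P_def[symmetric] R_def[symmetric], simp add: field_simps)
  moreover have "m/8 * ((- m/2 - 1) * W * (s - x)\<^sup>2) \<le> 0"
    using assms by (intro mult_nonneg_nonpos mult_nonpos_nonneg) (auto simp: W_def)
  ultimately show "\<exists>y. ((\<lambda>S. tay m S s) has_real_derivative y) (at x) \<and> y \<le> 0" by blast
qed

text \<open>Both branches of \<open>gam\<close> are the Taylor polynomial expanded at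
  \<open>max S s\<close>, so monotonicity in the point of expansion is all that is needed.\<close>

lemma gam_antimono:
  assumes "m \<ge> 0" "0 < S" "S \<le> T" shows "gam m T s \<le> gam m S s"
proof -
  have e: "gam m S s = tay m (max S s) s" for S by (auto simp: gam_def tay_def max_def)
  show ?thesis unfolding e using assms by (intro tay_antimono) auto
qed

lemma fsol_nonneg: "m \<ge> 2 \<Longrightarrow> 0 < s \<Longrightarrow> s \<le> 1 \<Longrightarrow> 0 \<le> fsol m s"
  by (simp add: fsol_def)

text \<open>The upper bound is the value of \<open>gam\<close> at \<open>s = 0\<close>. The
  restriction to arguments up to 1 fixes the sign of the logarithm in dimension two.\<close>

lemma gam_bounds:
  assumes "m \<ge> 2" "0 < S" "S \<le> 1" "0 \<le> s" "s \<le> 1"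
  shows "0 \<le> gam m S s" "gam m S s \<le> fsol m S + (1/2 + m/8) * S powr (1 - m/2)"
proof -
  have f: "0 \<le> fsol m S" using assms by (intro fsol_nonneg)
  have p: "S powr (- m/2) * S = S powr (1 - m/2)" "S powr (- m/2 - 1) * S\<^sup>2 = S powr (1 - m/2)"
    using powr_add[of S "- m/2" 1] powr_add[of S "- m/2 - 1" 2] assms by (simp_all add: algebra_simps)
  have q: "0 \<le> (1/2 + m/8) * S powr (1 - m/2)" using assms by simp
  show "0 \<le> gam m S s"
  proof (cases "s \<ge> S")
    case True
    then show ?thesis using assms by (simp add: gam_def fsol_nonneg)
  next
    case False
    have "tay m S s = fsol m S + 1/2 * S powr (- m/2) * (S - s) + m/8 * S powr (- m/2 - 1) * (s - S)\<^sup>2"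
      unfolding tay_def by (simp add: right_diff_distrib)
    moreover have "0 \<le> 1/2 * S powr (- m/2) * (S - s)" "0 \<le> m/8 * S powr (- m/2 - 1) * (s - S)\<^sup>2"
      using False assms by (auto intro!: mult_nonneg_nonneg)
    ultimately show ?thesis using False f by (simp add: gam_def)
  qed
  show "gam m S s \<le> fsol m S + (1/2 + m/8) * S powr (1 - m/2)"
  proof (cases "s \<ge> S")
    case True
    then have "gam m S s = fsol m s" "fsol m s \<le> fsol m S"
      using fsol_antimono[of S s m] assms by (auto simp: gam_def)
    with q show ?thesis by linarith
  next
    case False
    have "S powr (- m/2) * (S - s) \<le> S powr (- m/2) * S" using assms by (intro mult_left_mono) auto
    moreover have "S powr (- m/2 - 1) * (s - S)\<^sup>2 \<le> S powr (- m/2 - 1) * S\<^sup>2"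
      using assms False by (intro mult_left_mono) (auto simp: abs_le_square_iff[symmetric])
    then have "m/8 * (S powr (- m/2 - 1) * (s - S)\<^sup>2) \<le> m/8 * (S powr (- m/2 - 1) * S\<^sup>2)"
      using assms by (intro mult_left_mono) auto
    ultimately show ?thesis using False unfolding p by (simp add: gam_def tay_def field_simps)
  qed
qed

section \<open>A quantitative mean value property\<close>

text \<open>Layer cake: the integrand is the length of the set of \<open>t\<close> with
  \<open>|y - x|^2 < t < S\<close>. Exchanging the integrals leaves the volumes of balls of radius
  \<open>sqrt t\<close>, a power of \<open>t\<close>.\<close>

lemma integral_truncated_paraboloid:
  fixes x :: "real^'n::finite"
  assumes S: "S > 0"
  defines "m \<equiv> real CARD('n)"
  shows "(\<integral>y. max 0 (S - (norm (y - x))\<^sup>2) \<partial>lborel) = unit_ball_vol m * (S powr (m/2 + 1) / (m/2 + 1))"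
proof -
  let ?A = "{(t, y). (norm (y - x))\<^sup>2 < t \<and> t < S}"
  have A: "?A \<in> sets borel"
  proof -
    have "?A = {z. (norm (snd z - x))\<^sup>2 < fst z} \<inter> {z. fst z < S}" by auto
    also have "open \<dots>" by (intro open_Int open_Collect_less continuous_intros)
    finally show ?thesis by (rule borel_open)
  qed
  have Ap: "?A \<in> sets (lborel \<Otimes>\<^sub>M lborel)"
    by (subst lborel_prod) (use A in simp)
  have "(\<integral>\<^sup>+y. ennreal (max 0 (S - (norm (y - x))\<^sup>2)) \<partial>lborel) = (\<integral>\<^sup>+y. (\<integral>\<^sup>+t. indicator ?A (t, y) \<partial>lborel) \<partial>lborel)"
  proof (rule nn_integral_cong)
    fix y
    have "(\<integral>\<^sup>+t. indicator ?A (t, y) \<partial>lborel) = (\<integral>\<^sup>+t. indicator {(norm (y - x))\<^sup>2 <..< S} t \<partial>lborel)"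
      by (intro nn_integral_cong) (auto simp: indicator_def)
    also have "\<dots> = ennreal (max 0 (S - (norm (y - x))\<^sup>2))"
      by (cases "(norm (y - x))\<^sup>2 \<le> S") (auto simp: max_def)
    finally show "ennreal (max 0 (S - (norm (y - x))\<^sup>2)) = (\<integral>\<^sup>+t. indicator ?A (t, y) \<partial>lborel)" by simp
  qed
  also have "\<dots> = (\<integral>\<^sup>+t. (\<integral>\<^sup>+y. indicator ?A (t, y) \<partial>lborel) \<partial>lborel)"
    by (rule lborel_pair.Fubini'[symmetric]) (use Ap in simp)
  also have "\<dots> = (\<integral>\<^sup>+t. ennreal (unit_ball_vol m * t powr (m/2)) * indicator {0..S} t \<partial>lborel)"
  proof (rule nn_integral_cong_AE)
    have "AE t in lborel. t \<noteq> (0::real)" "AE t in lborel. t \<noteq> S" by (rule AE_lborel_singleton)+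
    then show "AE t in lborel. (\<integral>\<^sup>+y. indicator ?A (t, y) \<partial>lborel) = ennreal (unit_ball_vol m * t powr (m/2)) * indicator {0..S} t"
    proof eventually_elim
      case (elim t)
      show ?case
      proof (cases "0 < t \<and> t < S")
        case True
        have "(norm (y - x))\<^sup>2 < t \<longleftrightarrow> y \<in> ball x (sqrt t)" for y
          using True real_less_rsqrt[of "norm (y - x)" t] by (auto simp: dist_norm norm_minus_commute real_sqrt_less_iff
            intro: real_less_rsqrt dest!: real_less_lsqrt) (metis norm_ge_zero power2_less_imp_less real_sqrt_pow2 less_imp_le power_strict_mono zero_less_numeral)
        then have "(\<integral>\<^sup>+y. indicator ?A (t, y) \<partial>lborel) = (\<integral>\<^sup>+y. indicator (ball x (sqrt t)) y \<partial>lborel)"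
          using True by (intro nn_integral_cong) (auto simp: indicator_def)
        also have "\<dots> = emeasure lborel (ball x (sqrt t))" by simp
        also have "\<dots> = ennreal (unit_ball_vol m * sqrt t ^ CARD('n))"
          using True by (subst emeasure_ball) (auto simp: m_def)
        also have "sqrt t ^ CARD('n) = t powr (m/2)"
          using True by (simp add: m_def powr_half_sqrt[symmetric] powr_realpow[symmetric] powr_powr)
        finally show ?thesis using True by simp
      next
        case False
        then have "indicator ?A (t, y) = (0::ennreal)" for y
          using elim by (auto simp: indicator_def) (smt (verit) zero_le_power2)
        moreover have "t \<notin> {0..S}" using False elim by auto
        ultimately show ?thesis by simp
      qed
    qed
  qed
  also have "\<dots> = ennreal (unit_ball_vol m * (S powr (m/2 + 1) / (m/2 + 1)))"
  proof (rule nn_integral_has_integral_lebesgue')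
    show "((\<lambda>t. unit_ball_vol m * t powr (m/2)) has_integral unit_ball_vol m * (S powr (m/2 + 1) / (m/2 + 1))) {0..S}"
      using S by (intro has_integral_mult_right has_integral_powr_from_0) (auto simp: m_def add_pos_nonneg order.strict_trans2[of "-1" 0])
  qed (auto simp: m_def)
  finally have "(\<integral>\<^sup>+y. ennreal (max 0 (S - (norm (y - x))\<^sup>2)) \<partial>lborel) = ennreal (unit_ball_vol m * (S powr (m/2 + 1) / (m/2 + 1)))" .
  moreover have "0 \<le> unit_ball_vol m * (S powr (m/2 + 1) / (m/2 + 1))" by (simp add: m_def)
  ultimately show ?thesis
    by (subst integral_eq_nn_integral) auto
qed

text \<open>Minus the Laplacian of \<open>gam m S (|x|^2)\<close> in dimension \<open>m\<close>: a
  continuous bump on the ball of radius \<open>sqrt S\<close> whose total mass is the area of the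
  unit sphere for every \<open>S\<close>. Integrals against it take the place of spherical
  means.\<close>

definition eta :: "real \<Rightarrow> real \<Rightarrow> real \<Rightarrow> real" where
  "eta m S s = m * (m + 2) / 2 * S powr (- m/2 - 1) * max 0 (S - s)"

lemma integral_eta:
  fixes x :: "real^'n::finite"
  assumes S: "S > 0"
  defines "m \<equiv> real CARD('n)"
  shows "(\<integral>y. eta m S ((norm (y - x))\<^sup>2) \<partial>lborel) = m * unit_ball_vol m"
proof -
  have m: "m > 0" by (simp add: m_def)
  have "S powr (- m/2 - 1) * S powr (m/2 + 1) = 1" using S by (simp flip: powr_add)
  moreover have "(\<integral>y. eta m S ((norm (y - x))\<^sup>2) \<partial>lborel) =
      m * (m + 2) / 2 * S powr (- m/2 - 1) * (unit_ball_vol m * (S powr (m/2 + 1) / (m/2 + 1)))"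
    unfolding eta_def by (simp add: integral_truncated_paraboloid[OF S] m_def)
  moreover have "m * (m + 2) / 2 * S powr (- m/2 - 1) * (unit_ball_vol m * (S powr (m/2 + 1) / (m/2 + 1)))
    = m * unit_ball_vol m * (S powr (- m/2 - 1) * S powr (m/2 + 1))"
    using m by (simp add: divide_simps)
  ultimately show ?thesis by simp
qed

lemma eta_nonneg: "m \<ge> 0 \<Longrightarrow> 0 \<le> eta m S s"
  by (simp add: eta_def)

lemma eta_le:
  assumes "m \<ge> 0" "S > 0" "s \<ge> 0"
  shows "eta m S s \<le> m * (m + 2) / 2 * S powr (- m/2)"
proof -
  have "S powr (- m/2 - 1) * max 0 (S - s) \<le> S powr (- m/2 - 1) * S"
    using assms by (intro mult_left_mono) auto
  also have "\<dots> = S powr (- m/2)" using assms by (simp add: powr_diff)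
  finally show ?thesis unfolding eta_def mult.assoc using assms by (intro mult_left_mono) auto
qed

lemma eta_eq_0: "s \<ge> S \<Longrightarrow> eta m S s = 0"
  by (simp add: eta_def)

lemma continuous_eta: "continuous_on A (\<lambda>y. eta m S ((norm (y - x))\<^sup>2))"
  unfolding eta_def by (intro continuous_intros)

lemma integrable_supported:
  fixes g :: "'a::euclidean_space \<Rightarrow> real"
  assumes "compact K" "continuous_on K g" "\<And>x. x \<notin> K \<Longrightarrow> g x = 0"
  shows "integrable lborel g"
proof -
  have "(\<lambda>x. indicator K x *\<^sub>R g x) = g"
    using assms(3) by (auto simp: indicator_def fun_eq_iff)
  with borel_integrable_compact[OF assms(1,2)] show ?thesis by simp
qed

lemma eta_outside: "\<rho> \<ge> 0 \<Longrightarrow> y \<notin> cball x \<rho> \<Longrightarrow> eta m (\<rho>\<^sup>2) ((norm (y - x))\<^sup>2) = 0"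
  by (rule eta_eq_0) (auto simp: dist_norm norm_minus_commute intro!: power_mono)

lemma integrable_mult_eta:
  fixes x :: "real^'n::finite"
  assumes "\<rho> \<ge> 0" "continuous_on (cball x \<rho>) w"
  shows "integrable lborel (\<lambda>y. w y * eta m (\<rho>\<^sup>2) ((norm (y - x))\<^sup>2))"
  by (rule integrable_supported[of "cball x \<rho>"])
     (auto intro!: continuous_intros assms(2) continuous_eta simp: eta_outside[OF assms(1)])

lemma gam_C2:
  fixes x :: "real^'n::finite"
  assumes "S > 0"
  defines "m \<equiv> real CARD('n)"
  shows "C2_on UNIV (\<lambda>y. gam m S ((norm (y - x))\<^sup>2))"
    and "laplacian (\<lambda>y. gam m S ((norm (y - x))\<^sup>2)) y = - eta m S ((norm (y - x))\<^sup>2)"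
proof -
  note R = radial_C2[where S=UNIV and F="gam m S" and ?F1.0="gam1 m S" and ?F2.0="gam2 m S" and c=x,
      OF open_UNIV DERIV_gam[OF assms(1)] DERIV_gam1[OF assms(1)]]
  have c: "continuous_on UNIV (\<lambda>y. gam2 m S ((norm (y - x))\<^sup>2))"
    by (rule continuous_on_compose2[OF continuous_gam2[OF assms(1)]]) (auto intro!: continuous_intros)
  show "C2_on UNIV (\<lambda>y. gam m S ((norm (y - x))\<^sup>2))" by (rule R(1)[OF c])
  show "laplacian (\<lambda>y. gam m S ((norm (y - x))\<^sup>2)) y = - eta m S ((norm (y - x))\<^sup>2)"
    using R(2)[OF c, of y] gam_laplacian[OF assms(1), of "(norm (y - x))\<^sup>2" m] by (simp add: m_def eta_def)
qed

text \<open>Outside the larger radius both regularisations equal the exact fundamental solution, so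
  the difference has compact support; it is nonnegative because \<open>gam\<close> decreases in the
  radius of regularisation.\<close>

lemma gam_diff_C2:
  fixes x :: "real^'n::finite"
  assumes "0 < \<sigma>" "\<sigma> \<le> \<rho>"
  defines "m \<equiv> real CARD('n)"
  defines "\<phi> \<equiv> (\<lambda>y. gam m (\<sigma>\<^sup>2) ((norm (y - x))\<^sup>2) - gam m (\<rho>\<^sup>2) ((norm (y - x))\<^sup>2))"
  shows "C2_on UNIV \<phi>" "laplacian \<phi> y = eta m (\<rho>\<^sup>2) ((norm (y - x))\<^sup>2) - eta m (\<sigma>\<^sup>2) ((norm (y - x))\<^sup>2)"
    "0 \<le> \<phi> y" "y \<notin> cball x \<rho> \<Longrightarrow> \<phi> y = 0"
proof -
  have p: "\<sigma>\<^sup>2 > 0" "\<rho>\<^sup>2 > 0" "\<sigma>\<^sup>2 \<le> \<rho>\<^sup>2" using assms by (auto intro: power_mono)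
  show "C2_on UNIV \<phi>" unfolding \<phi>_def m_def
    by (intro C2_on_diff(1) gam_C2(1) open_UNIV p)
  show "laplacian \<phi> y = eta m (\<rho>\<^sup>2) ((norm (y - x))\<^sup>2) - eta m (\<sigma>\<^sup>2) ((norm (y - x))\<^sup>2)"
    unfolding \<phi>_def m_def
    by (subst C2_on_diff(2)[OF open_UNIV gam_C2(1)[OF p(1)] gam_C2(1)[OF p(2)] UNIV_I])
       (use gam_C2(2)[OF p(1), of x y] gam_C2(2)[OF p(2), of x y] in simp)
  show "0 \<le> \<phi> y" unfolding \<phi>_def using gam_antimono[OF _ p(1,3), of m] by (simp add: m_def)
  assume "y \<notin> cball x \<rho>"
  then have "\<rho>\<^sup>2 \<le> (norm (y - x))\<^sup>2" using assms(1,2) by (auto simp: dist_norm norm_minus_commute intro!: power_mono)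
  then show "\<phi> y = 0" using p by (simp add: \<phi>_def gam_def)
qed

lemma norm_sq_C2:
  fixes x :: "real^'n::finite"
  shows "C2_on UNIV (\<lambda>y. (norm (y - x))\<^sup>2)" "laplacian (\<lambda>y. (norm (y - x))\<^sup>2) y = 2 * real CARD('n)"
proof -
  note R = radial_C2[where S=UNIV and F="\<lambda>s. s" and ?F1.0="\<lambda>s. 1" and ?F2.0="\<lambda>s. 0" and c=x,
      OF open_UNIV]
  show "C2_on UNIV (\<lambda>y. (norm (y - x))\<^sup>2)" by (rule R(1)) (auto intro!: derivative_eq_intros)
  have "laplacian (\<lambda>y. (norm (y - x))\<^sup>2) y = 4 * (norm (y - x))\<^sup>2 * 0 + 2 * real CARD('n) * 1"
    by (rule R(2)) (auto intro!: derivative_eq_intros)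
  then show "laplacian (\<lambda>y. (norm (y - x))\<^sup>2) y = 2 * real CARD('n)" by simp
qed

text \<open>Green's identity with the test function \<phi> of \<open>gam_diff_C2\<close> turns the
  difference of the two averages into the integral of \<phi> times the Laplacian of
  \<open>w\<close>. The remaining task is the integral of \<phi>.\<close>

lemma mean_value_two_radii:
  fixes w :: "real^'n::finite \<Rightarrow> real"
  assumes U: "open U" "C2_on U w" "cball x \<rho> \<subseteq> U" and \<sigma>: "0 < \<sigma>" "\<sigma> \<le> \<rho>"
    and K: "\<And>y. y \<in> cball x \<rho> \<Longrightarrow> \<bar>laplacian w y\<bar> \<le> K"
  defines "m \<equiv> real CARD('n)"
  shows "\<bar>(\<integral>y. w y * eta m (\<sigma>\<^sup>2) ((norm (y - x))\<^sup>2) \<partial>lborel) - (\<integral>y. w y * eta m (\<rho>\<^sup>2) ((norm (y - x))\<^sup>2) \<partial>lborel)\<bar>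
    \<le> K * \<rho>\<^sup>2 * unit_ball_vol m / 2"
proof -
  define \<phi> where "\<phi> = (\<lambda>y::real^'n. gam m (\<sigma>\<^sup>2) ((norm (y - x))\<^sup>2) - gam m (\<rho>\<^sup>2) ((norm (y - x))\<^sup>2))"
  let ?e = "\<lambda>\<rho> y::real^'n. eta m (\<rho>\<^sup>2) ((norm (y - x))\<^sup>2)"
  have P: "C2_on UNIV \<phi>" "\<And>y. laplacian \<phi> y = ?e \<rho> y - ?e \<sigma> y" "\<And>y. 0 \<le> \<phi> y"
    "\<And>y. y \<notin> cball x \<rho> \<Longrightarrow> \<phi> y = 0"
    using gam_diff_C2[OF \<sigma>, where x=x] by (simp_all add: \<phi>_def m_def)
  have \<rho>: "\<rho> > 0" using \<sigma> by simp
  have cw: "continuous_on (cball x \<rho>) w" using C2_onD(1)[OF U(2)] U(3) by (rule continuous_on_subset)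
  have cw': "continuous_on (cball x \<sigma>) w" using cw \<sigma> by (auto intro: continuous_on_subset)
  have c\<phi>: "continuous_on A \<phi>" for A using C2_onD(1)[OF P(1)] by (rule continuous_on_subset) auto
  have i\<phi>: "integrable lborel \<phi>"
    by (rule integrable_supported[OF compact_cball c\<phi> P(4)])
  \<comment> \<open>Testing \<phi> against \<open>|y - x|^2\<close>, whose Laplacian is the constant
    \<open>2 m\<close>, expresses the integral of \<phi> through second moments of
    \<open>eta\<close>; no radial integration is required.\<close>
  note G1 = green_identity[OF open_UNIV compact_cball subset_UNIV P(4) norm_sq_C2(1) P(1), of x, unfolded norm_sq_C2(2)]
  have n: "integrable lborel (\<lambda>y. (norm (y - x))\<^sup>2 * ?e r y)" if "r \<ge> 0" for r
    using that by (intro integrable_mult_eta continuous_intros)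
  have "0 = (\<integral>y. ((norm (y - x))\<^sup>2 * ?e \<rho> y - (norm (y - x))\<^sup>2 * ?e \<sigma> y) - 2 * m * \<phi> y \<partial>lborel)"
    using G1(2) by (simp add: P(2) m_def algebra_simps)
  also have "\<dots> = (\<integral>y. (norm (y - x))\<^sup>2 * ?e \<rho> y \<partial>lborel) - (\<integral>y. (norm (y - x))\<^sup>2 * ?e \<sigma> y \<partial>lborel) - 2 * m * (\<integral>y. \<phi> y \<partial>lborel)"
    using n[of \<rho>] n[of \<sigma>] i\<phi> \<sigma> by simp
  finally have a: "2 * m * (\<integral>y. \<phi> y \<partial>lborel) = (\<integral>y. (norm (y - x))\<^sup>2 * ?e \<rho> y \<partial>lborel) - (\<integral>y. (norm (y - x))\<^sup>2 * ?e \<sigma> y \<partial>lborel)"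
    by simp
  have m: "m > 0" by (simp add: m_def)
  have "0 \<le> (\<integral>y. (norm (y - x))\<^sup>2 * ?e \<sigma> y \<partial>lborel)"
    using m by (intro Bochner_Integration.integral_nonneg mult_nonneg_nonneg eta_nonneg) auto
  moreover have "(\<integral>y. (norm (y - x))\<^sup>2 * ?e \<rho> y \<partial>lborel) \<le> (\<integral>y. \<rho>\<^sup>2 * ?e \<rho> y \<partial>lborel)"
  proof (rule integral_mono)
    show "integrable lborel (\<lambda>y. \<rho>\<^sup>2 * ?e \<rho> y)" using \<rho> by (intro integrable_mult_eta continuous_intros) auto
    show "(norm (y - x))\<^sup>2 * ?e \<rho> y \<le> \<rho>\<^sup>2 * ?e \<rho> y" for y
    proof (cases "y \<in> cball x \<rho>")
      case True
      then have "(norm (y - x))\<^sup>2 \<le> \<rho>\<^sup>2" by (intro power_mono) (auto simp: dist_norm norm_minus_commute)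
      then show ?thesis using m by (intro mult_right_mono eta_nonneg) auto
    qed (use \<rho> in \<open>simp add: eta_outside\<close>)
  qed (use n \<rho> in auto)
  moreover have "(\<integral>y. \<rho>\<^sup>2 * ?e \<rho> y \<partial>lborel) = \<rho>\<^sup>2 * (m * unit_ball_vol m)"
    using integral_eta[of "\<rho>\<^sup>2" x] \<rho> by (simp add: m_def)
  ultimately have "2 * m * (\<integral>y. \<phi> y \<partial>lborel) \<le> \<rho>\<^sup>2 * (m * unit_ball_vol m)" using a by linarith
  then have I: "(\<integral>y. \<phi> y \<partial>lborel) \<le> \<rho>\<^sup>2 * unit_ball_vol m / 2" using m by (simp add: field_simps)
  have K0: "K \<ge> 0" using K[of x] \<rho> abs_ge_zero[of "laplacian w x"] by (auto intro: order_trans)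
  have G2: "integrable lborel (\<lambda>y. w y * laplacian \<phi> y - \<phi> y * laplacian w y)"
    "(\<integral>y. w y * laplacian \<phi> y - \<phi> y * laplacian w y \<partial>lborel) = 0"
    by (rule green_identity[OF U(1) compact_cball U(3) _ U(2) C2_on_subset[OF P(1) subset_UNIV]], erule P(4))+
  have e1: "integrable lborel (\<lambda>y. w y * ?e \<rho> y)" and e2: "integrable lborel (\<lambda>y. w y * ?e \<sigma> y)"
    using cw cw' \<sigma> \<rho> by (auto intro!: integrable_mult_eta)
  have e: "w y * laplacian \<phi> y - \<phi> y * laplacian w y = w y * ?e \<rho> y - w y * ?e \<sigma> y - \<phi> y * laplacian w y" for y
    by (simp add: P(2) algebra_simps)
  have i3: "integrable lborel (\<lambda>y. \<phi> y * laplacian w y)"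
  proof -
    have "integrable lborel (\<lambda>y. (w y * ?e \<rho> y - w y * ?e \<sigma> y) - (w y * ?e \<rho> y - w y * ?e \<sigma> y - \<phi> y * laplacian w y))"
      by (rule Bochner_Integration.integrable_diff[OF Bochner_Integration.integrable_diff[OF e1 e2] G2(1)[unfolded e]])
    then show ?thesis by simp
  qed
  have "(\<integral>y. w y * ?e \<rho> y \<partial>lborel) - (\<integral>y. w y * ?e \<sigma> y \<partial>lborel) - (\<integral>y. \<phi> y * laplacian w y \<partial>lborel) = 0"
    using G2(2) e1 e2 i3 unfolding e by simp
  then have "\<bar>(\<integral>y. w y * ?e \<sigma> y \<partial>lborel) - (\<integral>y. w y * ?e \<rho> y \<partial>lborel)\<bar> = \<bar>\<integral>y. \<phi> y * laplacian w y \<partial>lborel\<bar>"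
    by linarith
  also have "\<dots> \<le> (\<integral>y. \<bar>\<phi> y * laplacian w y\<bar> \<partial>lborel)" by (rule integral_abs_bound)
  also have "\<dots> \<le> (\<integral>y. K * \<phi> y \<partial>lborel)"
  proof (rule integral_mono)
    show "\<bar>\<phi> y * laplacian w y\<bar> \<le> K * \<phi> y" for y
    proof (cases "y \<in> cball x \<rho>")
      case True
      have "\<phi> y * \<bar>laplacian w y\<bar> \<le> \<phi> y * K" by (rule mult_left_mono[OF K[OF True] P(3)])
      then show ?thesis using P(3)[of y] by (simp add: abs_mult mult.commute)
    qed (simp add: P(4))
  qed (use i3 i\<phi> in auto)
  also have "\<dots> = K * (\<integral>y. \<phi> y \<partial>lborel)" by simp
  also have "\<dots> \<le> K * (\<rho>\<^sup>2 * unit_ball_vol m / 2)" by (rule mult_left_mono[OF I K0])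
  finally show ?thesis by (simp add: mult.assoc)
qed

text \<open>As the inner radius tends to zero, continuity makes the inner average tend to
  \<open>m * unit_ball_vol m * w x\<close>, while the bound of \<open>mean_value_two_radii\<close>
  does not involve the inner radius.\<close>

lemma mean_value_estimate:
  fixes w :: "real^'n::finite \<Rightarrow> real"
  assumes U: "open U" "C2_on U w" "cball x \<rho> \<subseteq> U" and \<rho>: "0 < \<rho>"
    and K: "\<And>y. y \<in> cball x \<rho> \<Longrightarrow> \<bar>laplacian w y\<bar> \<le> K"
  defines "m \<equiv> real CARD('n)"
  shows "\<bar>m * unit_ball_vol m * w x - (\<integral>y. w y * eta m (\<rho>\<^sup>2) ((norm (y - x))\<^sup>2) \<partial>lborel)\<bar>
    \<le> K * \<rho>\<^sup>2 * unit_ball_vol m / 2"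
proof (rule field_le_epsilon)
  fix e :: real assume "e > 0"
  let ?e = "\<lambda>\<rho> y::real^'n. eta m (\<rho>\<^sup>2) ((norm (y - x))\<^sup>2)"
  let ?c = "m * unit_ball_vol m"
  have m: "m > 0" by (simp add: m_def)
  then have c: "?c > 0" by simp
  have cw: "continuous_on (cball x \<rho>) w" using C2_onD(1)[OF U(2)] U(3) by (rule continuous_on_subset)
  have "\<exists>d>0. \<forall>y\<in>cball x \<rho>. dist y x < d \<longrightarrow> dist (w y) (w x) < e / ?c"
    using cw[unfolded continuous_on_iff] \<rho> \<open>e > 0\<close> c by (simp add: divide_pos_pos)
  then obtain d where d: "d > 0" "\<And>y. y \<in> cball x \<rho> \<Longrightarrow> dist y x < d \<Longrightarrow> \<bar>w y - w x\<bar> < e / ?c"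
    by (auto simp: dist_real_def)
  define \<sigma> where "\<sigma> = min \<rho> (d/2)"
  have \<sigma>: "0 < \<sigma>" "\<sigma> \<le> \<rho>" "\<sigma> < d" using d \<rho> by (auto simp: \<sigma>_def)
  have i1: "integrable lborel (\<lambda>y. w y * ?e \<sigma> y)"
    using cw \<sigma> by (intro integrable_mult_eta) (auto intro: continuous_on_subset)
  have i2: "integrable lborel (\<lambda>y. a * ?e \<sigma> y)" for a
    using \<sigma> by (intro integrable_mult_eta) auto
  have J: "(\<integral>y. a * ?e \<sigma> y \<partial>lborel) = a * ?c" for a
    using integral_eta[of "\<sigma>\<^sup>2" x] \<sigma> by (simp add: m_def)
  have "\<bar>?c * w x - (\<integral>y. w y * ?e \<sigma> y \<partial>lborel)\<bar> = \<bar>\<integral>y. w x * ?e \<sigma> y - w y * ?e \<sigma> y \<partial>lborel\<bar>"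
    using Bochner_Integration.integral_diff[OF i2[of "w x"] i1] J[of "w x"] by (simp only: mult.commute)
  also have "\<dots> \<le> (\<integral>y. \<bar>w x * ?e \<sigma> y - w y * ?e \<sigma> y\<bar> \<partial>lborel)" by (rule integral_abs_bound)
  also have "\<dots> \<le> (\<integral>y. e / ?c * ?e \<sigma> y \<partial>lborel)"
  proof (rule integral_mono)
    show "\<bar>w x * ?e \<sigma> y - w y * ?e \<sigma> y\<bar> \<le> e / ?c * ?e \<sigma> y" for y
    proof (cases "y \<in> cball x \<sigma>")
      case True
      then have "\<bar>w y - w x\<bar> \<le> e / ?c" using d(2)[of y] \<sigma> by (auto simp: dist_commute)
      moreover have "\<bar>w x * ?e \<sigma> y - w y * ?e \<sigma> y\<bar> = \<bar>w y - w x\<bar> * ?e \<sigma> y"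
        using eta_nonneg[of m "\<sigma>\<^sup>2" "(norm (y - x))\<^sup>2"] m
        by (simp add: left_diff_distrib[symmetric] abs_mult abs_minus_commute)
      moreover have "0 \<le> ?e \<sigma> y" using m by (simp add: eta_nonneg)
      ultimately show ?thesis by (metis mult_right_mono)
    qed (use \<sigma> in \<open>simp add: eta_outside\<close>)
  qed (use i1 i2[of "w x"] i2[of "e / ?c"] in auto)
  also have "\<dots> = e / ?c * ?c" by (rule J)
  also have "\<dots> = e" using c by (metis less_irrefl nonzero_eq_divide_eq)
  finally have "\<bar>?c * w x - (\<integral>y. w y * ?e \<sigma> y \<partial>lborel)\<bar> \<le> e" .
  with mean_value_two_radii[OF U \<sigma>(1,2) K, folded m_def]
  show "\<bar>?c * w x - (\<integral>y. w y * ?e \<rho> y \<partial>lborel)\<bar> \<le> K * \<rho>\<^sup>2 * unit_ball_vol m / 2 + e" by linarith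
qed

text \<open>Since the fundamental solution is harmonic off 0, the chain rule leaves only
  \<open>P2\<close> times the squared gradient, which is |x|^(2-2m). The sign of \<open>P2\<close>
  alone therefore decides between sub- and superharmonicity.\<close>

lemma fsol_comp_C2:
  fixes P P1 P2 :: "real \<Rightarrow> real"
  assumes P: "\<And>t. (P has_real_derivative P1 t) (at t)" "\<And>t. (P1 has_real_derivative P2 t) (at t)"
    and cP2: "continuous_on UNIV P2" and a: "a > 0"
  defines "m \<equiv> real CARD('n)"
  shows "C2_on (- {0}) (\<lambda>x::real^'n::finite. P (fsol m ((norm x)\<^sup>2) / a))"
    and "\<And>x::real^'n. x \<noteq> 0 \<Longrightarrow> laplacian (\<lambda>x. P (fsol m ((norm x)\<^sup>2) / a)) x =
      ((norm x)\<^sup>2) powr (1 - m) * P2 (fsol m ((norm x)\<^sup>2) / a) / a\<^sup>2"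
proof -
  define g1 where "g1 s = - (1/2) * s powr (- m/2)" for s :: real
  define g2 where "g2 s = m/4 * s powr (- m/2 - 1)" for s :: real
  have dg: "((\<lambda>s. fsol m s / a) has_real_derivative g1 s / a) (at s)" if "s > 0" for s
    unfolding g1_def by (rule DERIV_cdivide[OF DERIV_fsol[OF that]])
  have dg1: "((\<lambda>s. g1 s / a) has_real_derivative g2 s / a) (at s)" if "s > 0" for s
    unfolding g1_def g2_def by (rule DERIV_cdivide[OF DERIV_fsol1[OF that]])
  let ?F1 = "\<lambda>s. P1 (fsol m s / a) * (g1 s / a)"
  let ?F2 = "\<lambda>s. (P2 (fsol m s / a) * (g1 s / a)) * (g1 s / a) + (g2 s / a) * P1 (fsol m s / a)"
  have d1: "((\<lambda>s. P (fsol m s / a)) has_real_derivative ?F1 s) (at s)" if "s > 0" for s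
    by (rule DERIV_chain2[OF P(1) dg[OF that]])
  have d2: "(?F1 has_real_derivative ?F2 s) (at s)" if "s > 0" for s
    by (rule DERIV_mult[OF DERIV_chain2[OF P(2) dg[OF that]] dg1[OF that]])
  have pos: "(norm (x - 0))\<^sup>2 > 0" if "x \<in> - {0}" for x :: "real^'n" using that by simp
  have cf: "continuous_on (- {0}) (\<lambda>x::real^'n. fsol m ((norm (x - 0))\<^sup>2) / a)"
    by (rule continuous_at_imp_continuous_on, intro ballI isCont_o2[where f="\<lambda>x. (norm (x - 0))\<^sup>2" and g="\<lambda>s. fsol m s / a"])
       (auto intro!: continuous_intros DERIV_isCont[OF dg])
  have cP1: "continuous_on UNIV P1"
    by (rule continuous_at_imp_continuous_on) (auto intro!: DERIV_isCont[OF P(2)])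
  have cF2: "continuous_on (- {0}) (\<lambda>x::real^'n. ?F2 ((norm (x - 0))\<^sup>2))"
    unfolding g1_def g2_def using a
    by (intro continuous_intros continuous_on_compose2[OF cP2 cf] continuous_on_compose2[OF cP1 cf]) auto
  note R = radial_C2[where S="- {0::real^'n}" and F="\<lambda>s. P (fsol m s / a)" and ?F1.0="?F1" and ?F2.0="?F2" and c=0,
    OF _ d1[OF pos] d2[OF pos] cF2]
  show "C2_on (- {0}) (\<lambda>x::real^'n. P (fsol m ((norm x)\<^sup>2) / a))"
    using R(1) by (simp add: open_Compl)
  fix x :: "real^'n" assume x: "x \<noteq> 0"
  define s where "s = (norm x)\<^sup>2"
  have s: "s > 0" using x by (simp add: s_def)
  have l: "laplacian (\<lambda>x. P (fsol m ((norm x)\<^sup>2) / a)) x = 4 * s * ?F2 s + 2 * m * ?F1 s"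
    using R(2)[of x] x by (simp add: open_Compl s_def m_def)
  have e1: "4 * s * (g1 s)\<^sup>2 = s powr (1 - m)"
  proof -
    have "4 * s * (g1 s)\<^sup>2 = s powr 1 * s powr (- m/2) * s powr (- m/2)"
      using s by (simp add: g1_def power2_eq_square)
    also have "\<dots> = s powr (1 + - m/2 + - m/2)" by (simp only: powr_add)
    also have "1 + - m/2 + - m/2 = 1 - m" by simp
    finally show ?thesis .
  qed
  have e2: "4 * s * g2 s + 2 * m * g1 s = 0"
  proof -
    have "s * s powr (- m/2 - 1) = s powr 1 * s powr (- m/2 - 1)" using s by simp
    also have "\<dots> = s powr (- m/2)" by (simp only: powr_add[symmetric]) simp
    finally have "m * (s * s powr (- m/2 - 1)) = m * s powr (- m/2)" by (simp only:)
    then show ?thesis by (simp add: g1_def g2_def algebra_simps)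
  qed
  have "4 * s * ?F2 s + 2 * m * ?F1 s = (4 * s * (g1 s)\<^sup>2) * P2 (fsol m s / a) / a\<^sup>2 + (4 * s * g2 s + 2 * m * g1 s) * P1 (fsol m s / a) / a"
    using a by (simp add: field_simps power2_eq_square)
  then show "laplacian (\<lambda>x. P (fsol m ((norm x)\<^sup>2) / a)) x = ((norm x)\<^sup>2) powr (1 - m) * P2 (fsol m ((norm x)\<^sup>2) / a) / a\<^sup>2"
    unfolding l e1 e2 by (simp add: s_def)
qed

lemma holder_continuous_imp_continuous:
  assumes "holder_continuous f" shows "continuous_on UNIV f"
proof -
  obtain \<alpha> C where a: "\<alpha> > 0" and C: "\<And>x y. \<bar>f x - f y\<bar> \<le> C * dist x y powr \<alpha>"
    using assms unfolding holder_continuous_def by auto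
  have "(f \<longlongrightarrow> f x) (at x)" for x
  proof -
    have "((\<lambda>y. dist y x) \<longlongrightarrow> 0) (at x)"
      by (rule tendsto_eq_intros | simp)+
    then have "((\<lambda>y. dist y x powr \<alpha>) \<longlongrightarrow> 0 powr \<alpha>) (at x)"
      using a by (intro tendsto_powr') auto
    from tendsto_mult[OF tendsto_const[of C] this]
    have l: "((\<lambda>y. C * dist y x powr \<alpha>) \<longlongrightarrow> 0) (at x)" by simp
    have "\<forall>\<^sub>F y in at x. norm (f y - f x) \<le> C * dist y x powr \<alpha>"
      by (rule always_eventually) (use C in simp)
    then have "((\<lambda>y. f y - f x) \<longlongrightarrow> 0) (at x)" by (rule Lim_null_comparison[OF _ l])
    then show ?thesis by (rule Lim_null[THEN iffD2])
  qed
  then show ?thesis by (auto simp: continuous_on_def intro: tendsto_within_subset)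
qed

lemma borel_measurable_continuous_punctured:
  fixes f :: "'a::euclidean_space \<Rightarrow> real"
  assumes "continuous_on (- {0}) f" shows "f \<in> borel_measurable borel"
proof -
  have "(\<lambda>x. if x \<in> {0} then f 0 else f x) \<in> borel_measurable borel"
    using assms by (intro borel_measurable_continuous_on_if) auto
  moreover have "(\<lambda>x. if x \<in> {0} then f 0 else f x) = f" by auto
  ultimately show ?thesis by simp
qed

lemma integrable_of_nn_integral_le:
  fixes f :: "'a \<Rightarrow> real"
  assumes "f \<in> borel_measurable M" "\<And>x. 0 \<le> f x" "(\<integral>\<^sup>+x. ennreal (f x) \<partial>M) \<le> ennreal C" "C \<ge> 0"
  shows "integrable M f" "integral\<^sup>L M f \<le> C"
proof -
  show i: "integrable M f"
    using assms by (intro integrableI_nonneg) (auto simp: order_le_less_trans[OF _ ennreal_less_top])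
  show "integral\<^sup>L M f \<le> C"
    using nn_integral_eq_integral[OF i] assms by (auto simp: ennreal_le_iff)
qed

section \<open>Isolated singularities\<close>

locale singular_solution =
  fixes u Q :: "real^'n::finite \<Rightarrow> real" and p m :: real
  assumes m_eq: "m = real CARD('n)"
    and N2: "CARD('n) \<ge> 2"
    and p1: "p > 1"
    and pcrit: "CARD('n) \<ge> 3 \<Longrightarrow> p < real CARD('n) / (real CARD('n) - 2)"
    and Qhold: "holder_continuous Q"
    and Q0: "Q 0 > 0"
    and uC2: "C2_on (- {0}) u"
    and eq: "\<And>x. x \<noteq> 0 \<Longrightarrow> - laplacian u x - u x = Q x * \<bar>u x\<bar> powr (p - 1) * u x"
    and blowup: "filterlim u at_top (at 0)"
begin

abbreviation om :: real where "om \<equiv> unit_ball_vol m"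
abbreviation h :: "real^'n \<Rightarrow> real" where "h x \<equiv> fsol m ((norm x)\<^sup>2)"

text \<open>The linear term is included, so that the equation reads as a Poisson equation with a
  right-hand side that is positive near 0.\<close>

definition src :: "real^'n \<Rightarrow> real" where
  "src x = u x + Q x * \<bar>u x\<bar> powr (p - 1) * u x"

lemma m2: "m \<ge> 2" using N2 by (simp add: m_eq)

lemma om_pos: "om > 0" using m2 by simp

lemma laplacian_u: "x \<noteq> 0 \<Longrightarrow> laplacian u x = - src x"
  using eq[of x] by (simp add: src_def)

lemma continuous_u: "continuous_on (- {0}) u" using uC2 by (rule C2_onD)

lemma continuous_src: "continuous_on (- {0}) src"
proof -
  have c: "continuous_on (- {0}) (\<lambda>x. \<bar>u x\<bar> powr (p - 1))"
    by (rule continuous_on_powr') (use p1 in \<open>auto intro!: continuous_intros continuous_u\<close>)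
  then show ?thesis unfolding src_def[abs_def]
    by (intro continuous_on_add continuous_on_mult c continuous_u
        continuous_on_subset[OF holder_continuous_imp_continuous[OF Qhold] subset_UNIV])
qed

lemma measurable_u [measurable]: "u \<in> borel_measurable borel"
  and measurable_src [measurable]: "src \<in> borel_measurable borel"
  by (intro borel_measurable_continuous_punctured continuous_u continuous_src)+

lemma near_origin:
  obtains R q C where "0 < R" "R \<le> 1" "0 < q" "0 < C"
    "\<And>x. x \<noteq> 0 \<Longrightarrow> norm x \<le> R \<Longrightarrow> 1 \<le> u x \<and> u x \<le> src x \<and> q * u x powr p \<le> src x \<and> src x \<le> C * u x powr p"
proof -
  have "\<forall>\<^sub>F x in at 0. u x \<ge> 1" using blowup by (simp add: filterlim_at_top)
  then obtain d1 where d1: "d1 > 0" "\<And>x. x \<noteq> 0 \<Longrightarrow> norm x < d1 \<Longrightarrow> u x \<ge> 1"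
    unfolding eventually_at by auto
  have "isCont Q 0" using holder_continuous_imp_continuous[OF Qhold] by (simp add: continuous_on_eq_continuous_at)
  then obtain d2 where d2: "d2 > 0" "\<And>x. norm x < d2 \<Longrightarrow> \<bar>Q x - Q 0\<bar> < Q 0 / 2"
    unfolding continuous_at_eps_delta using Q0 by (metis dist_0_norm dist_commute dist_real_def half_gt_zero)
  define R where "R = min 1 (min (d1/2) (d2/2))"
  have *: "1 \<le> u x \<and> u x \<le> src x \<and> Q 0/2 * u x powr p \<le> src x \<and> src x \<le> (1 + 2 * Q 0) * u x powr p"
    if "x \<noteq> 0" "norm x \<le> R" for x
  proof -
    have u: "u x \<ge> 1" using d1 that by (auto simp: R_def)
    have Q: "Q 0 / 2 \<le> Q x" "Q x \<le> 2 * Q 0" using d2(2)[of x] d2(1) Q0 that by (auto simp: R_def abs_if split: if_splits)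
    have e: "src x = u x + Q x * u x powr p"
      using u by (simp add: src_def powr_diff)
    have "u x powr 1 \<le> u x powr p" using u p1 by (intro powr_mono) auto
    then have "u x \<le> u x powr p" using u by simp
    moreover have "Q 0/2 * u x powr p \<le> Q x * u x powr p" "Q x * u x powr p \<le> 2 * Q 0 * u x powr p"
      by (rule mult_right_mono[OF Q(1)], simp, rule mult_right_mono[OF Q(2)], simp)
    moreover have "0 \<le> Q 0/2 * u x powr p" using Q0 by simp
    ultimately show ?thesis using u unfolding e distrib_right by (intro conjI; linarith)
  qed
  show ?thesis
    by (rule that[of R "Q 0/2" "1 + 2 * Q 0"]) (use d1 d2 Q0 * in \<open>auto simp: R_def\<close>)
qed

section \<open>Integral bounds from concave truncations\<close>

lemma h_at_top: "filterlim h at_top (at 0)"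
proof -
  have "filterlim (\<lambda>x::real^'n. (norm x)\<^sup>2) (at_right 0) (at 0)"
    unfolding filterlim_at by (auto intro!: tendsto_eq_intros simp: eventually_at_filter)
  from filterlim_compose[OF fsol_tendsto[OF m2] this] show ?thesis .
qed

lemma h_large: obtains r where "r > 0" "\<And>x. x \<noteq> 0 \<Longrightarrow> norm x < r \<Longrightarrow> h x \<ge> c"
proof -
  have "\<forall>\<^sub>F x in at 0. h x \<ge> c" using h_at_top by (simp add: filterlim_at_top)
  then show ?thesis using that unfolding eventually_at by (auto simp: dist_norm)
qed

text \<open>The function \<open>psi n (h / a)\<close> lives on an annulus: the condition on
  \<open>a\<close> puts \<open>h / a\<close> below 1 outside the ball of radius \<open>R\<close>,
  and near 0 the argument exceeds \<open>2 * n\<close>. Green's identity is thus applied where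
  \<open>u\<close> is C^2, whatever \<open>u\<close> does at the origin.\<close>

lemma integral_test_identity:
  assumes n: "n \<ge> 4" and R: "R > 0" "a > 0" "fsol m (R\<^sup>2) \<le> a"
  defines "I \<equiv> (\<lambda>x. src x * psi n (h x / a) + u x * (((norm x)\<^sup>2) powr (1 - m) * psi2 n (h x / a) / a\<^sup>2))"
  shows "integrable lborel I" "integral\<^sup>L lborel I = 0" "\<And>x. x \<notin> cball 0 R \<Longrightarrow> I x = 0" "I 0 = 0"
proof -
  obtain r where r: "r > 0" "\<And>x. x \<noteq> 0 \<Longrightarrow> norm x < r \<Longrightarrow> h x \<ge> 2 * n * a" using h_large by blast
  define K where "K = cball (0::real^'n) R - ball 0 r"
  have K: "compact K" "K \<subseteq> - {0}" using r by (auto simp: K_def compact_diff)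
  have low: "h x / a \<le> 1" if "x \<notin> cball 0 R" for x
  proof -
    have "fsol m ((norm x)\<^sup>2) \<le> fsol m (R\<^sup>2)"
      using that R by (intro fsol_antimono) (auto intro: power_mono)
    then show ?thesis using R by (simp add: divide_le_eq)
  qed
  have z: "psi n (h x / a) = 0" if "x \<notin> K" for x
  proof -
    have "x = 0 \<or> (x \<noteq> 0 \<and> norm x < r) \<or> x \<notin> cball 0 R" using that by (auto simp: K_def)
    then consider "x = 0" | "x \<noteq> 0" "norm x < r" | "x \<notin> cball 0 R" by blast
    then show ?thesis
    proof cases
      case 1 then show ?thesis using psi_low[OF n, of 0] by simp
    next
      case 2
      then have "h x / a \<ge> 2 * n" using r(2) R by (simp add: le_divide_eq)
      then show ?thesis by (rule psi_top[OF n])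
    next
      case 3 then show ?thesis using psi_low[OF n low] by simp
    qed
  qed
  have np: "n > 0" using n by simp
  note C = fsol_comp_C2[OF DERIV_psi[OF np] DERIV_psi1[OF np] continuous_psi2[OF np] R(2), where 'n='n, folded m_eq]
  note G = green_identity[OF open_Compl[OF closed_singleton] K z uC2 C(1)]
  have e: "u x * laplacian (\<lambda>x. psi n (h x / a)) x - psi n (h x / a) * laplacian u x = I x" for x
  \<comment> \<open>At 0 the value of \<open>h\<close> is the default 0, where \<open>psi n\<close>
    and \<open>psi2 n\<close> vanish. Both sides are then 0, so the formula needs no
    exception.\<close>
  proof (cases "x = 0")
    case True
    have "laplacian (\<lambda>x. psi n (h x / a)) x = 0"
      by (rule laplacian_zero_open[of "- K"]) (use K True z in \<open>auto simp: open_Compl compact_imp_closed\<close>)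
    then show ?thesis using True psi_low[OF n, of 0] by (simp add: I_def)
  next
    case False
    then show ?thesis by (simp add: C(2) laplacian_u I_def)
  qed
  show "integrable lborel I" "integral\<^sup>L lborel I = 0"
    using G unfolding e by auto
  show "I x = 0" if "x \<notin> cball 0 R" for x using psi_low[OF n low[OF that]] by (simp add: I_def)
  show "I 0 = 0" using psi_low[OF n, of 0] by (simp add: I_def)
qed

text \<open>What matters is that \<open>C\<close> does not depend on \<open>n\<close>. On the small
  ball \<open>psi n\<close> has become \<open>3/2 - kap (t / n)\<close>, so both terms of the
  integrand are nonnegative; on the fixed annulus between \<open>r\<close> and \<open>R\<close> they
  are bounded by \<open>psi_mid\<close>. As the total integral is zero, the nonnegative part is
  controlled by the annulus.\<close>

lemma concavity_bound:
  obtains a r C where "0 < a" "0 < r" "r \<le> 1" "0 \<le> C" "\<And>x. x \<noteq> 0 \<Longrightarrow> norm x < r \<Longrightarrow> 4 * a \<le> h x \<and> 1 \<le> u x \<and> u x \<le> src x"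
    "\<And>n. n \<ge> 4 \<Longrightarrow> (\<integral>\<^sup>+x. ennreal (indicator (ball 0 r - {0}) x *
       (src x * (3/2 - kap (h x / a / n)) + u x * (((norm x)\<^sup>2) powr (1 - m) * - kap2 (h x / a / n) / (a\<^sup>2 * n\<^sup>2)))) \<partial>lborel) \<le> ennreal C"
proof -
  obtain R q C1 where R: "0 < R" "R \<le> 1" and nb: "\<And>x. x \<noteq> 0 \<Longrightarrow> norm x \<le> R \<Longrightarrow> 1 \<le> u x \<and> u x \<le> src x"
    by (rule near_origin) blast
  define a where "a = max 1 (fsol m (R\<^sup>2))"
  have a: "a > 0" "fsol m (R\<^sup>2) \<le> a" by (auto simp: a_def)
  obtain r0 where r0: "r0 > 0" "\<And>x. x \<noteq> 0 \<Longrightarrow> norm x < r0 \<Longrightarrow> h x \<ge> 4 * a" using h_large by blast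
  define r where "r = min r0 R"
  have r: "0 < r" "r \<le> R" "r \<le> r0" using r0 R by (auto simp: r_def)
  define A where "A = cball (0::real^'n) R - ball 0 r"
  have A: "compact A" "A \<subseteq> - {0}" using r by (auto simp: A_def compact_diff)
  let ?b = "\<lambda>x. 6 * src x + 4 * (u x * (((norm x)\<^sup>2) powr (1 - m) / a\<^sup>2))"
  have "continuous_on A ?b"
    using a A(2) by (intro continuous_intros continuous_on_subset[OF continuous_u A(2)] continuous_on_subset[OF continuous_src A(2)]) auto
  then have "bounded (?b ` A)" using A(1) by (intro compact_imp_bounded compact_continuous_image)
  then obtain B where B: "B > 0" "\<And>x. x \<in> A \<Longrightarrow> \<bar>?b x\<bar> \<le> B" unfolding bounded_pos by auto
  define C where "C = B * measure lborel A"
  have Am: "A \<in> sets lborel" "emeasure lborel A < \<infinity>"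
    using A(1) emeasure_bounded_finite[OF compact_imp_bounded[OF A(1)]] by (auto intro: borel_compact)
  have iA: "integrable lborel (\<lambda>x. B * indicator A x)" "(\<integral>x. B * indicator A x \<partial>lborel) = C"
    using Am by (auto simp: C_def intro!: integrable_mult_right integrable_real_indicator)
  have hp: "h x \<ge> 0" if "x \<noteq> 0" "norm x \<le> R" for x
    using that R by (intro fsol_nonneg[OF m2]) (auto simp: power_le_one)
  have main: "(\<integral>\<^sup>+x. ennreal (indicator (ball 0 r - {0}) x *
       (src x * (3/2 - kap (h x / a / n)) + u x * (((norm x)\<^sup>2) powr (1 - m) * - kap2 (h x / a / n) / (a\<^sup>2 * n\<^sup>2)))) \<partial>lborel) \<le> ennreal C"
    if n: "n \<ge> 4" for n
  proof -
    define I where "I x = src x * psi n (h x / a) + u x * (((norm x)\<^sup>2) powr (1 - m) * psi2 n (h x / a) / a\<^sup>2)" for x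
    note T = integral_test_identity[OF n R(1) a, folded I_def]
    have Iin: "I x = src x * (3/2 - kap (h x / a / n)) + u x * (((norm x)\<^sup>2) powr (1 - m) * - kap2 (h x / a / n) / (a\<^sup>2 * n\<^sup>2))"
      if "x \<in> ball 0 r - {0}" for x
    proof -
      have "h x / a \<ge> 4" using r0(2)[of x] that r a by (auto simp: le_divide_eq)
      then show ?thesis using psi_high[OF n] by (simp add: I_def mult.commute)
    qed
    have I0: "I x \<ge> 0" if "x \<in> ball 0 r - {0}" for x
    proof -
      have "u x \<ge> 1" "src x \<ge> u x" using nb[of x] that r by auto
      then show ?thesis unfolding Iin[OF that] using kap_le kap2_bounds(1)
        by (intro add_nonneg_nonneg mult_nonneg_nonneg divide_nonneg_nonneg) (auto simp: kap_le)
    qed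
    have IA: "\<bar>I x\<bar> \<le> B" if "x \<in> A" for x
    proof -
      have x: "x \<noteq> 0" "norm x \<le> R" using that A by (auto simp: A_def)
      have us: "u x \<ge> 1" "src x \<ge> u x" using nb[OF x] by auto
      have t: "h x / a \<ge> 0" using hp[OF x] a by simp
      have "\<bar>src x * psi n (h x / a)\<bar> \<le> src x * 6"
        unfolding abs_mult using us psi_mid(1)[OF n t] by (intro mult_mono) auto
      moreover have "\<bar>u x * (((norm x)\<^sup>2) powr (1 - m) * psi2 n (h x / a) / a\<^sup>2)\<bar> \<le> 4 * (u x * (((norm x)\<^sup>2) powr (1 - m) / a\<^sup>2))"
      proof -
      have "\<bar>u x * (((norm x)\<^sup>2) powr (1 - m) * psi2 n (h x / a) / a\<^sup>2)\<bar> = u x * (((norm x)\<^sup>2) powr (1 - m) / a\<^sup>2) * \<bar>psi2 n (h x / a)\<bar>"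
        using us by (simp add: abs_mult)
      moreover have "u x * (((norm x)\<^sup>2) powr (1 - m) / a\<^sup>2) * \<bar>psi2 n (h x / a)\<bar> \<le> u x * (((norm x)\<^sup>2) powr (1 - m) / a\<^sup>2) * 4"
        using us psi_mid(2)[OF n t] by (intro mult_left_mono) auto
      ultimately show ?thesis by (simp only: mult.commute)
      qed
      moreover have "\<bar>I x\<bar> \<le> \<bar>src x * psi n (h x / a)\<bar> + \<bar>u x * (((norm x)\<^sup>2) powr (1 - m) * psi2 n (h x / a) / a\<^sup>2)\<bar>"
        unfolding I_def by (rule abs_triangle_ineq)
      ultimately have "\<bar>I x\<bar> \<le> ?b x" by linarith
      also have "\<dots> \<le> B" using B(2)[OF that] by simp
      finally show ?thesis .
    qed
    \<comment> \<open>Adding \<open>B\<close> on the annulus makes the integrand nonnegative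
      everywhere while raising its integral from 0 to \<open>C\<close>.\<close>
    let ?J = "\<lambda>x. I x + B * indicator A x"
    have le: "indicator (ball 0 r - {0}) x * I x \<le> ?J x" and J0: "0 \<le> ?J x" for x
    proof -
      consider "x = 0" | "x \<in> ball 0 r - {0}" | "x \<in> A" | "x \<notin> cball 0 R" by (auto simp: A_def)
      then have "indicator (ball 0 r - {0}) x * I x \<le> ?J x \<and> 0 \<le> ?J x"
      proof cases
        case 1 then show ?thesis using T(4) B(1) by simp
      next
        case 2 then show ?thesis using I0[OF 2] B(1) by simp
      next
        case 3
        then have "x \<notin> ball 0 r - {0}" by (auto simp: A_def)
        then show ?thesis using IA[OF 3] 3 by simp
      next
        case 4 then have "x \<notin> ball 0 r - {0}" using r by auto
        then show ?thesis using T(3)[OF 4] B(1) by simp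
      qed
      then show "indicator (ball 0 r - {0}) x * I x \<le> ?J x" "0 \<le> ?J x" by auto
    qed
    have "(\<integral>\<^sup>+x. ennreal (indicator (ball 0 r - {0}) x *
       (src x * (3/2 - kap (h x / a / n)) + u x * (((norm x)\<^sup>2) powr (1 - m) * - kap2 (h x / a / n) / (a\<^sup>2 * n\<^sup>2)))) \<partial>lborel)
       = (\<integral>\<^sup>+x. ennreal (indicator (ball 0 r - {0}) x * I x) \<partial>lborel)"
      by (intro nn_integral_cong) (auto simp: indicator_def Iin)
    also have "\<dots> \<le> (\<integral>\<^sup>+x. ennreal (?J x) \<partial>lborel)"
      by (intro nn_integral_mono ennreal_leI le)
    also have "\<dots> = ennreal (\<integral>x. ?J x \<partial>lborel)"
      using T(1) iA(1) J0 by (intro nn_integral_eq_integral) auto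
    also have "(\<integral>x. ?J x \<partial>lborel) = C" using T(1,2) iA by simp
    finally show ?thesis .
  qed
  show ?thesis
  proof (rule that[of a r C])
    show "0 \<le> C" using B by (simp add: C_def)
    show "4 * a \<le> h x \<and> 1 \<le> u x \<and> u x \<le> src x" if "x \<noteq> 0" "norm x < r" for x
      using r0(2)[of x] nb[of x] that r by auto
  qed (use a r R main in auto)
qed

lemma kap_measurable [measurable]: "kap \<in> borel_measurable borel" "kap2 \<in> borel_measurable borel"
  by (auto intro!: borel_measurable_continuous_onI continuous_kap2 continuous_at_imp_continuous_on DERIV_isCont[OF DERIV_kap])

lemma fsol_measurable [measurable]: "fsol m \<in> borel_measurable borel"
  unfolding fsol_def[abs_def] by measurable

text \<open>Fatou's lemma for n to infinity. At a fixed point, once \<open>n\<close> exceeds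
  \<open>h x / a\<close>, the truncation is in its linear range: \<open>3/2 - kap\<close> is at
  least 1/2 and the curvature term has vanished.\<close>

lemma src_integrable_near_0:
  obtains r where "r > 0" "integrable lborel (\<lambda>x. indicator (ball 0 r) x * src x)"
proof -
  obtain a r C where a: "0 < a" "0 < r" "0 \<le> C" and us: "\<And>x. x \<noteq> 0 \<Longrightarrow> norm x < r \<Longrightarrow> 4 * a \<le> h x \<and> 1 \<le> u x \<and> u x \<le> src x"
    and main: "\<And>n. n \<ge> 4 \<Longrightarrow> (\<integral>\<^sup>+x. ennreal (indicator (ball 0 r - {0}) x *
       (src x * (3/2 - kap (h x / a / n)) + u x * (((norm x)\<^sup>2) powr (1 - m) * - kap2 (h x / a / n) / (a\<^sup>2 * n\<^sup>2)))) \<partial>lborel) \<le> ennreal C"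
    by (rule concavity_bound) blast
  define G where "G k x = ennreal (indicator (ball 0 r - {0}) x *
       (src x * (3/2 - kap (h x / a / k)) + u x * (((norm x)\<^sup>2) powr (1 - m) * - kap2 (h x / a / k) / (a\<^sup>2 * k\<^sup>2))))" for k x
  let ?g = "\<lambda>x. indicator (ball 0 r - {0}) x * src x / 2"
  have "ball 0 r - {0} \<in> sets (borel :: (real^'n) measure)" by simp
  note [measurable] = this
  have "G k \<in> borel_measurable borel" for k unfolding G_def[abs_def] by measurable
  then have [measurable]: "G k \<in> borel_measurable lborel" for k by simp
  have pw: "ennreal (?g x) \<le> liminf (\<lambda>k. G (real k) x)" for x
  proof (cases "x \<in> ball 0 r - {0}")
    case True
    have s: "u x \<ge> 1" "src x \<ge> u x" using us[of x] True by auto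
    obtain k0 :: nat where k0: "real k0 \<ge> max 1 (h x / a)" using real_arch_simple by blast
    have "ennreal (?g x) \<le> G (real k) x" if "k \<ge> k0" for k
    proof -
      have k: "real k \<ge> real k0" using that by simp
      then have "h x / a \<le> real k" "real k > 0" using k0 by auto
      then have "h x / a / real k \<le> 1" by (subst divide_le_eq) auto
      then have kk: "kap (h x / a / real k) \<le> 1" "kap2 (h x / a / real k) = 0" by (simp_all add: kap_low)
      have "src x * (1/2) \<le> src x * (3/2 - kap (h x / a / real k))"
        using s kk by (intro mult_left_mono) auto
      then show ?thesis unfolding G_def using True kk by (intro ennreal_leI) simp
    qed
    then show ?thesis by (intro Liminf_bounded) (auto simp: eventually_sequentially)
  next
    case False then show ?thesis by simp
  qed
  have "(\<integral>\<^sup>+x. ennreal (?g x) \<partial>lborel) \<le> (\<integral>\<^sup>+x. liminf (\<lambda>k. G (real k) x) \<partial>lborel)"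
    by (intro nn_integral_mono pw)
  also have "\<dots> \<le> liminf (\<lambda>k. \<integral>\<^sup>+x. G (real k) x \<partial>lborel)"
    by (rule nn_integral_liminf) simp
  also have "\<dots> \<le> limsup (\<lambda>k. \<integral>\<^sup>+x. G (real k) x \<partial>lborel)" by (rule Liminf_le_Limsup) simp
  also have "\<dots> \<le> ennreal C"
  proof (rule Limsup_bounded)
    show "\<forall>\<^sub>F k in sequentially. (\<integral>\<^sup>+x. G (real k) x \<partial>lborel) \<le> ennreal C"
      unfolding eventually_sequentially G_def by (intro exI[of _ 4] allI impI main) auto
  qed
  finally have fin: "(\<integral>\<^sup>+x. ennreal (?g x) \<partial>lborel) \<le> ennreal C" .
  have "0 \<le> ?g x" for x using us[of x] by (auto simp: indicator_def)
  then have "integrable lborel ?g" using fin a by (intro integrable_of_nn_integral_le(1)[of _ _ C]) auto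
  then have i: "integrable lborel (\<lambda>x. 2 * ?g x)" by (intro integrable_mult_right)
  have "integrable lborel (\<lambda>x. indicator (ball 0 r) x * src x)"
  proof (rule integrable_cong_AE_imp[OF i])
    show "AE x in lborel. 2 * ?g x = indicator (ball 0 r) x * src x"
      using AE_lborel_singleton[of "0::real^'n"] by eventually_elim (auto simp: indicator_def)
  qed (auto intro!: borel_measurable_times measurable_src borel_measurable_indicator)
  with a show ?thesis by (intro that)
qed

text \<open>Here the curvature term is the useful part of \<open>concavity_bound\<close>: with
  \<open>n\<close> adapted to \<open>x\<close> it dominates a multiple of |x|^(2-2m) / (h x)^2 times
  \<open>u\<close> on the whole ball.\<close>

lemma local_mass_bound:
  obtains \<theta> r C where "0 < \<theta>" "\<theta> \<le> 1/2" "0 < r" "0 \<le> C"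
    "\<And>x. x \<noteq> 0 \<Longrightarrow> norm x < r \<Longrightarrow> (\<integral>y. indicator (cball x (\<theta> * norm x)) y * u y \<partial>lborel)
      \<le> C * ((norm x)\<^sup>2) powr (m - 1) * (h x)\<^sup>2"
proof -
  obtain a r0 C where a: "0 < a" "0 < r0" "0 \<le> C" and us: "\<And>x. x \<noteq> 0 \<Longrightarrow> norm x < r0 \<Longrightarrow> 4 * a \<le> h x \<and> 1 \<le> u x \<and> u x \<le> src x"
    and main: "\<And>n. n \<ge> 4 \<Longrightarrow> (\<integral>\<^sup>+x. ennreal (indicator (ball 0 r0 - {0}) x *
       (src x * (3/2 - kap (h x / a / n)) + u x * (((norm x)\<^sup>2) powr (1 - m) * - kap2 (h x / a / n) / (a\<^sup>2 * n\<^sup>2)))) \<partial>lborel) \<le> ennreal C"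
    by (rule concavity_bound) blast
  obtain \<theta> r1 where \<theta>: "0 < \<theta>" "\<theta> \<le> 1/2" "0 < r1"
    and sl: "\<And>s t. 0 < s \<Longrightarrow> s < r1 \<Longrightarrow> (1 - \<theta>)\<^sup>2 * s \<le> t \<Longrightarrow> t \<le> (1 + \<theta>)\<^sup>2 * s \<Longrightarrow>
      5/6 * fsol m s \<le> fsol m t \<and> fsol m t \<le> 7/6 * fsol m s"
    by (rule fsol_slowly_varying[OF m2]) blast
  obtain r2 where r2: "r2 > 0" "\<And>x. x \<noteq> 0 \<Longrightarrow> norm x < r2 \<Longrightarrow> h x \<ge> 6 * a" using h_large by blast
  define r where "r = min (r0/2) (min (sqrt r1) r2)"
  have r: "r > 0" "r \<le> r0/2" "r \<le> sqrt r1" "r \<le> r2" using a r2 \<theta> by (auto simp: r_def)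
  show ?thesis
  proof (rule that[of \<theta> r "C * 4 powr (m - 1)"])
    fix x :: "real^'n" assume x: "x \<noteq> 0" "norm x < r"
    \<comment> \<open>Places \<open>h x / a / n\<close> at 3/2, the peak of the tent. The parameter
      is real, so it can be matched to \<open>x\<close> exactly, and \<open>h x \<ge> 6 * a\<close>
      is what gives \<open>n \<ge> 4\<close>.\<close>
    define n where "n = h x / a / (3/2)"
    have n: "n \<ge> 4" using r2(2)[of x] x r a by (simp add: n_def le_divide_eq)
    define c where "c = (4 * (norm x)\<^sup>2) powr (1 - m) / (a\<^sup>2 * n\<^sup>2)"
    have c: "c > 0" using a n x by (simp add: c_def)
    let ?B = "cball x (\<theta> * norm x)"
    have y: "c * u y \<le> u y * (((norm y)\<^sup>2) powr (1 - m) * - kap2 (h y / a / n) / (a\<^sup>2 * n\<^sup>2))"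
      "y \<in> ball 0 r0 - {0}" "0 \<le> src y * (3/2 - kap (h y / a / n))" "0 \<le> u y" if "y \<in> ?B" for y
    proof -
      have d: "norm (x - y) \<le> \<theta> * norm x" using that by (simp add: dist_norm)
      have lo: "(1 - \<theta>) * norm x \<le> norm y" using d norm_triangle_ineq2[of x y] by (simp add: algebra_simps)
      have hi: "norm y \<le> (1 + \<theta>) * norm x" using d norm_triangle_ineq2[of y x] by (simp add: algebra_simps norm_minus_commute)
      have nx: "norm x > 0" using x by simp
      have "(1 - \<theta>) * norm x > 0" using \<theta> nx by simp
      then have y0: "norm y > 0" using lo by linarith
      have t: "\<theta> * norm x \<le> 1/2 * norm x" using \<theta> nx by (intro mult_right_mono) auto
      then have hi2: "norm y \<le> 2 * norm x" using hi nx unfolding distrib_right by linarith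
      show yb: "y \<in> ball 0 r0 - {0}" using y0 hi2 x r by auto
      have u: "u y \<ge> 1" "src y \<ge> u y" using us[of y] yb by auto
      show "0 \<le> u y" using u by simp
      show "0 \<le> src y * (3/2 - kap (h y / a / n))" using u kap_le by simp
      have "(1 - \<theta>)\<^sup>2 * (norm x)\<^sup>2 \<le> (norm y)\<^sup>2"
        unfolding power_mult_distrib[symmetric] using lo \<theta> nx by (intro power_mono) auto
      moreover have "(norm y)\<^sup>2 \<le> (1 + \<theta>)\<^sup>2 * (norm x)\<^sup>2"
        unfolding power_mult_distrib[symmetric] using hi by (intro power_mono) auto
      moreover have "(norm x)\<^sup>2 < r1"
      proof -
        have "norm x < sqrt r1" using x r by simp
        then have "(norm x)\<^sup>2 < (sqrt r1)\<^sup>2" by (intro power_strict_mono) auto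
        then show ?thesis using \<theta> by simp
      qed
      ultimately have "5/6 * h x \<le> h y" "h y \<le> 7/6 * h x" using sl[of "(norm x)\<^sup>2" "(norm y)\<^sup>2"] nx by auto
      moreover have hx: "h x > 0" proof -
        have "h x \<ge> 6 * a" using r2(2)[of x] x r by auto
        then show ?thesis using a by linarith
      qed
      moreover have "h y / a / n = 3/2 * (h y / h x)" using a hx by (simp add: n_def)
      moreover have "5/6 \<le> h y / h x" "h y / h x \<le> 7/6"
        using calculation hx by (simp_all add: le_divide_eq divide_le_eq)
      ultimately have "5/4 \<le> h y / a / n" "h y / a / n \<le> 7/4" by linarith+
      then have k: "- kap2 (h y / a / n) \<ge> 1" using kap2_bounds(3) by simp
      have "(norm y)\<^sup>2 \<le> (2 * norm x)\<^sup>2" using hi2 by (intro power_mono) auto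
      then have "(4 * (norm x)\<^sup>2) powr (1 - m) \<le> ((norm y)\<^sup>2) powr (1 - m)"
        using y0 nx m2 by (intro powr_mono2') (auto simp: power_mult_distrib)
      then have "(4 * (norm x)\<^sup>2) powr (1 - m) * 1 \<le> ((norm y)\<^sup>2) powr (1 - m) * - kap2 (h y / a / n)"
        using k by (intro mult_mono) auto
      then have "c \<le> ((norm y)\<^sup>2) powr (1 - m) * - kap2 (h y / a / n) / (a\<^sup>2 * n\<^sup>2)"
        unfolding c_def using a n by (intro divide_right_mono) auto
      then show "c * u y \<le> u y * (((norm y)\<^sup>2) powr (1 - m) * - kap2 (h y / a / n) / (a\<^sup>2 * n\<^sup>2))"
        using u by (subst mult.commute) (intro mult_left_mono, auto)
    qed
    have "(\<integral>\<^sup>+y. ennreal (c * (indicator ?B y * u y)) \<partial>lborel) \<le> (\<integral>\<^sup>+x. ennreal (indicator (ball 0 r0 - {0}) x *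
       (src x * (3/2 - kap (h x / a / n)) + u x * (((norm x)\<^sup>2) powr (1 - m) * - kap2 (h x / a / n) / (a\<^sup>2 * n\<^sup>2)))) \<partial>lborel)"
    proof (intro nn_integral_mono)
      fix z show "ennreal (c * (indicator ?B z * u z)) \<le> ennreal (indicator (ball 0 r0 - {0}) z *
       (src z * (3/2 - kap (h z / a / n)) + u z * (((norm z)\<^sup>2) powr (1 - m) * - kap2 (h z / a / n) / (a\<^sup>2 * n\<^sup>2))))"
      proof (cases "z \<in> ?B")
        case True
        show ?thesis using y[OF True] True by (intro ennreal_leI) simp
      qed simp
    qed
    also have "\<dots> \<le> ennreal C" by (rule main[OF n])
    finally have "(\<integral>y. c * (indicator ?B y * u y) \<partial>lborel) \<le> C"
      using y(4) c a by (intro integrable_of_nn_integral_le(2)) (auto simp: indicator_def)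
    then have "(\<integral>y. indicator ?B y * u y \<partial>lborel) \<le> C / c" using c by (simp add: field_simps)
    also have "C / c = C * (a\<^sup>2 * n\<^sup>2) * (4 * (norm x)\<^sup>2) powr (m - 1)"
      using x a n by (simp add: c_def powr_minus_divide[of _ "m - 1", simplified])
    also have "a\<^sup>2 * n\<^sup>2 = 4/9 * (h x)\<^sup>2" using a by (simp add: n_def power_divide)
    also have "C * (4/9 * (h x)\<^sup>2) * (4 * (norm x)\<^sup>2) powr (m - 1) \<le> C * (1 * (h x)\<^sup>2) * (4 * (norm x)\<^sup>2) powr (m - 1)"
      using a by (intro mult_right_mono mult_left_mono) auto
    also have "\<dots> = C * 4 powr (m - 1) * ((norm x)\<^sup>2) powr (m - 1) * (h x)\<^sup>2"
      by (simp add: powr_mult)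
    finally show "(\<integral>y. indicator ?B y * u y \<partial>lborel) \<le> C * 4 powr (m - 1) * ((norm x)\<^sup>2) powr (m - 1) * (h x)\<^sup>2" .
  qed (use \<theta> r a in auto)
qed

end

section \<open>Pointwise bounds by a doubling argument\<close>

text \<open>The point where \<open>v y * (d - |y - x|) powr \<alpha>\<close> is maximal is the centre of a ball on which
  \<open>v\<close> is controlled by its central value.\<close>
lemma doubling_point:
  fixes v :: "'a::euclidean_space \<Rightarrow> real"
  assumes "d > 0" "\<alpha> > 0" "continuous_on (cball x d) v" "\<And>y. y \<in> cball x d \<Longrightarrow> v y > 0"
  obtains z \<sigma> where "0 < \<sigma>" "\<sigma> \<le> d" "z \<in> cball x d" "cball z \<sigma> \<subseteq> cball x d"
    "\<And>y. y \<in> cball z \<sigma> \<Longrightarrow> v y \<le> 2 powr \<alpha> * v z" "v x * d powr \<alpha> \<le> v z * (2 * \<sigma>) powr \<alpha>"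
proof -
  let ?w = "\<lambda>y. v y * (d - dist x y) powr \<alpha>"
  have "continuous_on (cball x d) (\<lambda>y. (d - dist x y) powr \<alpha>)"
    by (rule continuous_on_powr') (use assms(2) in \<open>auto intro!: continuous_intros\<close>)
  then have "continuous_on (cball x d) ?w" by (intro continuous_on_mult assms(3))
  then obtain z where z: "z \<in> cball x d" "\<And>y. y \<in> cball x d \<Longrightarrow> ?w y \<le> ?w z"
    using continuous_attains_sup[of "cball x d" ?w] assms(1) by auto
  have wx: "v x * d powr \<alpha> \<le> ?w z" using z(2)[of x] assms(1) by simp
  have "v x * d powr \<alpha> > 0" using assms by simp
  then have "(d - dist x z) powr \<alpha> \<noteq> 0" using wx by auto
  then have dz: "dist x z < d" using z(1) by (cases "dist x z = d") auto
  \<comment> \<open>Half the distance from \<open>z\<close> to the sphere: throughout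
    \<open>cball z \<sigma>\<close> the weight is at least \<open>\<sigma> powr \<alpha>\<close>,
    against \<open>(2 * \<sigma>) powr \<alpha>\<close> at \<open>z\<close>. This is the origin of
    the factor \<open>2 powr \<alpha>\<close>.\<close>
  define \<sigma> where "\<sigma> = (d - dist x z) / 2"
  have "\<sigma> > 0" using dz by (simp add: \<sigma>_def)
  moreover have "d - dist x z \<le> d + d" by (rule order_trans[of _ d]) (use assms(1) in auto)
  then have "\<sigma> \<le> d" by (simp add: \<sigma>_def)
  ultimately have \<sigma>: "\<sigma> > 0" "\<sigma> \<le> d" by auto
  have two: "d - dist x z = 2 * \<sigma>" by (simp add: \<sigma>_def field_simps)
  have sub: "d - dist x y \<ge> \<sigma>" if "y \<in> cball z \<sigma>" for y
    using dist_triangle[of x y z] that by (simp add: \<sigma>_def)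
  have sub': "cball z \<sigma> \<subseteq> cball x d" using sub \<sigma> by (auto, smt (verit) mem_cball)
  have vz: "v z > 0" using assms(4) z(1) by simp
  show ?thesis
  proof (rule that[OF \<sigma> z(1) sub'])
    show "v x * d powr \<alpha> \<le> v z * (2 * \<sigma>) powr \<alpha>" using wx by (simp only: two)
    fix y assume y: "y \<in> cball z \<sigma>"
    then have yd: "y \<in> cball x d" using sub' by auto
    have "v y * \<sigma> powr \<alpha> \<le> ?w y"
      using sub[OF y] \<sigma> assms(2) assms(4)[OF yd] by (intro mult_left_mono powr_mono2) auto
    also have "\<dots> \<le> ?w z" by (rule z(2)[OF yd])
    also have "\<dots> = v z * (2 * \<sigma>) powr \<alpha>" by (simp only: two)
    also have "\<dots> = (2 powr \<alpha> * v z) * \<sigma> powr \<alpha>" using \<sigma> by (simp add: powr_mult)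
    finally show "v y \<le> 2 powr \<alpha> * v z" using \<sigma> by simp
  qed
qed

context singular_solution begin

lemma mean_value_u:
  assumes \<rho>: "0 < \<rho>" and z: "cball z \<rho> \<subseteq> - {0}" and K: "\<And>y. y \<in> cball z \<rho> \<Longrightarrow> \<bar>src y\<bar> \<le> K"
  shows "\<bar>m * om * u z - (\<integral>y. u y * eta m (\<rho>\<^sup>2) ((norm (y - z))\<^sup>2) \<partial>lborel)\<bar> \<le> K * \<rho>\<^sup>2 * om / 2"
  unfolding m_eq
  by (rule mean_value_estimate[OF _ uC2 z \<rho>]) (use K z in \<open>auto simp: open_Compl laplacian_u subset_eq\<close>)

lemma eta_le_indicator:
  assumes "\<rho> > 0"
  shows "eta m (\<rho>\<^sup>2) ((norm (y - z))\<^sup>2) \<le> m * (m + 2) / 2 * \<rho> powr (- m) * indicator (cball z \<rho>) y"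
proof (cases "y \<in> cball z \<rho>")
  case True
  have "(\<rho>\<^sup>2) powr (- m/2) = \<rho> powr (- m)"
    using assms by (simp add: powr_powr flip: powr_numeral)
  then show ?thesis using eta_le[of m "\<rho>\<^sup>2" "(norm (y - z))\<^sup>2"] m2 assms True by simp
qed (use eta_outside[of \<rho> y z m] assms in simp)

text \<open>The weight \<open>2 / (p - 1)\<close> is the scaling exponent of the equation. At a doubling point with value
  \<open>A\<close>, the mean value property on the radius \<open>\<approx> A powr ((1 - p) / 2)\<close> and the integrability of \<open>u powr p\<close>
  bound \<open>A powr e\<close>; subcriticality of \<open>p\<close> is exactly \<open>e > 0\<close>.\<close>
lemma src_le_u_over_square:
  obtains r C where "0 < r" "0 < C" "r \<le> 1" "\<And>x. x \<noteq> 0 \<Longrightarrow> norm x < r \<Longrightarrow> 1 \<le> u x \<and> 0 \<le> src x \<and> src x * (norm x)\<^sup>2 \<le> C * u x"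
proof -
  obtain R q C1 where R: "0 < R" "R \<le> 1" "0 < q" "0 < C1" and nb: "\<And>x. x \<noteq> 0 \<Longrightarrow> norm x \<le> R \<Longrightarrow>
      1 \<le> u x \<and> u x \<le> src x \<and> q * u x powr p \<le> src x \<and> src x \<le> C1 * u x powr p"
    by (rule near_origin) blast
  obtain r0 where r0: "r0 > 0" "integrable lborel (\<lambda>x. indicator (ball 0 r0) x * src x)"
    by (rule src_integrable_near_0) blast
  define r1 where "r1 = min r0 R"
  have r1: "r1 > 0" "r1 \<le> r0" "r1 \<le> R" using r0 R by (auto simp: r1_def)
  define D where "D = ball (0::real^'n) r1 - {0}"
  have nbD: "1 \<le> u x" "u x \<le> src x" "q * u x powr p \<le> src x" "src x \<le> C1 * u x powr p" if "x \<in> D" for x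
    using nb[of x] that r1 by (auto simp: D_def)
  have iD: "integrable lborel (\<lambda>x. indicator D x * src x)"
  proof -
    have "integrable lborel (\<lambda>x. indicator D x *\<^sub>R (indicator (ball 0 r0) x * src x))"
      by (rule integrable_mult_indicator[OF _ r0(2)]) (simp add: D_def)
    moreover have "(\<lambda>x. indicator D x *\<^sub>R (indicator (ball 0 r0) x * src x)) = (\<lambda>x. indicator D x * src x)"
      using r1 by (auto simp: fun_eq_iff indicator_def D_def)
    ultimately show ?thesis by simp
  qed
  define P where "P = (\<integral>x. indicator D x * src x \<partial>lborel)"
  have P0: "P \<ge> 0" unfolding P_def
    using nbD by (intro Bochner_Integration.integral_nonneg) (fastforce simp: indicator_def)
  define \<alpha> where "\<alpha> = 2 / (p - 1)"
  have \<alpha>: "\<alpha> > 0" "\<alpha> * (p - 1) = 2" using p1 by (auto simp: \<alpha>_def field_simps)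
  define C2 where "C2 = C1 * (2 powr \<alpha>) powr p"
  have C2: "C2 > 0" using R by (simp add: C2_def)
  define e where "e = p - (p - 1) * m / 2"
  have e: "e > 0"
  proof (cases "CARD('n) \<ge> 3")
    case True
    then have "p * (m - 2) < m" using pcrit by (simp add: m_eq less_divide_eq)
    then show ?thesis by (simp add: e_def field_simps)
  next
    case False
    then have "m = 2" using N2 by (simp add: m_eq)
    then show ?thesis by (simp add: e_def)
  qed
  define c where "c = m * (m + 2) / 2"
  have c: "c > 0" using m2 by (simp add: c_def)
  define C3 where "C3 = 4 powr p * c * (P/q) * (m/C2) powr (- m/2) / (m * om)"
  have C3: "C3 \<ge> 0" unfolding C3_def using c P0 R C2 m2 om_pos by simp
  define C4 where "C4 = C3 powr (1/e)"
  define C5 where "C5 = m / C2 + C4 powr (p - 1)"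
  have C5: "C5 > 0" using m2 C2 by (simp add: C5_def add_pos_nonneg)
  have "1 \<le> u x \<and> 0 \<le> src x \<and> src x * (norm x)\<^sup>2 \<le> 16 * C5 * C1 * u x" if x: "x \<noteq> 0" "norm x < r1/2" for x
  proof -
    define d where "d = norm x / 2"
    have d: "d > 0" "d \<le> 1" using x r1 R by (auto simp: d_def)
    have dD: "cball x d \<subseteq> D"
    proof
      fix y assume "y \<in> cball x d"
      then have "norm (x - y) \<le> norm x / 2" by (simp add: d_def dist_norm)
      then have "norm y \<ge> norm x / 2" "norm y \<le> 3/2 * norm x"
        using norm_triangle_ineq2[of x y] norm_triangle_ineq2[of y x] by (auto simp: norm_minus_commute)
      then show "y \<in> D" using x by (auto simp: D_def)
    qed
    have xD: "x \<in> D" using x r1 by (auto simp: D_def)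
    have u1: "u y > 0" if "y \<in> cball x d" for y using nbD(1)[of y] dD that by auto
    have D0: "D \<subseteq> - {0}" by (auto simp: D_def)
    obtain z \<sigma> where z: "0 < \<sigma>" "\<sigma> \<le> d" "z \<in> cball x d" "cball z \<sigma> \<subseteq> cball x d"
      and dbl: "\<And>y. y \<in> cball z \<sigma> \<Longrightarrow> u y \<le> 2 powr \<alpha> * u z" and ux: "u x * d powr \<alpha> \<le> u z * (2 * \<sigma>) powr \<alpha>"
      by (rule doubling_point[OF d(1) \<alpha>(1) continuous_on_subset[OF continuous_u order_trans[OF dD D0]] u1]) blast+
    define A where "A = u z"
    have A: "A \<ge> 1" using nbD(1)[of z] z(3) dD by (auto simp: A_def)
    have srcK: "\<bar>src y\<bar> \<le> C2 * A powr p" if "y \<in> cball z \<sigma>" for y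
    proof -
      have yD: "y \<in> D" using that z(4) dD by auto
      have "u y powr p \<le> (2 powr \<alpha> * A) powr p"
        using dbl[OF that] nbD(1)[OF yD] p1 by (intro powr_mono2) (auto simp: A_def)
      also have "\<dots> = (2 powr \<alpha>) powr p * A powr p" by (simp add: powr_mult)
      finally have "C1 * u y powr p \<le> C1 * ((2 powr \<alpha>) powr p * A powr p)" using R by simp
      then have "src y \<le> C2 * A powr p" using nbD(4)[OF yD] by (simp add: C2_def mult.assoc)
      moreover have "0 \<le> src y" using nbD(1,2)[OF yD] by simp
      ultimately show ?thesis by simp
    qed
    \<comment> \<open>If \<sigma> is at most the intrinsic radius of the equation at height
      \<open>A\<close>, the claim is immediate. Otherwise a ball of the intrinsic radius fits
      inside, and the mean value property on it bounds \<open>A\<close> by a constant.\<close>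
    have main: "A powr (p - 1) * \<sigma>\<^sup>2 \<le> C5"
    proof (cases "m / C2 * A powr (1 - p) \<ge> \<sigma>\<^sup>2")
      case True
      then have "A powr (p - 1) * \<sigma>\<^sup>2 \<le> A powr (p - 1) * (m / C2 * A powr (1 - p))" by (intro mult_left_mono) auto
      also have "\<dots> = m / C2 * (A powr (p - 1) * A powr (1 - p))" by simp
      also have "A powr (p - 1) * A powr (1 - p) = 1" using A by (simp flip: powr_add)
      finally show ?thesis by (simp add: C5_def add_increasing2)
    next
      case False
      \<comment> \<open>With this radius the mean value error is exactly half of the main term
        \<open>m * om * A\<close>.\<close>
      define \<rho> where "\<rho> = sqrt (m / C2 * A powr (1 - p))"
      have r2: "\<rho>\<^sup>2 = m / C2 * A powr (1 - p)" using m2 C2 by (simp add: \<rho>_def)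
      have \<rho>: "\<rho> > 0" using m2 C2 A by (simp add: \<rho>_def)
      have "\<rho>\<^sup>2 \<le> \<sigma>\<^sup>2" using False r2 by simp
      then have \<rho>\<sigma>: "\<rho> \<le> \<sigma>" using z(1) by (rule power2_le_imp_le[OF _ less_imp_le])
      then have sub: "cball z \<rho> \<subseteq> cball z \<sigma>" by auto
      have sD: "cball z \<rho> \<subseteq> D" using sub z(4) dD by blast
      let ?e = "\<lambda>y. eta m (\<rho>\<^sup>2) ((norm (y - z))\<^sup>2)"
      have K: "\<bar>m * om * A - (\<integral>y. u y * ?e y \<partial>lborel)\<bar> \<le> C2 * A powr p * \<rho>\<^sup>2 * om / 2"
      proof -
        have "\<bar>src y\<bar> \<le> C2 * A powr p" if "y \<in> cball z \<rho>" for y using srcK sub that by blast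
        from mean_value_u[OF \<rho> order_trans[OF sD D0] this] show ?thesis by (simp only: A_def)
      qed
      have "C2 * A powr p * \<rho>\<^sup>2 = m * (A powr p * A powr (1 - p))" unfolding r2 using C2 by simp
      also have "A powr p * A powr (1 - p) = A" using A by (simp flip: powr_add)
      finally have eq: "C2 * A powr p * \<rho>\<^sup>2 = m * A" .
      have "m * om * A - (\<integral>y. u y * ?e y \<partial>lborel) \<le> m * A * om / 2"
        using order_trans[OF abs_ge_self K] unfolding eq .
      then have "m * om * A / 2 \<le> (\<integral>y. u y * ?e y \<partial>lborel)" by (simp add: mult_ac)
      also have "\<dots> \<le> (\<integral>y. (A/4) * ?e y + ((A/4) powr (1 - p) * (c * \<rho> powr (- m)) / q) * (indicator D y * src y) \<partial>lborel)"
      proof (rule integral_mono)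
        have cu: "continuous_on (cball z \<rho>) u" using continuous_u order_trans[OF sD D0] by (rule continuous_on_subset)
        show "integrable lborel (\<lambda>y. u y * ?e y)" using \<rho> by (intro integrable_mult_eta cu) auto
        show "integrable lborel (\<lambda>y. (A/4) * ?e y + ((A/4) powr (1 - p) * (c * \<rho> powr (- m)) / q) * (indicator D y * src y))"
          using \<rho> iD by (intro Bochner_Integration.integrable_add integrable_mult_eta integrable_mult_right) auto
        fix y
        show "u y * ?e y \<le> (A/4) * ?e y + ((A/4) powr (1 - p) * (c * \<rho> powr (- m)) / q) * (indicator D y * src y)"
        proof (cases "y \<in> cball z \<rho>")
          case True
          then have yD: "y \<in> D" using sD by auto
          have e0: "0 \<le> ?e y" using m2 by (simp add: eta_nonneg)
          have uy: "u y \<ge> 1" using nbD(1)[OF yD] .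
          \<comment> \<open>Below \<open>A/4\<close> the first summand suffices; above it the
            decreasing power \<open>1 - p\<close> trades \<open>u\<close> for
            \<open>u powr p\<close>, whose integral is controlled by that of \<open>src\<close>. The
            summand \<open>A/4\<close> costs \<open>m * om * A / 4\<close>, half of the lower bound
            at hand.\<close>
          have "u y \<le> A/4 + (A/4) powr (1 - p) * u y powr p"
          proof (cases "u y \<le> A/4")
            case True then show ?thesis by (simp add: add_increasing2)
          next
            case False
            have "u y = u y powr (1 - p) * u y powr p" using uy by (simp flip: powr_add)
            also have "\<dots> \<le> (A/4) powr (1 - p) * u y powr p"
              using False A p1 by (intro mult_right_mono powr_mono2') auto
            finally show ?thesis using A by simp
          qed
          then have "u y * ?e y \<le> (A/4 + (A/4) powr (1 - p) * u y powr p) * ?e y" by (rule mult_right_mono[OF _ e0])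
          moreover have "(A/4) powr (1 - p) * u y powr p * ?e y \<le> (A/4) powr (1 - p) * (src y / q) * (c * \<rho> powr (- m))"
          proof (rule mult_mono)
            show "(A/4) powr (1 - p) * u y powr p \<le> (A/4) powr (1 - p) * (src y / q)"
              using nbD(3)[OF yD] R by (intro mult_left_mono) (auto simp: field_simps)
            show "?e y \<le> c * \<rho> powr (- m)" using eta_le_indicator[OF \<rho>, of y z] True by (simp add: c_def)
            show "0 \<le> (A/4) powr (1 - p) * (src y / q)" using nbD(1,2)[OF yD] R by simp
          qed (rule e0)
          ultimately show ?thesis using yD by (simp add: algebra_simps)
        next
          case False
          have "0 \<le> indicator D y * src y" using nbD(1,2)[of y] by (auto simp: indicator_def)
          then show ?thesis using False \<rho> R c by (simp add: eta_outside)
        qed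
      qed
      also have "\<dots> = (A/4) * (m * om) + ((A/4) powr (1 - p) * (c * \<rho> powr (- m)) / q) * P"
      proof -
        have "integrable lborel (\<lambda>y. (A/4) * ?e y)" using \<rho> by (intro integrable_mult_eta) auto
        moreover have "(\<integral>y. (A/4) * ?e y \<partial>lborel) = (A/4) * (m * om)"
          using integral_eta[of "\<rho>\<^sup>2" z] \<rho> by (simp add: m_eq)
        ultimately show ?thesis unfolding P_def
          by (subst Bochner_Integration.integral_add) (use iD in \<open>auto intro: integrable_mult_right\<close>)
      qed
      finally have "m * om * A / 4 \<le> (A/4) powr (1 - p) * (c * \<rho> powr (- m)) / q * P" by (simp add: field_simps)
      then have "m * om * A / 4 * (A/4) powr (p - 1) \<le> ((A/4) powr (1 - p) * (c * \<rho> powr (- m)) / q * P) * (A/4) powr (p - 1)"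
        by (intro mult_right_mono) auto
      also have "\<dots> = (c * \<rho> powr (- m)) / q * P * ((A/4) powr (1 - p) * (A/4) powr (p - 1))" by simp
      also have "(A/4) powr (1 - p) * (A/4) powr (p - 1) = 1" using A by (simp flip: powr_add)
      also have "\<rho> powr (- m) = (m/C2) powr (- m/2) * A powr ((p - 1) * m / 2)"
      proof -
        have "\<rho> powr (- m) = (\<rho>\<^sup>2) powr (- m/2)" using \<rho> by (simp add: powr_powr flip: powr_numeral)
        also have "\<dots> = (m/C2) powr (- m/2) * (A powr (1 - p)) powr (- m/2)"
          unfolding r2 using m2 C2 by (subst powr_mult) auto
        also have "(A powr (1 - p)) powr (- m/2) = A powr ((p - 1) * m / 2)"
        proof -
          have "(1 - p) * (- m/2) = (p - 1) * m / 2" by (simp add: field_simps)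
          then show ?thesis by (simp only: powr_powr)
        qed
        finally show ?thesis .
      qed
      also have "m * om * A / 4 * (A/4) powr (p - 1) = m * om * (4 powr - p * A powr p)"
      proof -
        have "A / 4 * (A/4) powr (p - 1) = (A/4) powr p" using A by (simp add: powr_diff)
        also have "\<dots> = 4 powr - p * A powr p" using A by (simp add: powr_divide powr_minus field_simps)
        finally show ?thesis by (simp add: mult.assoc)
      qed
      finally have "m * om * (4 powr - p * A powr p) \<le> c * ((m/C2) powr (- m/2) * A powr ((p - 1) * m / 2)) / q * P" by simp
      \<comment> \<open>The kernel contributes \<open>A powr ((p - 1) * m / 2)\<close> through its
        height \<open>\<rho> powr (- m)\<close>. Cancelling it leaves \<open>A powr e\<close>
        bounded, hence \<open>A\<close> bounded, since \<open>e > 0\<close>.\<close>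
      moreover have "A powr p = A powr e * A powr ((p - 1) * m / 2)"
        by (simp add: e_def flip: powr_add)
      ultimately have "(m * om * (4 powr - p * A powr e)) * A powr ((p - 1) * m / 2) \<le> (c * (m/C2) powr (- m/2) / q * P) * A powr ((p - 1) * m / 2)"
        by (simp add: algebra_simps)
      then have "m * om * (4 powr - p * A powr e) \<le> c * (m/C2) powr (- m/2) / q * P"
        by (rule mult_right_le_imp_le) (use A in simp)
      then have "4 powr p * (m * om * (4 powr - p * A powr e)) \<le> 4 powr p * (c * (m/C2) powr (- m/2) / q * P)"
        by (rule mult_left_mono) simp
      moreover have "4 powr p * (m * om * (4 powr - p * A powr e)) = A powr e * (m * om)"
        by (simp add: powr_minus)
      moreover have "m * om > 0" using m2 om_pos by simp
      ultimately have "A powr e \<le> 4 powr p * (c * (m/C2) powr (- m/2) / q * P) / (m * om)"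
        by (simp only: le_divide_eq if_True)
      then have "A powr e \<le> C3" by (simp add: C3_def mult_ac)
      then have "(A powr e) powr (1/e) \<le> C3 powr (1/e)" using e by (intro powr_mono2) auto
      then have "A \<le> C4" using e A by (simp add: C4_def powr_powr)
      then have "A powr (p - 1) \<le> C4 powr (p - 1)" using A p1 by (intro powr_mono2) auto
      moreover have "\<sigma>\<^sup>2 \<le> 1" using z d by (intro power_le_one) auto
      ultimately have "A powr (p - 1) * \<sigma>\<^sup>2 \<le> C4 powr (p - 1) * 1" by (intro mult_mono) auto
      then show ?thesis using m2 C2 by (simp add: C5_def add_increasing)
    qed
    have up: "u x \<ge> 1" "src x \<ge> u x" "src x \<le> C1 * u x powr p" using nbD[OF xD] by auto
    \<comment> \<open>The relation \<open>\<alpha> * (p - 1) = 2\<close> converts the doubling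
      weight, raised to \<open>p - 1\<close>, into the square of a length.\<close>
    have sq: "(s powr \<alpha>) powr (p - 1) = s\<^sup>2" if "s > 0" for s :: real
      using that \<alpha>(2) by (simp add: powr_powr)
    have "(u x * d powr \<alpha>) powr (p - 1) \<le> (A * (2 * \<sigma>) powr \<alpha>) powr (p - 1)"
      using ux up p1 by (intro powr_mono2) (auto simp: A_def)
    then have "u x powr (p - 1) * d\<^sup>2 \<le> A powr (p - 1) * (2 * \<sigma>)\<^sup>2"
      using sq[of d] sq[of "2 * \<sigma>"] d z by (simp add: powr_mult)
    then have "u x powr (p - 1) * (norm x)\<^sup>2 \<le> 16 * (A powr (p - 1) * \<sigma>\<^sup>2)"
      by (simp add: d_def power_divide power_mult_distrib)
    then have "u x powr (p - 1) * (norm x)\<^sup>2 \<le> 16 * C5" using main by linarith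
    then have "C1 * (u x powr (p - 1) * (norm x)\<^sup>2 * u x) \<le> C1 * (16 * C5 * u x)"
      using R up by (intro mult_left_mono mult_right_mono) auto
    moreover have "u x powr p = u x powr (p - 1) * u x" using up by (simp add: powr_diff)
    moreover have "src x * (norm x)\<^sup>2 \<le> C1 * u x powr p * (norm x)\<^sup>2" using up by (intro mult_right_mono) auto
    ultimately show ?thesis using up by (simp add: algebra_simps)
  qed
  then show ?thesis using R r1 C5 by (intro that[of "r1/2" "16 * C5 * C1"]) auto
qed

text \<open>By \<open>src_le_u_over_square\<close>, \<open>u\<close> satisfies a linear equation
  whose potential is at most a constant over |x|^2. This bound is scale invariant, so values are
  controlled by averages with a constant independent of |x|. Doubling with exponent \<open>m\<close>
  is chosen because the mass of \<open>u\<close> near \<open>z\<close> controls precisely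
  \<open>A * \<sigma> powr m\<close>.\<close>

lemma pointwise_le_average:
  assumes \<theta>: "0 < \<theta>" "\<theta> \<le> 1/2"
  obtains r C where "0 < r" "0 \<le> C" "r \<le> 1"
    "\<And>x. x \<noteq> 0 \<Longrightarrow> norm x < r \<Longrightarrow> u x * norm x powr m \<le> C * (\<integral>y. indicator (cball x (\<theta> * norm x)) y * u y \<partial>lborel)"
proof -
  obtain r0 C where r0: "0 < r0" "0 < C" "r0 \<le> 1" and nb: "\<And>x. x \<noteq> 0 \<Longrightarrow> norm x < r0 \<Longrightarrow> 1 \<le> u x \<and> 0 \<le> src x \<and> src x * (norm x)\<^sup>2 \<le> C * u x"
    by (rule src_le_u_over_square) blast
  define K where "K = 4 * C * 2 powr m"
  have K: "K > 0" using r0 by (simp add: K_def)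
  \<comment> \<open>Chosen to make \<open>K * \<mu>\<^sup>2 \<le> m\<close>: on the radius
    \<open>\<mu> * \<sigma>\<close> the mean value error is at most half of the main term.\<close>
  define \<mu> where "\<mu> = min 1 (sqrt (m / K))"
  have \<mu>: "0 < \<mu>" "\<mu> \<le> 1" using m2 K by (auto simp: \<mu>_def)
  have \<mu>2: "K * \<mu>\<^sup>2 \<le> m"
  proof -
    have "\<mu>\<^sup>2 \<le> (sqrt (m / K))\<^sup>2" using \<mu> by (intro power_mono) (auto simp: \<mu>_def)
    then show ?thesis using m2 K by (simp add: field_simps)
  qed
  define c where "c = m * (m + 2) / 2"
  have c: "c > 0" using m2 by (simp add: c_def)
  define C' where "C' = 2 * c * \<mu> powr (- m) / (m * om) * 2 powr m * \<theta> powr (- m)"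
  have "u x * norm x powr m \<le> C' * (\<integral>y. indicator (cball x (\<theta> * norm x)) y * u y \<partial>lborel)"
    if x: "x \<noteq> 0" "norm x < r0/2" for x
  proof -
    define d where "d = \<theta> * norm x"
    have nx: "norm x > 0" using x by simp
    have d: "d > 0" "d \<le> norm x / 2" using nx \<theta> mult_right_mono[OF \<theta>(2), of "norm x"] by (auto simp: d_def)
    have ny: "norm x / 2 \<le> norm y" "y \<noteq> 0" "norm y < r0" if "y \<in> cball x d" for y
    proof -
      have "norm (x - y) \<le> norm x / 2" using that d by (simp add: dist_norm)
      then have "norm y \<ge> norm x / 2" "norm y \<le> 3/2 * norm x"
        using norm_triangle_ineq2[of x y] norm_triangle_ineq2[of y x] by (auto simp: norm_minus_commute)
      then show "norm x / 2 \<le> norm y" "y \<noteq> 0" "norm y < r0" using x by auto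
    qed
    have d0: "cball x d \<subseteq> - {0}" using ny(2) by blast
    have nby: "1 \<le> u y" "0 \<le> src y" "src y * (norm y)\<^sup>2 \<le> C * u y" if "y \<in> cball x d" for y
      using nb[OF ny(2,3)[OF that]] by auto
    have cu: "continuous_on (cball x d) u" using continuous_u d0 by (rule continuous_on_subset)
    have up: "u y > 0" if "y \<in> cball x d" for y using nby(1)[OF that] by simp
    have mp: "m > 0" using m2 by simp
    obtain z \<sigma> where z: "0 < \<sigma>" "\<sigma> \<le> d" "z \<in> cball x d" "cball z \<sigma> \<subseteq> cball x d"
      and dbl: "\<And>y. y \<in> cball z \<sigma> \<Longrightarrow> u y \<le> 2 powr m * u z" and ux: "u x * d powr m \<le> u z * (2 * \<sigma>) powr m"
      by (rule doubling_point[OF d(1) mp cu up]) blast+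
    define \<rho> where "\<rho> = \<mu> * \<sigma>"
    have \<rho>: "\<rho> > 0" "\<rho> \<le> \<sigma>" using \<mu> z mult_right_mono[of \<mu> 1 \<sigma>] by (auto simp: \<rho>_def)
    have sub: "cball z \<rho> \<subseteq> cball z \<sigma>" "cball z \<rho> \<subseteq> cball x d" using \<rho> z(4) by auto
    define A where "A = u z"
    have A: "A \<ge> 1" using nby(1)[OF z(3)] by (simp add: A_def)
    have srcK: "\<bar>src y\<bar> \<le> K * A / (norm x)\<^sup>2" if "y \<in> cball z \<rho>" for y
    proof -
      have y: "y \<in> cball x d" using that sub by auto
      have "(norm x / 2)\<^sup>2 \<le> (norm y)\<^sup>2" using ny(1)[OF y] by (intro power_mono) auto
      then have "src y * (norm x / 2)\<^sup>2 \<le> src y * (norm y)\<^sup>2" using nby(2)[OF y] by (rule mult_left_mono)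
      also have "\<dots> \<le> C * u y" by (rule nby(3)[OF y])
      also have "\<dots> \<le> C * (2 powr m * A)" using dbl[of y] that sub r0 by (intro mult_left_mono) (auto simp: A_def)
      finally have "src y * (norm x)\<^sup>2 \<le> K * A" by (simp add: K_def power_divide algebra_simps)
      then show ?thesis using nby(2)[OF y] nx by (simp add: field_simps)
    qed
    let ?e = "\<lambda>y. eta m (\<rho>\<^sup>2) ((norm (y - z))\<^sup>2)"
    have mv: "\<bar>m * om * A - (\<integral>y. u y * ?e y \<partial>lborel)\<bar> \<le> K * A / (norm x)\<^sup>2 * \<rho>\<^sup>2 * om / 2"
      using mean_value_u[OF \<rho>(1) order_trans[OF sub(2) d0] srcK] by (simp only: A_def)
    have "\<rho>\<^sup>2 \<le> \<mu>\<^sup>2 * (norm x)\<^sup>2"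
      unfolding \<rho>_def power_mult_distrib using z d nx by (intro mult_left_mono power_mono) auto
    then have "K * A / (norm x)\<^sup>2 * \<rho>\<^sup>2 \<le> K * A / (norm x)\<^sup>2 * (\<mu>\<^sup>2 * (norm x)\<^sup>2)"
      using K A by (intro mult_left_mono) auto
    also have "\<dots> = (K * \<mu>\<^sup>2) * A" using nx by simp
    also have "\<dots> \<le> m * A" using \<mu>2 A by (intro mult_right_mono) auto
    finally have "K * A / (norm x)\<^sup>2 * \<rho>\<^sup>2 * om \<le> m * A * om" using om_pos by (intro mult_right_mono) auto
    then have "m * om * A / 2 \<le> (\<integral>y. u y * ?e y \<partial>lborel)" using mv by (simp add: abs_le_iff field_simps)
    also have "\<dots> \<le> (\<integral>y. (c * \<rho> powr (- m)) * (indicator (cball x d) y * u y) \<partial>lborel)"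
    proof (rule integral_mono)
      show "integrable lborel (\<lambda>y. u y * ?e y)"
        using \<rho> sub by (intro integrable_mult_eta continuous_on_subset[OF cu]) auto
      show "integrable lborel (\<lambda>y. (c * \<rho> powr (- m)) * (indicator (cball x d) y * u y))"
        using borel_integrable_compact[OF compact_cball cu] by (intro integrable_mult_right) simp
      fix y show "u y * ?e y \<le> (c * \<rho> powr (- m)) * (indicator (cball x d) y * u y)"
      proof (cases "y \<in> cball z \<rho>")
        case True
        then have y: "y \<in> cball x d" using sub by auto
        have "?e y \<le> c * \<rho> powr (- m)" using eta_le_indicator[OF \<rho>(1), of y z] True by (simp add: c_def)
        then have "u y * ?e y \<le> u y * (c * \<rho> powr (- m))" using up[OF y] by (intro mult_left_mono) auto
        then show ?thesis using y by (simp add: mult.commute)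
      next
        case False
        have "0 \<le> indicator (cball x d) y * u y" using up[of y] by (auto simp: indicator_def)
        then show ?thesis using False \<rho> c by (simp add: eta_outside)
      qed
    qed
    also have "\<dots> = c * \<rho> powr (- m) * (\<integral>y. indicator (cball x d) y * u y \<partial>lborel)" by simp
    finally have a: "m * om * A / 2 \<le> c * \<rho> powr (- m) * (\<integral>y. indicator (cball x d) y * u y \<partial>lborel)" .
    define J where "J = (\<integral>y. indicator (cball x d) y * u y \<partial>lborel)"
    have "\<rho> powr (- m) * \<sigma> powr m = \<mu> powr (- m)"
      using \<mu> z by (simp add: \<rho>_def powr_mult powr_minus)
    then have "c * (\<rho> powr (- m) * \<sigma> powr m) * J = c * \<mu> powr (- m) * J" by simp
    moreover have "m * om * A / 2 * \<sigma> powr m \<le> c * \<rho> powr (- m) * J * \<sigma> powr m"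
      using a by (intro mult_right_mono) (auto simp: J_def)
    moreover have "c * \<rho> powr (- m) * J * \<sigma> powr m = c * (\<rho> powr (- m) * \<sigma> powr m) * J" by simp
    ultimately have "m * om * A / 2 * \<sigma> powr m \<le> c * \<mu> powr (- m) * J" by linarith
    then have "A * \<sigma> powr m \<le> 2 * c * \<mu> powr (- m) / (m * om) * J" using mp om_pos by (simp add: field_simps)
    then have "2 powr m * (A * \<sigma> powr m) \<le> 2 powr m * (2 * c * \<mu> powr (- m) / (m * om) * J)" by (intro mult_left_mono) auto
    moreover have "u x * d powr m \<le> 2 powr m * (A * \<sigma> powr m)" using ux z by (simp add: A_def powr_mult algebra_simps)
    ultimately have "u x * d powr m \<le> 2 * c * \<mu> powr (- m) / (m * om) * 2 powr m * J" by (simp add: algebra_simps)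
    then have "u x * d powr m * \<theta> powr (- m) \<le> 2 * c * \<mu> powr (- m) / (m * om) * 2 powr m * J * \<theta> powr (- m)"
      by (intro mult_right_mono) auto
    moreover have "d powr m * \<theta> powr (- m) = norm x powr m" using \<theta> by (simp add: d_def powr_mult powr_minus)
    ultimately show ?thesis by (simp add: C'_def J_def d_def algebra_simps)
  qed
  moreover have "C' \<ge> 0" unfolding C'_def using c m2 om_pos by simp
  ultimately show ?thesis using r0 by (intro that[of "r0/2" C']) auto
qed

text \<open>The two preceding bounds combine to give a multiple of |x|^(m-2) h(x)^2. The slack in
  \<open>b\<close> absorbs the square of the logarithm when \<open>m = 2\<close> and allows all
  dimensions to be treated alike.\<close>

lemma u_le_powr:
  assumes b: "b > m - 2"
  obtains r C where "0 < r" "0 < C" "r \<le> 1" "\<And>x. x \<noteq> 0 \<Longrightarrow> norm x < r \<Longrightarrow> u x \<le> C * norm x powr (- b)"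
proof -
  obtain \<theta> r1 C1 where \<theta>: "0 < \<theta>" "\<theta> \<le> 1/2" "0 < r1" "0 \<le> C1"
    and J: "\<And>x. x \<noteq> 0 \<Longrightarrow> norm x < r1 \<Longrightarrow> (\<integral>y. indicator (cball x (\<theta> * norm x)) y * u y \<partial>lborel)
      \<le> C1 * ((norm x)\<^sup>2) powr (m - 1) * (h x)\<^sup>2"
    by (rule local_mass_bound) blast
  obtain r2 C2 where r2: "0 < r2" "0 \<le> C2" "r2 \<le> 1"
    and pw: "\<And>x. x \<noteq> 0 \<Longrightarrow> norm x < r2 \<Longrightarrow> u x * norm x powr m \<le> C2 * (\<integral>y. indicator (cball x (\<theta> * norm x)) y * u y \<partial>lborel)"
    by (rule pointwise_le_average[OF \<theta>(1,2)]) blast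
  \<comment> \<open>The midpoint of \<open>m - 2\<close> and \<open>b\<close>. Since
    \<open>h\<close> enters squared, the exponent \<open>2 * a = b + m - 2\<close> makes the total
    exactly |x|^(-b).\<close>
  define a where "a = (b + m - 2) / 2"
  have a: "a > m - 2" using b by (simp add: a_def)
  obtain s0 where s0: "s0 > 0" and hs: "\<And>s. 0 < s \<Longrightarrow> s < s0 \<Longrightarrow> fsol m s \<le> s powr (- a/2)"
    by (rule fsol_le_powr[OF m2 a]) blast
  define r where "r = min r1 (min r2 (sqrt s0))"
  have r: "r > 0" "r \<le> r1" "r \<le> r2" "r \<le> sqrt s0" "r \<le> 1" using \<theta> r2 s0 by (auto simp: r_def)
  have "u x \<le> (C2 * C1 + 1) * norm x powr (- b)" if x: "x \<noteq> 0" "norm x < r" for x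
  proof -
    have nx: "norm x > 0" using x by simp
    have "norm x < sqrt s0" using x r by simp
    then have "(norm x)\<^sup>2 < (sqrt s0)\<^sup>2" by (intro power_strict_mono) auto
    then have "(norm x)\<^sup>2 < s0" using s0 by simp
    then have "h x \<le> ((norm x)\<^sup>2) powr (- a/2)" using nx by (intro hs) auto
    also have "\<dots> = norm x powr (- a)" using nx by (simp add: powr_powr flip: powr_numeral)
    finally have h1: "h x \<le> norm x powr (- a)" .
    have "0 \<le> h x" using x r nx by (intro fsol_nonneg m2) (auto simp: power_le_one)
    then have "(h x)\<^sup>2 \<le> (norm x powr (- a))\<^sup>2" using h1 by (intro power_mono) auto
    also have "\<dots> = norm x powr (- 2 * a)" using nx by (simp add: powr_powr mult.commute flip: powr_numeral)
    finally have h2: "(h x)\<^sup>2 \<le> norm x powr (- 2 * a)" .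
    have s1: "((norm x)\<^sup>2) powr (m - 1) = norm x powr (2 * (m - 1))" using nx by (simp add: powr_powr flip: powr_numeral)
    have "u x * norm x powr m \<le> C2 * (C1 * ((norm x)\<^sup>2) powr (m - 1) * (h x)\<^sup>2)"
      using pw[of x] J[of x] x r r2 by (meson mult_left_mono order_less_le_trans order_trans)
    also have "\<dots> \<le> C2 * (C1 * ((norm x)\<^sup>2) powr (m - 1) * norm x powr (- 2 * a))"
      using h2 r2 \<theta> by (intro mult_left_mono mult_nonneg_nonneg) auto
    also have "\<dots> = C2 * C1 * (norm x powr (2 * (m - 1)) * norm x powr (- 2 * a))" by (simp add: s1)
    also have "norm x powr (2 * (m - 1)) * norm x powr (- 2 * a) = norm x powr (- b) * norm x powr m"
    proof -
      have "2 * a = b + m - 2" by (simp add: a_def)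
      then have "2 * (m - 1) + (- 2 * a) = - b + m" by (simp add: algebra_simps)
      then show ?thesis by (metis powr_add)
    qed
    finally have "u x * norm x powr m \<le> C2 * C1 * norm x powr (- b) * norm x powr m" by simp
    then have "u x \<le> C2 * C1 * norm x powr (- b)" using nx by (simp add: mult_le_cancel_right)
    also have "\<dots> \<le> (C2 * C1 + 1) * norm x powr (- b)" by (intro mult_right_mono) auto
    finally show ?thesis .
  qed
  moreover have "C2 * C1 + 1 > 0" using r2 \<theta> by (simp add: add_nonneg_pos)
  ultimately show ?thesis using r by (intro that[of r "C2 * C1 + 1"]) auto
qed

end

section \<open>The weak equation and its defect at the origin\<close>

lemma locally_integrable_punctured:
  fixes f :: "real^'n::finite \<Rightarrow> real"
  assumes f: "continuous_on (- {0}) f" and r: "r > 0" "integrable lborel (\<lambda>x. indicator (ball 0 r) x * f x)"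
  shows "locally_integrable f"
  unfolding locally_integrable_def
proof (intro allI impI)
  fix K :: "(real^'n) set" assume K: "compact K"
  have "set_integrable lborel (ball 0 r) f" using r(2) by (simp add: set_integrable_def)
  then have a: "set_integrable lborel (K \<inter> ball 0 r) f"
    by (rule set_integrable_subset) (use K in \<open>auto intro: borel_compact\<close>)
  have "compact (K - ball 0 r)" using K by (simp add: compact_diff)
  moreover have "continuous_on (K - ball 0 r) f" using r(1) by (intro continuous_on_subset[OF f]) auto
  ultimately have b: "set_integrable lborel (K - ball 0 r) f"
    unfolding set_integrable_def by (rule borel_integrable_compact)
  have "set_integrable lborel ((K \<inter> ball 0 r) \<union> (K - ball 0 r)) f"
    by (rule set_integrable_Un[OF a b]) (use K in \<open>auto intro: borel_compact\<close>)
  moreover have "(K \<inter> ball 0 r) \<union> (K - ball 0 r) = K" by auto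
  ultimately show "set_integrable lborel K f" by simp
qed

lemma integrable_locally_integrable_mult:
  fixes w g :: "real^'n::finite \<Rightarrow> real"
  assumes w: "locally_integrable w" "w \<in> borel_measurable borel"
    and g: "continuous_on UNIV g" "compact K" "\<And>x. x \<notin> K \<Longrightarrow> g x = 0"
  shows "integrable lborel (\<lambda>x. w x * g x)"
proof -
  obtain M where M: "M > 0" "\<And>x. \<bar>g x\<bar> \<le> M" using bounded_compact_support[OF g] by blast
  have i: "integrable lborel (\<lambda>x. M * (indicator K x * w x))"
    using w(1) g(2) unfolding locally_integrable_def set_integrable_def by (intro integrable_mult_right) simp
  have [measurable]: "g \<in> borel_measurable borel" using g(1) by (rule borel_measurable_continuous_onI)
  note [measurable] = w(2)
  show ?thesis
  proof (rule Bochner_Integration.integrable_bound[OF i])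
    show "AE x in lborel. norm (w x * g x) \<le> norm (M * (indicator K x * w x))"
    proof (rule AE_I2)
      fix x show "norm (w x * g x) \<le> norm (M * (indicator K x * w x))"
      proof (cases "x \<in> K")
        case True
        have "\<bar>w x\<bar> * \<bar>g x\<bar> \<le> \<bar>w x\<bar> * M" using M by (intro mult_left_mono) auto
        then show ?thesis using True M(1) by (simp add: abs_mult mult.commute)
      qed (simp add: g(3))
    qed
  qed simp
qed

text \<open>Wider than \<open>test_function\<close>, because the spline cutoffs and the differences
  of \<open>gam\<close> are only C^2 and must be admissible in the weak equation.\<close>

definition C2c :: "(real^'n::finite \<Rightarrow> real) \<Rightarrow> bool" where
  "C2c \<xi> \<longleftrightarrow> C2_on UNIV \<xi> \<and> (\<exists>K. compact K \<and> (\<forall>x. x \<notin> K \<longrightarrow> \<xi> x = 0))"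

lemma test_function_C2c: "test_function \<xi> \<Longrightarrow> C2c \<xi>"
  unfolding C2c_def
proof
  assume t: "test_function \<xi>"
  then have s: "continuous_on UNIV (partial_iter is \<xi>)" "has_partial i (partial_iter is \<xi>) x" for "is" i x
    unfolding test_function_def smooth_def by auto
  show "C2_on UNIV \<xi>" unfolding C2_on_def
    using s(1)[of "[]"] s(2)[of _ "[]"] s(1)[of "[_]"] s(2)[of _ "[_]"] s(1)[of "[_,_]"] by simp
  have "\<xi> x = 0" if "x \<notin> closure {x. \<xi> x \<noteq> 0}" for x
    using that closure_subset[of "{x. \<xi> x \<noteq> 0}"] by auto
  then show "\<exists>K. compact K \<and> (\<forall>x. x \<notin> K \<longrightarrow> \<xi> x = 0)"
    using t unfolding test_function_def by blast
qed

lemma C2c_diff: "C2c f \<Longrightarrow> C2c g \<Longrightarrow> C2c (\<lambda>x. f x - g x)"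
  unfolding C2c_def
proof (elim conjE exE, intro conjI)
  fix K L assume K: "compact K" "\<forall>x. x \<notin> K \<longrightarrow> f x = 0" and L: "compact L" "\<forall>x. x \<notin> L \<longrightarrow> g x = 0"
  show "\<exists>K. compact K \<and> (\<forall>x. x \<notin> K \<longrightarrow> f x - g x = 0)"
    using K L by (intro exI[of _ "K \<union> L"]) auto
qed (auto intro: C2_on_diff)

lemma C2c_cmult: "C2c f \<Longrightarrow> C2c (\<lambda>x. c * f x)"
  unfolding C2c_def by (auto intro: C2_on_cmult)

lemma C2c_mult: "C2c f \<Longrightarrow> C2_on UNIV g \<Longrightarrow> C2c (\<lambda>x. f x * g x)"
  unfolding C2c_def by (auto intro: C2_on_mult)

text \<open>The path from 0 to \<open>x\<close> switches on one coordinate at a time. Each leg runs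
  parallel to an axis, so bounds on the partial derivatives apply directly, and each leg has length
  at most \<open>norm x\<close>.\<close>

lemma partial_bounded_imp_lipschitz_at_0:
  fixes f :: "real^'n::finite \<Rightarrow> real"
  assumes f: "C2_on UNIV f" and L: "\<And>i x. \<bar>partial i f x\<bar> \<le> L"
  shows "\<bar>f x - f 0\<bar> \<le> real CARD('n) * L * norm x"
proof -
  have L0: "L \<ge> 0" using L abs_ge_zero order_trans by blast
  define y where "y I = (\<chi> i. if i \<in> I then x $ i else 0)" for I :: "'n set"
  have "\<bar>f (y I) - f 0\<bar> \<le> real (card I) * (L * norm x)" if "finite I" for I
    using that
  proof induction
    case empty
    have "y {} = 0" by (simp add: y_def vec_eq_iff)
    then show ?case by simp
  next
    case (insert j I)
    have yj: "y (insert j I) = y I + x $ j *\<^sub>R axis j 1"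
      using insert(2) by (auto simp: y_def vec_eq_iff axis_def)
    have d: "((\<lambda>t. f (y I + t *\<^sub>R axis j 1)) has_real_derivative partial j f (y I + t *\<^sub>R axis j 1)) (at t)" for t
      by (intro has_pd_shift C2_onD(4)[OF f]) simp
    have "\<bar>f (y I + (x $ j) *\<^sub>R axis j 1) - f (y I + 0 *\<^sub>R axis j 1)\<bar> \<le> L * \<bar>x $ j - 0\<bar>"
      using field_differentiable_bound[of UNIV "\<lambda>t. f (y I + t *\<^sub>R axis j 1)" "\<lambda>t. partial j f (y I + t *\<^sub>R axis j 1)" L "x $ j" 0]
        d L by (auto simp: has_field_derivative_at_within)
    also have "\<dots> \<le> L * norm x" using L0 component_le_norm_cart[of x j] by (intro mult_left_mono) auto
    finally have "\<bar>f (y (insert j I)) - f (y I)\<bar> \<le> L * norm x" by (simp add: yj)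
    then have "\<bar>f (y (insert j I)) - f 0\<bar> \<le> L * norm x + real (card I) * (L * norm x)" using insert(3) by linarith
    then show ?case using insert(1,2) by (simp add: algebra_simps)
  qed
  from this[of UNIV] have "\<bar>f (y UNIV) - f 0\<bar> \<le> real CARD('n) * (L * norm x)" by simp
  moreover have "y UNIV = x" by (simp add: y_def vec_eq_iff)
  ultimately show ?thesis by (simp add: mult.assoc)
qed

text \<open>\<open>kap\<close> is reused: \<open>2 * kap (t/2) - kap t\<close> is 0 for
  \<open>t \<le> 1\<close> and 3/2 for \<open>t \<ge> 4\<close>. With
  \<open>t = |x|^2 / \<epsilon>^2\<close> the transition takes place for \<epsilon> \<le> |x| \<le>
  2 \<epsilon>.\<close>

definition cut :: "real \<Rightarrow> real" where
  "cut t = 1 - 2/3 * (2 * kap (t/2) - kap t)"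
definition cut1 :: "real \<Rightarrow> real" where
  "cut1 t = - 2/3 * (kap1 (t/2) - kap1 t)"
definition cut2 :: "real \<Rightarrow> real" where
  "cut2 t = - 2/3 * (kap2 (t/2) / 2 - kap2 t)"

lemma DERIV_cut: "(cut has_real_derivative cut1 t) (at t)"
proof -
  have "((\<lambda>t. kap (t/2)) has_real_derivative kap1 (t/2) * (1/2)) (at t)"
    by (rule DERIV_chain2[OF DERIV_kap]) (auto intro!: derivative_eq_intros)
  then show ?thesis unfolding cut_def[abs_def] cut1_def
    by (auto intro!: derivative_eq_intros DERIV_kap)
qed

lemma DERIV_cut1: "(cut1 has_real_derivative cut2 t) (at t)"
proof -
  have "((\<lambda>t. kap1 (t/2)) has_real_derivative kap2 (t/2) * (1/2)) (at t)"
    by (rule DERIV_chain2[OF DERIV_kap1]) (auto intro!: derivative_eq_intros)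
  then show ?thesis unfolding cut1_def[abs_def] cut2_def
    by (auto intro!: derivative_eq_intros DERIV_kap1)
qed

lemma continuous_cut2: "continuous_on S cut2"
  unfolding cut2_def[abs_def]
  by (intro continuous_intros continuous_kap2 continuous_on_compose2[OF continuous_kap2[of UNIV]]) auto

lemma cut_low: "t \<le> 1 \<Longrightarrow> 0 \<le> t \<Longrightarrow> cut t = 1 \<and> cut1 t = 0 \<and> cut2 t = 0"
  by (simp add: cut_def cut1_def cut2_def kap_low)

lemma cut_high: "t \<ge> 4 \<Longrightarrow> cut t = 0 \<and> cut1 t = 0 \<and> cut2 t = 0"
  by (simp add: cut_def cut1_def cut2_def kap_high)

lemma cut_bounds: "t \<ge> 0 \<Longrightarrow> \<bar>cut t\<bar> \<le> 4" "\<bar>cut1 t\<bar> \<le> 1" "\<bar>cut2 t\<bar> \<le> 2"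
proof -
  show "\<bar>cut t\<bar> \<le> 4" if "t \<ge> 0"
  proof -
    have "kap t \<ge> 0" "kap (t/2) \<ge> 0" using that by (auto intro: kap_nonneg)
    moreover have "cut t = 1 - 4/3 * kap (t/2) + 2/3 * kap t" by (simp add: cut_def algebra_simps)
    ultimately show ?thesis using kap_le[of t] kap_le[of "t/2"] by linarith
  qed
  show "\<bar>cut1 t\<bar> \<le> 1"
    using kap1_bounds[of t] kap1_bounds[of "t/2"] unfolding cut1_def by (simp add: abs_le_iff)
  show "\<bar>cut2 t\<bar> \<le> 2"
    using kap2_bounds(1,2)[of t] kap2_bounds(1,2)[of "t/2"] unfolding cut2_def by (simp add: abs_le_iff)
qed

definition cutoff :: "real \<Rightarrow> real^'n::finite \<Rightarrow> real" where
  "cutoff \<epsilon> x = cut ((norm x)\<^sup>2 / \<epsilon>\<^sup>2)"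

lemma cutoff_eq:
  assumes "\<epsilon> > 0"
  shows "norm x \<le> \<epsilon> \<Longrightarrow> cutoff \<epsilon> x = 1" "norm x \<ge> 2 * \<epsilon> \<Longrightarrow> cutoff \<epsilon> x = 0" "\<bar>cutoff \<epsilon> x\<bar> \<le> 4"
proof -
  show "cutoff \<epsilon> x = 1" if "norm x \<le> \<epsilon>"
  proof -
    have "(norm x)\<^sup>2 \<le> \<epsilon>\<^sup>2" using that by (intro power_mono) auto
    then show ?thesis using assms by (simp add: cutoff_def cut_low)
  qed
  show "cutoff \<epsilon> x = 0" if "norm x \<ge> 2 * \<epsilon>"
  proof -
    have "(2 * \<epsilon>)\<^sup>2 \<le> (norm x)\<^sup>2" using that assms by (intro power_mono) auto
    then have "(norm x)\<^sup>2 / \<epsilon>\<^sup>2 \<ge> 4" using assms by (simp add: le_divide_eq power_mult_distrib)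
    then show ?thesis by (simp add: cutoff_def cut_high)
  qed
  show "\<bar>cutoff \<epsilon> x\<bar> \<le> 4" unfolding cutoff_def by (rule cut_bounds(1)) simp
qed

lemma cutoff_C2:
  fixes x :: "real^'n::finite"
  assumes "\<epsilon> > 0"
  shows "C2_on UNIV (cutoff \<epsilon> :: real^'n \<Rightarrow> real)"
    and "laplacian (cutoff \<epsilon>) x = 4 * (norm x)\<^sup>2 * (cut2 ((norm x)\<^sup>2 / \<epsilon>\<^sup>2) / \<epsilon>^4) + 2 * real CARD('n) * (cut1 ((norm x)\<^sup>2 / \<epsilon>\<^sup>2) / \<epsilon>\<^sup>2)"
    and "partial i (cutoff \<epsilon>) x = cut1 ((norm x)\<^sup>2 / \<epsilon>\<^sup>2) / \<epsilon>\<^sup>2 * (2 * x $ i)"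
proof -
  have l: "((\<lambda>s. s / \<epsilon>\<^sup>2) has_real_derivative 1 / \<epsilon>\<^sup>2) (at s)" for s
    by (rule DERIV_cdivide[OF DERIV_ident])
  have d1: "((\<lambda>s. cut (s / \<epsilon>\<^sup>2)) has_real_derivative cut1 (s / \<epsilon>\<^sup>2) / \<epsilon>\<^sup>2) (at s)" for s
    using DERIV_chain2[OF DERIV_cut l] by simp
  have d2: "((\<lambda>s. cut1 (s / \<epsilon>\<^sup>2) / \<epsilon>\<^sup>2) has_real_derivative cut2 (s / \<epsilon>\<^sup>2) / \<epsilon>^4) (at s)" for s
  proof -
    have "\<epsilon>^4 = \<epsilon>\<^sup>2 * \<epsilon>\<^sup>2" by (simp flip: power_add)
    then show ?thesis using DERIV_cdivide[OF DERIV_chain2[OF DERIV_cut1 l], of "\<epsilon>\<^sup>2"] by simp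
  qed
  have c: "continuous_on UNIV (\<lambda>x::real^'n. cut2 ((norm (x - 0))\<^sup>2 / \<epsilon>\<^sup>2) / \<epsilon>^4)"
    using assms by (intro continuous_intros continuous_on_compose2[OF continuous_cut2[of UNIV]]) auto
  have e: "cutoff \<epsilon> = (\<lambda>x::real^'n. cut ((norm (x - 0))\<^sup>2 / \<epsilon>\<^sup>2))" by (auto simp: cutoff_def)
  note R = radial_C2[where S="UNIV::(real^'n) set" and c=0 and F="\<lambda>s. cut (s / \<epsilon>\<^sup>2)", OF open_UNIV d1 d2 c]
  show "C2_on UNIV (cutoff \<epsilon> :: real^'n \<Rightarrow> real)" unfolding e by (rule R(1))
  show "laplacian (cutoff \<epsilon>) x = 4 * (norm x)\<^sup>2 * (cut2 ((norm x)\<^sup>2 / \<epsilon>\<^sup>2) / \<epsilon>^4) + 2 * real CARD('n) * (cut1 ((norm x)\<^sup>2 / \<epsilon>\<^sup>2) / \<epsilon>\<^sup>2)"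
    unfolding e using R(2)[of x] by simp
  show "partial i (cutoff \<epsilon>) x = cut1 ((norm x)\<^sup>2 / \<epsilon>\<^sup>2) / \<epsilon>\<^sup>2 * (2 * x $ i)"
    unfolding e using R(3)[of x i] by simp
qed

lemma cutoff_derivative_bounds:
  fixes x :: "real^'n::finite"
  assumes \<epsilon>: "\<epsilon> > 0"
  shows "\<bar>laplacian (cutoff \<epsilon>) x\<bar> \<le> (32 + 2 * real CARD('n)) / \<epsilon>\<^sup>2"
    and "\<bar>partial i (cutoff \<epsilon>) x\<bar> \<le> 4 / \<epsilon>"
    and "norm x < \<epsilon> \<or> norm x > 2 * \<epsilon> \<Longrightarrow> laplacian (cutoff \<epsilon>) x = 0 \<and> partial i (cutoff \<epsilon>) x = 0"
proof -
  let ?t = "(norm x)\<^sup>2 / \<epsilon>\<^sup>2"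
  have van: "cut1 ?t = 0 \<and> cut2 ?t = 0" if "norm x < \<epsilon> \<or> norm x > 2 * \<epsilon>"
    using that
  proof
    assume "norm x < \<epsilon>"
    then have "(norm x)\<^sup>2 \<le> \<epsilon>\<^sup>2" by (intro power_mono) auto
    then show ?thesis using \<epsilon> by (simp add: cut_low)
  next
    assume "norm x > 2 * \<epsilon>"
    then have "(2 * \<epsilon>)\<^sup>2 \<le> (norm x)\<^sup>2" using \<epsilon> by (intro power_mono) auto
    then have "?t \<ge> 4" using \<epsilon> by (simp add: le_divide_eq power_mult_distrib)
    then show ?thesis by (simp add: cut_high)
  qed
  then show z: "laplacian (cutoff \<epsilon>) x = 0 \<and> partial i (cutoff \<epsilon>) x = 0" if "norm x < \<epsilon> \<or> norm x > 2 * \<epsilon>" for i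
    using that by (simp add: cutoff_C2[OF \<epsilon>])
  show "\<bar>laplacian (cutoff \<epsilon>) x\<bar> \<le> (32 + 2 * real CARD('n)) / \<epsilon>\<^sup>2"
  proof (cases "norm x > 2 * \<epsilon>")
    case False
    then have "(norm x)\<^sup>2 \<le> (2 * \<epsilon>)\<^sup>2" using \<epsilon> by (intro power_mono) auto
    then have "(norm x)\<^sup>2 \<le> 4 * \<epsilon>\<^sup>2" by (simp add: power_mult_distrib)
    then have "\<bar>4 * (norm x)\<^sup>2 * (cut2 ?t / \<epsilon>^4)\<bar> \<le> 4 * (4 * \<epsilon>\<^sup>2) * (2 / \<epsilon>^4)"
      unfolding abs_mult abs_divide using cut_bounds(3)[of ?t] \<epsilon> by (intro mult_mono frac_le) auto
    also have "\<dots> = 32 / \<epsilon>\<^sup>2" using \<epsilon> by (simp add: power2_eq_square power4_eq_xxxx)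
    finally have 1: "\<bar>4 * (norm x)\<^sup>2 * (cut2 ?t / \<epsilon>^4)\<bar> \<le> 32 / \<epsilon>\<^sup>2" .
    have "\<bar>2 * real CARD('n) * (cut1 ?t / \<epsilon>\<^sup>2)\<bar> \<le> 2 * real CARD('n) * (1 / \<epsilon>\<^sup>2)"
      unfolding abs_mult abs_divide using cut_bounds(2)[of ?t] \<epsilon> by (intro mult_mono frac_le) auto
    with 1 show ?thesis unfolding cutoff_C2(2)[OF \<epsilon>] add_divide_distrib
      using abs_triangle_ineq[of "4 * (norm x)\<^sup>2 * (cut2 ?t / \<epsilon>^4)" "2 * real CARD('n) * (cut1 ?t / \<epsilon>\<^sup>2)"] by simp
  qed (use z[of i] in simp)
  show "\<bar>partial i (cutoff \<epsilon>) x\<bar> \<le> 4 / \<epsilon>"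
  proof (cases "norm x > 2 * \<epsilon>")
    case False
    have "\<bar>cut1 ?t / \<epsilon>\<^sup>2 * (2 * x $ i)\<bar> \<le> 1 / \<epsilon>\<^sup>2 * (2 * (2 * \<epsilon>))"
      unfolding abs_mult abs_divide
      using cut_bounds(2)[of ?t] \<epsilon> False component_le_norm_cart[of x i] by (intro mult_mono frac_le) auto
    also have "\<dots> = 4 / \<epsilon>" using \<epsilon> by (simp add: power2_eq_square)
    finally show ?thesis by (simp add: cutoff_C2(3)[OF \<epsilon>])
  qed (use z[of i] \<epsilon> in simp)
qed

context singular_solution begin

lemma locally_integrable_src: "locally_integrable src"
  by (rule src_integrable_near_0) (rule locally_integrable_punctured[OF continuous_src])

lemma locally_integrable_u: "locally_integrable u"
proof -
  obtain r where r: "r > 0" "integrable lborel (\<lambda>x. indicator (ball 0 r) x * src x)"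
    by (rule src_integrable_near_0) blast
  obtain R where R: "0 < R" and nb: "\<And>x. x \<noteq> 0 \<Longrightarrow> norm x \<le> R \<Longrightarrow> 1 \<le> u x \<and> u x \<le> src x"
    by (rule near_origin) blast
  have "integrable lborel (\<lambda>x. indicator (ball 0 (min r R)) x * u x)"
  proof (rule Bochner_Integration.integrable_bound[OF r(2)])
    show "(\<lambda>x. indicator (ball 0 (min r R)) x * u x) \<in> borel_measurable lborel"
      by (auto intro!: borel_measurable_times measurable_u borel_measurable_indicator)
    show "AE x in lborel. norm (indicator (ball 0 (min r R)) x * u x) \<le> norm (indicator (ball 0 r) x * src x)"
      using AE_lborel_singleton[of "0::real^'n"]
    proof eventually_elim
      case (elim x)
      then show ?case using nb[of x] by (auto simp: indicator_def)
    qed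
  qed
  then show ?thesis using r R by (intro locally_integrable_punctured[OF continuous_u, of "min r R"]) auto
qed

lemma locally_integrable_nonlinearity: "locally_integrable (\<lambda>x. Q x * \<bar>u x\<bar> powr (p - 1) * u x)"
proof -
  have "(\<lambda>x. Q x * \<bar>u x\<bar> powr (p - 1) * u x) = (\<lambda>x. src x - u x)" by (auto simp: src_def)
  then show ?thesis using locally_integrable_src locally_integrable_u
    unfolding locally_integrable_def by (auto intro: set_integral_diff)
qed

text \<open>The defect of the weak equation, that is, what Green's identity misses because of the
  singularity; the linear term is contained in \<open>src\<close>.\<close>

definition weak :: "(real^'n \<Rightarrow> real) \<Rightarrow> real" where
  "weak \<xi> = (\<integral>x. (u x * - laplacian \<xi> x - src x * \<xi> x) \<partial>lborel)"

lemma weak_integrable: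
  assumes "C2c \<xi>"
  shows "integrable lborel (\<lambda>x. u x * - laplacian \<xi> x)" "integrable lborel (\<lambda>x. src x * \<xi> x)"
proof -
  obtain K where K: "C2_on UNIV \<xi>" "compact K" "\<And>x. x \<notin> K \<Longrightarrow> \<xi> x = 0" using assms unfolding C2c_def by auto
  have "laplacian \<xi> x = 0" if "x \<notin> K" for x
    by (rule laplacian_zero_open[of "- K"]) (use K that in \<open>auto simp: open_Compl compact_imp_closed\<close>)
  then show "integrable lborel (\<lambda>x. u x * - laplacian \<xi> x)"
    by (intro integrable_locally_integrable_mult[OF locally_integrable_u measurable_u _ K(2)] continuous_intros
        C2_on_continuous_laplacian[OF K(1)]) auto
  show "integrable lborel (\<lambda>x. src x * \<xi> x)"
    by (rule integrable_locally_integrable_mult[OF locally_integrable_src measurable_src C2_onD(1)[OF K(1)] K(2,3)])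
qed

lemma weak_integrable': "C2c \<xi> \<Longrightarrow> integrable lborel (\<lambda>x. u x * - laplacian \<xi> x - src x * \<xi> x)"
  by (intro Bochner_Integration.integrable_diff weak_integrable)

lemma weak_diff:
  assumes "C2c \<xi>" "C2c \<zeta>" shows "weak (\<lambda>x. \<xi> x - \<zeta> x) = weak \<xi> - weak \<zeta>"
proof -
  have "C2_on UNIV \<xi>" "C2_on UNIV \<zeta>" using assms unfolding C2c_def by auto
  then have l: "laplacian (\<lambda>x. \<xi> x - \<zeta> x) x = laplacian \<xi> x - laplacian \<zeta> x" for x
    by (intro C2_on_diff(2)[of UNIV]) auto
  show ?thesis
    unfolding weak_def l Bochner_Integration.integral_diff[OF weak_integrable'[OF assms(1)] weak_integrable'[OF assms(2)], symmetric]
    by (intro Bochner_Integration.integral_cong) (auto simp: algebra_simps)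
qed

lemma weak_cmult:
  assumes "C2c \<xi>" shows "weak (\<lambda>x. c * \<xi> x) = c * weak \<xi>"
proof -
  have "C2_on UNIV \<xi>" using assms unfolding C2c_def by auto
  then have l: "laplacian (\<lambda>x. c * \<xi> x) x = c * laplacian \<xi> x" for x
    by (intro C2_on_cmult(2)[of UNIV]) auto
  show ?thesis
    unfolding weak_def l integral_mult_right_zero[symmetric]
    by (intro Bochner_Integration.integral_cong) (auto simp: algebra_simps)
qed

lemma weak_eq_0_away:
  assumes "C2c \<xi>" "\<epsilon> > 0" "\<And>x. norm x < \<epsilon> \<Longrightarrow> \<xi> x = 0" shows "weak \<xi> = 0"
proof -
  obtain K where K: "C2_on UNIV \<xi>" "compact K" "\<And>x. x \<notin> K \<Longrightarrow> \<xi> x = 0" using assms(1) unfolding C2c_def by auto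
  have K': "compact (K - ball 0 \<epsilon>)" "K - ball 0 \<epsilon> \<subseteq> - {0}" "\<And>x. x \<notin> K - ball 0 \<epsilon> \<Longrightarrow> \<xi> x = 0"
    using K assms by (auto simp: compact_diff)
  have G: "(\<integral>x. u x * laplacian \<xi> x - \<xi> x * laplacian u x \<partial>lborel) = 0"
    by (rule green_identity(2)[OF open_Compl[OF closed_singleton] K'(1,2) _ uC2 C2_on_subset[OF K(1) subset_UNIV]])
       (erule K'(3))
  have l0: "laplacian \<xi> 0 = 0" by (rule laplacian_zero_open[of "ball 0 \<epsilon>"]) (use assms in auto)
  have e: "u x * laplacian \<xi> x - \<xi> x * laplacian u x = - (u x * - laplacian \<xi> x - src x * \<xi> x)" for x
    using l0 assms(2) assms(3)[of 0] laplacian_u[of x] by (cases "x = 0") auto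
  show ?thesis using G unfolding e weak_def integral_minus by (simp only: neg_equal_0_iff_equal)
qed

text \<open>Replacing \<zeta> by \<zeta> times a cutoff at scale \<epsilon> does not change the
  defect. Terms with a differentiated cutoff live on \<epsilon> \<le> |x| \<le> 2 \<epsilon>; since
  \<zeta> = O(|x|) they are of order |u| / \<epsilon> there, so they integrate to
  O(\<epsilon>^(m-b-1)). The other terms vanish in the limit by dominated convergence.\<close>

lemma weak_eq_0:
  assumes \<zeta>: "C2c \<zeta>" and z0: "\<zeta> 0 = 0" shows "weak \<zeta> = 0"
proof -
  obtain K where K: "C2_on UNIV \<zeta>" "compact K" "\<And>x. x \<notin> K \<Longrightarrow> \<zeta> x = 0" using \<zeta> unfolding C2c_def by auto
  have oK: "open (- K)" using K(2) by (simp add: open_Compl compact_imp_closed)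
  have "\<exists>M. \<forall>x. \<bar>partial i \<zeta> x\<bar> \<le> M" for i
  proof -
    have "partial i \<zeta> x = 0" if "x \<notin> K" for x
      by (rule partial_zero_open[OF oK]) (use K that in auto)
    from bounded_compact_support[OF C2_onD(2)[OF K(1)] K(2) this] show ?thesis by blast
  qed
  then obtain M where M: "\<And>i x. \<bar>partial i \<zeta> x\<bar> \<le> M i" by metis
  define L where "L = (\<Sum>i\<in>UNIV. \<bar>M i\<bar>)"
  have L: "\<bar>partial i \<zeta> x\<bar> \<le> L" for i x
    using M[of i x] member_le_sum[of i UNIV "\<lambda>i. \<bar>M i\<bar>"] unfolding L_def by (auto intro: order_trans)
  have L0: "L \<ge> 0" by (simp add: L_def sum_nonneg)
  have lip: "\<bar>\<zeta> x\<bar> \<le> m * L * norm x" for x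
    using partial_bounded_imp_lipschitz_at_0[OF K(1) L, of x] by (simp add: z0 m_eq)
  \<comment> \<open>The midpoint of \<open>m - 2\<close> and \<open>m - 1\<close>: above the first
    the growth bound is available, below the second the cutoff error tends to 0, here like
    \<open>\<epsilon> powr (1/2)\<close>.\<close>
  define b where "b = m - 3/2"
  have b: "b > m - 2" "b \<ge> 0" using m2 by (auto simp: b_def)
  obtain r0 C where r0: "0 < r0" "0 < C" and up: "\<And>x. x \<noteq> 0 \<Longrightarrow> norm x < r0 \<Longrightarrow> u x \<le> C * norm x powr (- b)"
    by (rule u_le_powr[OF b(1)]) blast
  obtain R where R: "0 < R" and nb: "\<And>x. x \<noteq> 0 \<Longrightarrow> norm x \<le> R \<Longrightarrow> 1 \<le> u x"
    by (rule near_origin) blast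
  define r where "r = min (r0/2) R / 2"
  have r: "r > 0" "2 * r < r0" "2 * r \<le> R" using r0 R by (auto simp: r_def)
  define D where "D = C * (m * L * 2 * (32 + 2 * m) + 2 * m * L * 4) * om * 2 powr m"
  \<comment> \<open>The part of the product rule in which the cutoff is not differentiated;
    \<open>?b\<close> below collects the terms with derivatives of the cutoff.\<close>
  let ?a = "\<lambda>\<epsilon> x. (u x * - laplacian \<zeta> x - src x * \<zeta> x) * cutoff \<epsilon> x"
  have est: "\<bar>weak \<zeta> - (\<integral>x. ?a \<epsilon> x \<partial>lborel)\<bar> \<le> D * \<epsilon> powr (1/2)" and inta: "integrable lborel (?a \<epsilon>)" if \<epsilon>: "0 < \<epsilon>" "\<epsilon> \<le> r" for \<epsilon>
  proof -
    note cC = cutoff_C2(1)[OF \<epsilon>(1), where 'n='n]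
    have z\<chi>: "C2c (\<lambda>x. \<zeta> x * cutoff \<epsilon> x)" by (rule C2c_mult[OF \<zeta> cC])
    have "weak (\<lambda>x. \<zeta> x - \<zeta> x * cutoff \<epsilon> x) = 0"
      by (rule weak_eq_0_away[OF C2c_diff[OF \<zeta> z\<chi>] \<epsilon>(1)]) (simp add: cutoff_eq(1)[OF \<epsilon>(1)])
    then have w: "weak \<zeta> = weak (\<lambda>x. \<zeta> x * cutoff \<epsilon> x)" using weak_diff[OF \<zeta> z\<chi>] by simp
    let ?b = "\<lambda>x. u x * - (\<zeta> x * laplacian (cutoff \<epsilon>) x + 2 * (\<Sum>i\<in>UNIV. partial i \<zeta> x * partial i (cutoff \<epsilon>) x))"
    have e: "u x * - laplacian (\<lambda>x. \<zeta> x * cutoff \<epsilon> x) x - src x * (\<zeta> x * cutoff \<epsilon> x) = ?a \<epsilon> x + ?b x" for x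
      by (subst C2_on_mult(2)[OF open_UNIV K(1) cC]) (auto simp: algebra_simps)
    have cc: "continuous_on UNIV (cutoff \<epsilon> :: real^'n \<Rightarrow> real)" using C2_onD(1)[OF cC] .
    have [measurable]: "cutoff \<epsilon> \<in> borel_measurable (borel :: (real^'n) measure)" using cc by (rule borel_measurable_continuous_onI)
    show ia: "integrable lborel (?a \<epsilon>)"
    proof (rule Bochner_Integration.integrable_bound)
      show "integrable lborel (\<lambda>x. 4 * (u x * - laplacian \<zeta> x - src x * \<zeta> x))"
        by (intro integrable_mult_right weak_integrable'[OF \<zeta>])
      show "?a \<epsilon> \<in> borel_measurable lborel"
        using borel_measurable_integrable[OF weak_integrable'[OF \<zeta>]] by (intro borel_measurable_times) auto
      show "AE x in lborel. norm (?a \<epsilon> x) \<le> norm (4 * (u x * - laplacian \<zeta> x - src x * \<zeta> x))"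
      proof (rule AE_I2)
        fix x show "norm (?a \<epsilon> x) \<le> norm (4 * (u x * - laplacian \<zeta> x - src x * \<zeta> x))"
          unfolding real_norm_def abs_mult
          by (rule order_trans[OF mult_left_mono[OF cutoff_eq(3)[OF \<epsilon>(1)] abs_ge_zero]]) simp
      qed
    qed
    have ib: "integrable lborel ?b"
    proof -
      have "integrable lborel (\<lambda>x. (?a \<epsilon> x + ?b x) - ?a \<epsilon> x)"
        using weak_integrable'[OF z\<chi>] unfolding e by (intro Bochner_Integration.integrable_diff ia)
      then show ?thesis by simp
    qed
    have "weak \<zeta> = (\<integral>x. ?a \<epsilon> x + ?b x \<partial>lborel)"
      using w unfolding weak_def[of "\<lambda>x. \<zeta> x * cutoff \<epsilon> x"] e .
    also have "\<dots> = (\<integral>x. ?a \<epsilon> x \<partial>lborel) + (\<integral>x. ?b x \<partial>lborel)"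
      by (rule Bochner_Integration.integral_add[OF ia ib])
    finally have "weak \<zeta> - (\<integral>x. ?a \<epsilon> x \<partial>lborel) = (\<integral>x. ?b x \<partial>lborel)" by simp
    then have "\<bar>weak \<zeta> - (\<integral>x. ?a \<epsilon> x \<partial>lborel)\<bar> \<le> (\<integral>x. \<bar>?b x\<bar> \<partial>lborel)" by (simp only: integral_abs_bound)
    also have "\<dots> \<le> (\<integral>x. (C * (m * L * 2 * (32 + 2 * m) + 2 * m * L * 4) * \<epsilon> powr (- b - 1)) * indicator (cball (0::real^'n) (2 * \<epsilon>)) x \<partial>lborel)"
    proof (rule integral_mono)
      show "integrable lborel (\<lambda>x. \<bar>?b x\<bar>)" using ib by (rule integrable_abs)
      show "integrable lborel (\<lambda>x::real^'n. (C * (m * L * 2 * (32 + 2 * m) + 2 * m * L * 4) * \<epsilon> powr (- b - 1)) * indicator (cball 0 (2 * \<epsilon>)) x)"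
        by (intro integrable_mult_right integrable_indicator_cball)
      fix x :: "real^'n"
      show "\<bar>?b x\<bar> \<le> (C * (m * L * 2 * (32 + 2 * m) + 2 * m * L * 4) * \<epsilon> powr (- b - 1)) * indicator (cball 0 (2 * \<epsilon>)) x"
      proof (cases "norm x < \<epsilon> \<or> norm x > 2 * \<epsilon>")
        case True
        have b0: "?b x = 0" by (simp add: cutoff_derivative_bounds(3)[OF \<epsilon>(1) True])
        show ?thesis unfolding b0 abs_zero
          using r0 m2 L0 by (intro mult_nonneg_nonneg add_nonneg_nonneg) auto
      next
        case False
        then have x: "\<epsilon> \<le> norm x" "norm x \<le> 2 * \<epsilon>" by auto
        then have x0: "x \<noteq> 0" "norm x < r0" "norm x \<le> R" using \<epsilon> r by auto
        have "norm x powr (- b) \<le> \<epsilon> powr (- b)" using x \<epsilon> b by (intro powr_mono2') auto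
        then have "u x \<le> C * \<epsilon> powr (- b)" using up[OF x0(1,2)] r0(2) by (meson mult_left_mono less_imp_le order_trans)
        moreover have "u x \<ge> 1" using nb x0 by auto
        ultimately have u: "\<bar>u x\<bar> \<le> C * \<epsilon> powr (- b)" by simp
        have "\<bar>\<zeta> x\<bar> \<le> m * L * (2 * \<epsilon>)" using lip[of x] x m2 L0 by (meson mult_left_mono mult_nonneg_nonneg order_trans zero_le_numeral)
        then have 1: "\<bar>\<zeta> x * laplacian (cutoff \<epsilon>) x\<bar> \<le> m * L * (2 * \<epsilon>) * ((32 + 2 * m) / \<epsilon>\<^sup>2)"
          unfolding abs_mult using cutoff_derivative_bounds(1)[OF \<epsilon>(1), of x] m2 L0 \<epsilon> by (intro mult_mono) (auto simp: m_eq)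
        have "\<bar>\<Sum>i\<in>UNIV. partial i \<zeta> x * partial i (cutoff \<epsilon>) x\<bar> \<le> (\<Sum>i\<in>UNIV. \<bar>partial i \<zeta> x * partial i (cutoff \<epsilon>) x\<bar>)"
          by (rule sum_abs)
        also have "\<dots> \<le> (\<Sum>i\<in>(UNIV::'n set). L * (4 / \<epsilon>))"
          unfolding abs_mult using L cutoff_derivative_bounds(2)[OF \<epsilon>(1), of _ x] L0 by (intro sum_mono mult_mono) auto
        also have "\<dots> = m * (L * (4 / \<epsilon>))" by (simp add: m_eq)
        finally have 2: "\<bar>2 * (\<Sum>i\<in>UNIV. partial i \<zeta> x * partial i (cutoff \<epsilon>) x)\<bar> \<le> 2 * (m * (L * (4 / \<epsilon>)))" by simp
        have "\<bar>\<zeta> x * laplacian (cutoff \<epsilon>) x + 2 * (\<Sum>i\<in>UNIV. partial i \<zeta> x * partial i (cutoff \<epsilon>) x)\<bar>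
            \<le> m * L * (2 * \<epsilon>) * ((32 + 2 * m) / \<epsilon>\<^sup>2) + 2 * (m * (L * (4 / \<epsilon>)))"
          using abs_triangle_ineq 1 2 by (meson add_mono order_trans)
        also have "\<dots> = (m * L * 2 * (32 + 2 * m) + 2 * m * L * 4) * \<epsilon> powr (- 1)"
          using \<epsilon> by (simp add: powr_minus_divide power2_eq_square field_simps)
        finally have "\<bar>?b x\<bar> \<le> (C * \<epsilon> powr (- b)) * ((m * L * 2 * (32 + 2 * m) + 2 * m * L * 4) * \<epsilon> powr (- 1))"
          unfolding abs_mult abs_minus_cancel using u r0 by (intro mult_mono) auto
        also have "\<dots> = C * (m * L * 2 * (32 + 2 * m) + 2 * m * L * 4) * (\<epsilon> powr (- b) * \<epsilon> powr (- 1))" by (simp only: mult_ac)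
        also have "\<epsilon> powr (- b) * \<epsilon> powr (- 1) = \<epsilon> powr (- b - 1)" by (simp only: powr_add[symmetric]) simp
        finally show ?thesis using x by simp
      qed
    qed
    also have "\<dots> = C * (m * L * 2 * (32 + 2 * m) + 2 * m * L * 4) * \<epsilon> powr (- b - 1) * (om * (2 * \<epsilon>) powr m)"
    proof -
      have "measure lborel (cball (0::real^'n) (2 * \<epsilon>)) = om * (2 * \<epsilon>) ^ CARD('n)"
        using content_cball[of "2 * \<epsilon>" "0::real^'n"] \<epsilon> by (simp add: m_eq)
      also have "(2 * \<epsilon>) ^ CARD('n) = (2 * \<epsilon>) powr m" using \<epsilon> by (simp add: m_eq powr_realpow)
      finally show ?thesis by simp
    qed
    also have "\<dots> = D * (\<epsilon> powr (- b - 1) * \<epsilon> powr m)" using \<epsilon> by (simp add: D_def powr_mult)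
    also have "\<epsilon> powr (- b - 1) * \<epsilon> powr m = \<epsilon> powr (1/2)" by (simp add: b_def flip: powr_add)
    finally show "\<bar>weak \<zeta> - (\<integral>x. ?a \<epsilon> x \<partial>lborel)\<bar> \<le> D * \<epsilon> powr (1/2)" .
  qed
  define e where "e n = r / real (Suc n)" for n
  have e: "0 < e n" "e n \<le> r" for n using r by (auto simp: e_def field_simps)
  have e0: "e \<longlonglongrightarrow> 0" unfolding e_def[abs_def] by real_asymp
  have "(\<lambda>n. D * e n powr (1/2)) \<longlonglongrightarrow> D * 0 powr (1/2)"
    by (intro tendsto_intros tendsto_powr' e0) (auto intro!: always_eventually less_imp_le[OF e(1)])
  then have "(\<lambda>n. D * e n powr (1/2)) \<longlonglongrightarrow> 0" by simp
  then have "(\<lambda>n. weak \<zeta> - (\<integral>x. ?a (e n) x \<partial>lborel)) \<longlonglongrightarrow> 0"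
    by (rule Lim_null_comparison[rotated]) (use est[OF e] in simp)
  moreover have "(\<lambda>n. \<integral>x. ?a (e n) x \<partial>lborel) \<longlonglongrightarrow> (\<integral>x. (0::real) \<partial>(lborel :: (real^'n) measure))"
  proof (rule integral_dominated_convergence)
    show "integrable lborel (\<lambda>x. 4 * \<bar>u x * - laplacian \<zeta> x - src x * \<zeta> x\<bar>)"
      by (intro integrable_mult_right integrable_abs weak_integrable'[OF \<zeta>])
    show "?a (e n) \<in> borel_measurable lborel" for n by (rule borel_measurable_integrable[OF inta[OF e]])
    show "AE x in lborel. norm (?a (e n) x) \<le> 4 * \<bar>u x * - laplacian \<zeta> x - src x * \<zeta> x\<bar>" for n
    proof (rule AE_I2)
      fix x show "norm (?a (e n) x) \<le> 4 * \<bar>u x * - laplacian \<zeta> x - src x * \<zeta> x\<bar>"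
        unfolding real_norm_def abs_mult
        by (rule order_trans[OF mult_left_mono[OF cutoff_eq(3)[OF e(1)] abs_ge_zero]]) simp
    qed
    show "AE x in lborel. (\<lambda>n. ?a (e n) x) \<longlonglongrightarrow> 0"
      using AE_lborel_singleton[of "0::real^'n"]
    proof eventually_elim
      case (elim x)
      then have "\<forall>\<^sub>F n in sequentially. e n < norm x / 2" by (intro order_tendstoD(2)[OF e0]) simp
      then have "\<forall>\<^sub>F n in sequentially. ?a (e n) x = 0"
      proof eventually_elim
        case (elim n)
        then show ?case using cutoff_eq(2)[OF e(1), of n x] by simp
      qed
      then show ?case by (rule tendsto_eventually)
    qed
  qed simp
  ultimately have "(\<lambda>n. (weak \<zeta> - (\<integral>x. ?a (e n) x \<partial>lborel)) + (\<integral>x. ?a (e n) x \<partial>lborel)) \<longlonglongrightarrow> 0 + 0"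
    by (intro tendsto_add) auto
  then show ?thesis by (simp add: LIMSEQ_const_iff)
qed

text \<open>Subtracting \<open>\<xi> 0\<close> times one fixed cutoff leaves a function vanishing at
  0, which the defect annihilates. Thus \<open>k\<close> is the defect of that cutoff.\<close>

lemma weak_dirac:
  obtains k where "\<And>\<xi>. C2c \<xi> \<Longrightarrow> weak \<xi> = k * \<xi> 0"
proof
  fix \<xi> :: "real^'n \<Rightarrow> real" assume \<xi>: "C2c \<xi>"
  have one: "C2c (cutoff 1 :: real^'n \<Rightarrow> real)"
    unfolding C2c_def using cutoff_C2(1)[of 1, where 'n='n] cutoff_eq(2)[of 1, where x="_ :: real^'n"]
    by (auto intro!: exI[of _ "cball 0 2"])
  have c: "C2c (\<lambda>x::real^'n. \<xi> 0 * cutoff 1 x)" using one by (rule C2c_cmult)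
  have "weak (\<lambda>x. \<xi> x - \<xi> 0 * cutoff 1 x) = 0"
    by (rule weak_eq_0[OF C2c_diff[OF \<xi> c]]) (simp add: cutoff_eq)
  then show "weak \<xi> = weak (cutoff 1) * \<xi> 0"
    using weak_diff[OF \<xi> c] weak_cmult[OF one, of "\<xi> 0"] by simp
qed

end

section \<open>The limit of u / h at the origin\<close>

lemma fsol_ge_powr:
  assumes "m \<ge> 2"
  obtains c r where "0 < c" "0 < r" "\<And>s. 0 < s \<Longrightarrow> s < r \<Longrightarrow> c * s powr (1 - m/2) \<le> fsol m s"
proof (cases "m = 2")
  case True
  have "\<forall>\<^sub>F s in at_right 0. - ln s / 2 \<ge> (1::real)" by real_asymp
  then obtain r where r: "r > 0" "\<And>s. 0 < s \<Longrightarrow> s < r \<Longrightarrow> - ln s / 2 \<ge> (1::real)"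
    unfolding eventually_at_right_field by auto
  show ?thesis by (rule that[of 1 r]) (use r True in \<open>auto simp: fsol_def\<close>)
next
  case False
  then show ?thesis using assms by (intro that[of "1 / (m - 2)" 1]) (auto simp: fsol_def)
qed

text \<open>Regularising at radius |x|/2 replaces \<open>s = |x|^2\<close> by \<open>s/4\<close>.
  The additional term is bounded for \<open>m = 2\<close> and of the order of \<open>fsol\<close>
  itself otherwise, so near 0 it can be absorbed into \<open>h\<close>.\<close>

lemma fsol_quarter_le:
  assumes "m \<ge> 0" "s > 0"
  shows "fsol m (s/4) \<le> fsol m s + 4 powr (m/2) * s powr (1 - m/2)"
proof -
  have "\<exists>z>s/4. z < s \<and> fsol m s - fsol m (s/4) = (s - s/4) * (- (1/2) * z powr (- m/2))"
    by (rule MVT2) (use assms in \<open>auto intro!: DERIV_fsol[THEN DERIV_cong]\<close>)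
  then obtain z where z: "z > s/4" and e: "fsol m s - fsol m (s/4) = (s - s/4) * (- (1/2) * z powr (- m/2))" by blast
  have "z powr (- m/2) \<le> (s/4) powr (- m/2)" using z assms by (intro powr_mono2') auto
  then have "(3/8) * s * z powr (- m/2) \<le> (3/8) * s * (s/4) powr (- m/2)" using assms by (intro mult_left_mono) auto
  also have "\<dots> \<le> s * (s/4) powr (- m/2)" using assms by (intro mult_right_mono) auto
  also have "\<dots> = 4 powr (m/2) * (s powr 1 * s powr (- m/2))" using assms by (simp add: powr_divide powr_minus field_simps)
  also have "s powr 1 * s powr (- m/2) = s powr (1 - m/2)" by (simp only: powr_add[symmetric]) simp
  finally show ?thesis using e by (simp add: algebra_simps)
qed

lemma second_derivative_at_local_max:
  fixes f f' :: "real \<Rightarrow> real"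
  assumes d: "d > 0" and f: "\<And>t. \<bar>t\<bar> < d \<Longrightarrow> (f has_real_derivative f' t) (at t)"
    and f': "(f' has_real_derivative c) (at 0)" and mx: "\<And>t. \<bar>t\<bar> < d \<Longrightarrow> f t \<le> f 0"
  shows "c \<le> 0"
proof (rule ccontr)
  assume "\<not> c \<le> 0"
  then have "c > 0" by simp
  have "f' 0 = 0" by (rule DERIV_local_max[OF f d]) (use d mx in auto)
  obtain e where e: "e > 0" "\<And>h. 0 < h \<Longrightarrow> h < e \<Longrightarrow> f' 0 < f' (0 + h)"
    using DERIV_pos_inc_right[OF f' \<open>c > 0\<close>] by blast
  define h where "h = min d e / 2"
  have h: "0 < h" "h < d" "h < e" using d e by (auto simp: h_def)
  have "\<exists>z>0. z < h \<and> f h - f 0 = (h - 0) * f' z"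
    by (rule MVT2) (use h f in auto)
  then obtain z where z: "0 < z" "z < h" "f h - f 0 = h * f' z" by auto
  have "f' z > 0" using e(2)[of z] z h \<open>f' 0 = 0\<close> by simp
  then have "f h > f 0" using z h by (simp add: algebra_simps)
  then show False using mx[of h] h by simp
qed

lemma laplacian_at_local_max:
  fixes g :: "real^'n::finite \<Rightarrow> real"
  assumes "open S" "x \<in> S" "C2_on S g" "\<And>y. y \<in> S \<Longrightarrow> g y \<le> g x"
  shows "laplacian g x \<le> 0"
  unfolding laplacian_def
proof (rule sum_nonpos)
  fix i :: 'n
  obtain d where d: "d > 0" "ball x d \<subseteq> S" using assms(1,2) openE by blast
  have S: "x + t *\<^sub>R axis i 1 \<in> S" if "\<bar>t\<bar> < d" for t
    using d(2) that by (auto simp: dist_norm)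
  show "partial i (partial i g) x \<le> 0"
  proof (rule second_derivative_at_local_max[OF d(1), of "\<lambda>t. g (x + t *\<^sub>R axis i 1)" "\<lambda>t. partial i g (x + t *\<^sub>R axis i 1)"])
    show "((\<lambda>t. g (x + t *\<^sub>R axis i 1)) has_real_derivative partial i g (x + t *\<^sub>R axis i 1)) (at t)" if "\<bar>t\<bar> < d" for t
      by (rule has_pd_shift[OF C2_onD(4)[OF assms(3) S[OF that]]])
    show "((\<lambda>t. partial i g (x + t *\<^sub>R axis i 1)) has_real_derivative partial i (partial i g) x) (at 0)"
      using C2_onD(5)[OF assms(3,2)] unfolding has_pd_def .
    show "g (x + t *\<^sub>R axis i 1) \<le> g (x + 0 *\<^sub>R axis i 1)" if "\<bar>t\<bar> < d" for t
      using assms(4)[OF S[OF that]] by simp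
  qed
qed

lemma norm_powr_C2:
  shows "C2_on (- {0}) (\<lambda>x::real^'n::finite. ((norm x)\<^sup>2) powr e)"
    and "\<And>x::real^'n. x \<noteq> 0 \<Longrightarrow> laplacian (\<lambda>x. ((norm x)\<^sup>2) powr e) x = e * (4 * e - 4 + 2 * real CARD('n)) * ((norm x)\<^sup>2) powr (e - 1)"
proof -
  have pos: "(norm (x - 0))\<^sup>2 > 0" if "x \<in> - {0}" for x :: "real^'n" using that by simp
  have d1: "((\<lambda>s. s powr e) has_real_derivative e * s powr (e - 1)) (at s)" if "s > 0" for s
    by (rule has_real_derivative_powr[OF that])
  have d2: "((\<lambda>s. e * s powr (e - 1)) has_real_derivative e * ((e - 1) * s powr (e - 1 - 1))) (at s)" if "s > 0" for s
    by (rule DERIV_cmult[OF has_real_derivative_powr[OF that]])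
  have c: "continuous_on (- {0}) (\<lambda>x::real^'n. e * ((e - 1) * ((norm (x - 0))\<^sup>2) powr (e - 1 - 1)))"
    by (intro continuous_intros) auto
  note R = radial_C2[where S="- {0::real^'n}" and F="\<lambda>s. s powr e" and c=0, OF open_Compl[OF closed_singleton] d1[OF pos] d2[OF pos] c]
  show "C2_on (- {0}) (\<lambda>x::real^'n. ((norm x)\<^sup>2) powr e)" using R(1) by simp
  fix x :: "real^'n" assume x: "x \<noteq> 0"
  define s where "s = (norm x)\<^sup>2"
  have "s > 0" using x by (simp add: s_def)
  then have "s * s powr (e - 1 - 1) = s powr 1 * s powr (e - 1 - 1)" by simp
  also have "\<dots> = s powr (e - 1)" by (simp only: powr_add[symmetric]) simp
  finally have p: "s * s powr (e - 1 - 1) = s powr (e - 1)" .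
  have "laplacian (\<lambda>x. ((norm x)\<^sup>2) powr e) x = 4 * s * (e * ((e - 1) * s powr (e - 1 - 1))) + 2 * real CARD('n) * (e * s powr (e - 1))"
    using R(2)[of x] x by (simp add: s_def)
  also have "\<dots> = 4 * e * (e - 1) * (s * s powr (e - 1 - 1)) + 2 * real CARD('n) * (e * s powr (e - 1))" by simp
  also have "\<dots> = e * (4 * e - 4 + 2 * real CARD('n)) * s powr (e - 1)" unfolding p by (simp add: algebra_simps)
  finally show "laplacian (\<lambda>x. ((norm x)\<^sup>2) powr e) x = e * (4 * e - 4 + 2 * real CARD('n)) * ((norm x)\<^sup>2) powr (e - 1)"
    by (simp add: s_def)
qed

context singular_solution begin

lemma h_inverse_tendsto: "((\<lambda>x. c / h x) \<longlongrightarrow> 0) (at 0)"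
  by (rule tendsto_divide_0[OF tendsto_const filterlim_at_top_imp_at_infinity[OF h_at_top]])

text \<open>One bound in two forms: as a potential times \<open>u\<close> it feeds the comparison
  argument, as a pure power of |x| it controls the mean value error.\<close>

lemma src_le_powr:
  assumes b: "b > m - 2"
  obtains r C where "0 < r" "0 < C" "r \<le> 1"
    "\<And>x. x \<noteq> 0 \<Longrightarrow> norm x < r \<Longrightarrow> 1 \<le> u x \<and> 0 \<le> src x \<and> src x \<le> C * norm x powr (- b * (p - 1)) * u x \<and> src x \<le> C * norm x powr (- b * p)"
proof -
  obtain R q C1 where R: "0 < R" "R \<le> 1" "0 < q" "0 < C1" and nb: "\<And>x. x \<noteq> 0 \<Longrightarrow> norm x \<le> R \<Longrightarrow>
      1 \<le> u x \<and> u x \<le> src x \<and> q * u x powr p \<le> src x \<and> src x \<le> C1 * u x powr p"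
    by (rule near_origin) blast
  obtain r0 C0 where r0: "0 < r0" "0 < C0" and up: "\<And>x. x \<noteq> 0 \<Longrightarrow> norm x < r0 \<Longrightarrow> u x \<le> C0 * norm x powr (- b)"
    by (rule u_le_powr[OF b]) blast
  define C where "C = max (C1 * C0 powr p) (C1 * C0 powr (p - 1))"
  have P: "u x powr t \<le> C0 powr t * norm x powr (- b * t)" if "x \<noteq> 0" "norm x < min r0 R" "t \<ge> 0" for x t
  proof -
    have "u x powr t \<le> (C0 * norm x powr (- b)) powr t"
      using up[of x] nb[of x] that by (intro powr_mono2) auto
    also have "\<dots> = C0 powr t * norm x powr (- b * t)" using r0 by (simp add: powr_mult powr_powr)
    finally show ?thesis .
  qed
  have "1 \<le> u x \<and> 0 \<le> src x \<and> src x \<le> C * norm x powr (- b * (p - 1)) * u x \<and> src x \<le> C * norm x powr (- b * p)"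
    if x: "x \<noteq> 0" "norm x < min r0 R" for x
  proof -
    have n: "1 \<le> u x" "u x \<le> src x" "src x \<le> C1 * u x powr p" using nb[of x] x by auto
    have "C1 * u x powr p \<le> C1 * (C0 powr p * norm x powr (- b * p))" using P[OF x, of p] p1 R by (intro mult_left_mono) auto
    also have "\<dots> = C1 * C0 powr p * norm x powr (- b * p)" by (simp only: mult.assoc)
    also have "\<dots> \<le> C * norm x powr (- b * p)" by (intro mult_right_mono) (auto simp: C_def)
    finally have a: "src x \<le> C * norm x powr (- b * p)" using n by simp
    have "u x powr p = u x powr (p - 1) * u x" using n by (simp add: powr_diff)
    then have "C1 * u x powr p = C1 * (u x powr (p - 1) * u x)" by simp
    also have "\<dots> \<le> C1 * ((C0 powr (p - 1) * norm x powr (- b * (p - 1))) * u x)"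
      using P[OF x, of "p - 1"] p1 R n by (intro mult_left_mono mult_right_mono) auto
    also have "\<dots> = C1 * C0 powr (p - 1) * norm x powr (- b * (p - 1)) * u x" by (simp only: mult.assoc)
    also have "\<dots> \<le> C * norm x powr (- b * (p - 1)) * u x" using n by (intro mult_right_mono) (auto simp: C_def)
    finally show ?thesis using a n by simp
  qed
  moreover have "C > 0" using R r0 by (simp add: C_def less_max_iff_disj)
  ultimately show ?thesis using R r0 by (intro that[of "min r0 R" C]) auto
qed

text \<open>Because \<rho> is only half of |x|, the origin lies outside the regularised ball and the
  first part of \<phi> has the exact value \<open>h x\<close> there. Because \<rho> is comparable to
  |x|, the maximum of \<phi> is still of the order of \<open>h x\<close>, which is what makes the
  \<open>src\<close> term tractable.\<close>

lemma representation:
  assumes k: "\<And>\<xi>. C2c \<xi> \<Longrightarrow> weak \<xi> = k * \<xi> 0" and x: "x \<noteq> 0" "norm x < 1"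
  defines "\<rho> \<equiv> norm x / 2"
  defines "\<phi> \<equiv> (\<lambda>y. gam m (\<rho>\<^sup>2) ((norm (y - x))\<^sup>2) - gam m 1 ((norm (y - x))\<^sup>2))"
  shows "(\<integral>y. u y * eta m (\<rho>\<^sup>2) ((norm (y - x))\<^sup>2) \<partial>lborel) =
     k * (h x - gam m 1 ((norm x)\<^sup>2)) + (\<integral>y. u y * eta m 1 ((norm (y - x))\<^sup>2) \<partial>lborel) + (\<integral>y. src y * \<phi> y \<partial>lborel)"
proof -
  have \<rho>: "0 < \<rho>" "\<rho> \<le> 1" using x by (auto simp: \<rho>_def)
  note P = gam_diff_C2[OF \<rho>, where x=x, folded m_eq, unfolded power_one]
  have C: "C2c \<phi>" unfolding C2c_def \<phi>_def using P(1) P(4) by (intro conjI exI[of _ "cball x 1"]) auto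
  have le: "\<rho>\<^sup>2 \<le> (norm x)\<^sup>2" using x by (intro power_mono) (auto simp: \<rho>_def)
  have "weak \<phi> = k * (h x - gam m 1 ((norm x)\<^sup>2))"
    using k[OF C] le by (simp add: \<phi>_def gam_def)
  moreover have l: "u y * - laplacian \<phi> y = u y * eta m (\<rho>\<^sup>2) ((norm (y - x))\<^sup>2) - u y * eta m 1 ((norm (y - x))\<^sup>2)" for y
    unfolding \<phi>_def P(2) by (simp add: algebra_simps)
  have i: "integrable lborel (\<lambda>y. u y * eta m (r\<^sup>2) ((norm (y - x))\<^sup>2))" if "r \<ge> 0" for r
    using eta_outside[OF that, of _ x m]
    by (intro integrable_locally_integrable_mult[OF locally_integrable_u measurable_u continuous_eta compact_cball]) auto
  have "weak \<phi> = (\<integral>y. u y * eta m (\<rho>\<^sup>2) ((norm (y - x))\<^sup>2) \<partial>lborel) - (\<integral>y. u y * eta m 1 ((norm (y - x))\<^sup>2) \<partial>lborel) - (\<integral>y. src y * \<phi> y \<partial>lborel)"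
    unfolding weak_def Bochner_Integration.integral_diff[OF weak_integrable[OF C]]
    unfolding l using i[of \<rho>] i[of 1] \<rho> by simp
  ultimately show ?thesis by simp
qed

text \<open>Divide the representation by \<open>h x\<close>: the average on the left is close to
  \<open>m * om * u x\<close>, the average at radius 1 and the regularised term stay bounded, and
  the \<open>src\<close> term is o(\<open>h x\<close>).\<close>

lemma asymptotics:
  assumes k: "\<And>\<xi>. C2c \<xi> \<Longrightarrow> weak \<xi> = k * \<xi> 0"
  shows "((\<lambda>x. u x / h x) \<longlongrightarrow> k / (m * om)) (at 0)"
proof -
  have ev: "\<forall>\<^sub>F x in at (0::real^'n). x \<noteq> 0 \<and> norm x < r" if "r > 0" for r
    using that by (auto simp: eventually_at intro!: exI[of _ r])
  have hev: "\<forall>\<^sub>F x in at 0. h x \<ge> 1" using h_at_top by (simp add: filterlim_at_top)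
  define \<phi> where "\<phi> x y = gam m ((norm x / 2)\<^sup>2) ((norm (y - x))\<^sup>2) - gam m 1 ((norm (y - x))\<^sup>2)" for x y :: "real^'n"
  let ?I1 = "\<lambda>x. \<integral>y. u y * eta m ((norm x / 2)\<^sup>2) ((norm (y - x))\<^sup>2) \<partial>lborel"
  let ?I2 = "\<lambda>x. \<integral>y. u y * eta m 1 ((norm (y - x))\<^sup>2) \<partial>lborel"
  let ?I3 = "\<lambda>x. \<integral>y. src y * \<phi> x y \<partial>lborel"
  obtain c rc where c: "0 < c" "0 < rc" and hc: "\<And>s. 0 < s \<Longrightarrow> s < rc \<Longrightarrow> c * s powr (1 - m/2) \<le> fsol m s"
    by (rule fsol_ge_powr[OF m2]) blast
  have hlow: "c * norm x powr (2 - m) \<le> h x" if "x \<noteq> 0" "norm x < sqrt rc" for x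
  proof -
    have "(norm x)\<^sup>2 < (sqrt rc)\<^sup>2" using that by (intro power_strict_mono) auto
    then have "c * ((norm x)\<^sup>2) powr (1 - m/2) \<le> h x" using that c by (intro hc) auto
    moreover have "((norm x)\<^sup>2) powr (1 - m/2) = norm x powr (2 - m)"
    proof -
      have "2 * (1 - m/2) = 2 - m" by simp
      then show ?thesis using that by (simp add: powr_powr flip: powr_numeral)
    qed
    ultimately show ?thesis by simp
  qed
  have A: "((\<lambda>x. (m * om * u x - ?I1 x) / h x) \<longlongrightarrow> 0) (at 0)"
  proof -
    \<comment> \<open>The midpoint of \<open>m - 2\<close> and \<open>m / p\<close>, an interval
      that is nonempty by subcriticality. The condition \<open>b * p < m\<close> makes the mean
      value error, of order |x|^(2 - b p), negligible against \<open>h x\<close>, which is at least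
      a multiple of |x|^(2-m).\<close>
    define b where "b = ((m - 2) + m / p) / 2"
    have mp: "m - 2 < m / p"
    proof (cases "CARD('n) \<ge> 3")
      case True
      then have "m - 2 > 0" "p < m / (m - 2)" using pcrit by (auto simp: m_eq)
      then show ?thesis using p1 by (simp add: field_simps)
    next
      case False
      then have "m = 2" using N2 by (simp add: m_eq)
      then show ?thesis using p1 by simp
    qed
    have b: "b > m - 2" using mp by (simp add: b_def)
    have "2 * b < m / p + m / p" using mp by (simp add: b_def)
    then have "b < m / p" by linarith
    then have bp: "m - b * p > 0" using p1 by (simp add: field_simps)
    obtain r C where r: "0 < r" "0 < C" "r \<le> 1"
      and sr: "\<And>x. x \<noteq> 0 \<Longrightarrow> norm x < r \<Longrightarrow> 1 \<le> u x \<and> 0 \<le> src x \<and> src x \<le> C * norm x powr (- b * (p - 1)) * u x \<and> src x \<le> C * norm x powr (- b * p)"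
      by (rule src_le_powr[OF b]) blast
    define D where "D = C * 2 powr (b * p) * om / c"
    have "norm ((m * om * u x - ?I1 x) / h x) \<le> D * norm x powr (m - b * p)"
      if x: "x \<noteq> 0" "norm x < min (r/2) (sqrt rc)" "h x \<ge> 1" for x
    proof -
      have nx: "norm x > 0" using x by simp
      have y: "y \<noteq> 0 \<and> \<bar>src y\<bar> \<le> C * (norm x / 2) powr (- b * p)" if "y \<in> cball x (norm x / 2)" for y
      proof -
        have "norm (x - y) \<le> norm x / 2" using that by (simp add: dist_norm)
        then have "norm y \<ge> norm x / 2" "norm y \<le> 3/2 * norm x"
          using norm_triangle_ineq2[of x y] norm_triangle_ineq2[of y x] by (auto simp: norm_minus_commute)
        then have y: "y \<noteq> 0" "norm y < r" and le: "norm x / 2 \<le> norm y" using x by auto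
        have "- b * p \<le> 0" using b m2 p1 by simp
        then have "norm y powr (- b * p) \<le> (norm x / 2) powr (- b * p)" using le nx by (intro powr_mono2') auto
        then have "C * norm y powr (- b * p) \<le> C * (norm x / 2) powr (- b * p)" using r by (intro mult_left_mono) auto
        then show ?thesis using sr[OF y] y by auto
      qed
      have "\<bar>m * om * u x - ?I1 x\<bar> \<le> C * (norm x / 2) powr (- b * p) * (norm x / 2)\<^sup>2 * om / 2"
        using nx y by (intro mean_value_u) auto
      also have "\<dots> \<le> C * (norm x / 2) powr (- b * p) * (norm x)\<^sup>2 * om"
        using r om_pos by (simp add: power_divide field_simps)
      also have "(norm x / 2) powr (- b * p) = 2 powr (b * p) * norm x powr (- b * p)"
        using nx by (simp add: powr_divide powr_minus field_simps)
      also have "C * (2 powr (b * p) * norm x powr (- b * p)) * (norm x)\<^sup>2 * om = C * 2 powr (b * p) * om * (norm x powr (- b * p) * norm x powr 2)"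
        using nx by simp
      also have "norm x powr (- b * p) * norm x powr 2 = norm x powr (m - b * p) * norm x powr (2 - m)"
        by (simp only: powr_add[symmetric]) simp
      also have "C * 2 powr (b * p) * om * (norm x powr (m - b * p) * norm x powr (2 - m)) = D * norm x powr (m - b * p) * (c * norm x powr (2 - m))"
        using c by (simp add: D_def)
      also have "\<dots> \<le> D * norm x powr (m - b * p) * h x"
        using hlow[of x] x r c om_pos by (intro mult_left_mono) (auto simp: D_def)
      finally show ?thesis using x(3) by (simp add: abs_divide divide_le_eq)
    qed
    then have "\<forall>\<^sub>F x in at 0. norm ((m * om * u x - ?I1 x) / h x) \<le> D * norm x powr (m - b * p)"
      using ev[of "min (r/2) (sqrt rc)"] hev r c by (auto elim: eventually_elim2)
    moreover have "((\<lambda>x::real^'n. D * norm x powr (m - b * p)) \<longlongrightarrow> D * (norm (0::real^'n)) powr (m - b * p)) (at 0)"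
      using bp by (intro tendsto_intros tendsto_powr') auto
    then have "((\<lambda>x::real^'n. D * norm x powr (m - b * p)) \<longlongrightarrow> 0) (at 0)" by simp
    ultimately show ?thesis by (rule Lim_null_comparison)
  qed
  have B: "((\<lambda>x. ?I2 x / h x) \<longlongrightarrow> 0) (at 0)"
  proof -
    define M where "M = m * (m + 2) / 2 * (\<integral>y. indicator (cball 0 2) y * \<bar>u y\<bar> \<partial>lborel)"
    have iu: "integrable lborel (\<lambda>y. indicator (cball 0 2) y * \<bar>u y\<bar>)"
    proof -
      have "integrable lborel (\<lambda>y. indicator (cball 0 2) y * u y)"
        using locally_integrable_u unfolding locally_integrable_def set_integrable_def by simp
      from integrable_abs[OF this] show ?thesis by (simp add: abs_mult)
    qed
    have "norm (?I2 x / h x) \<le> M / h x" if x: "norm x < 1" "h x \<ge> 1" for x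
    proof -
      have "\<bar>?I2 x\<bar> \<le> (\<integral>y. \<bar>u y * eta m 1 ((norm (y - x))\<^sup>2)\<bar> \<partial>lborel)" by (rule integral_abs_bound)
      also have "\<dots> \<le> (\<integral>y. m * (m + 2) / 2 * (indicator (cball 0 2) y * \<bar>u y\<bar>) \<partial>lborel)"
      proof (rule integral_mono)
        have "integrable lborel (\<lambda>y. u y * eta m (1\<^sup>2) ((norm (y - x))\<^sup>2))"
          using eta_outside[of 1 _ x m]
          by (intro integrable_locally_integrable_mult[OF locally_integrable_u measurable_u continuous_eta compact_cball]) auto
        then show "integrable lborel (\<lambda>y. \<bar>u y * eta m 1 ((norm (y - x))\<^sup>2)\<bar>)" by simp
        show "integrable lborel (\<lambda>y. m * (m + 2) / 2 * (indicator (cball 0 2) y * \<bar>u y\<bar>))"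
          by (intro integrable_mult_right iu)
        fix y show "\<bar>u y * eta m 1 ((norm (y - x))\<^sup>2)\<bar> \<le> m * (m + 2) / 2 * (indicator (cball 0 2) y * \<bar>u y\<bar>)"
        proof (cases "y \<in> cball x 1")
          case True
          then have "norm y \<le> 2" using x norm_triangle_ineq2[of y x] by (simp add: dist_norm norm_minus_commute)
          moreover have "\<bar>eta m 1 ((norm (y - x))\<^sup>2)\<bar> \<le> m * (m + 2) / 2"
            using eta_le[of m 1 "(norm (y - x))\<^sup>2"] eta_nonneg[of m 1 "(norm (y - x))\<^sup>2"] m2 by simp
          then have "\<bar>u y\<bar> * \<bar>eta m 1 ((norm (y - x))\<^sup>2)\<bar> \<le> \<bar>u y\<bar> * (m * (m + 2) / 2)" by (intro mult_left_mono) auto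
          ultimately show ?thesis by (simp add: abs_mult mult.commute)
        next
          case False
          then show ?thesis using eta_outside[of 1 y x m] m2 by simp
        qed
      qed
      also have "\<dots> = M" by (simp add: M_def)
      finally show ?thesis using x(2) by (simp add: abs_divide divide_right_mono)
    qed
    then have "\<forall>\<^sub>F x in at 0. norm (?I2 x / h x) \<le> M / h x"
      using ev[of 1] hev by (auto elim: eventually_elim2)
    then show ?thesis by (rule Lim_null_comparison[OF _ h_inverse_tendsto])
  qed
  have G: "((\<lambda>x. gam m 1 ((norm x)\<^sup>2) / h x) \<longlongrightarrow> 0) (at 0)"
  proof -
    have "norm (gam m 1 ((norm x)\<^sup>2) / h x) \<le> (fsol m 1 + (1/2 + m/8)) / h x" if "norm x < 1" "h x \<ge> 1" for x
      using gam_bounds[OF m2, of 1 "(norm x)\<^sup>2"] that by (auto simp: abs_divide power_le_one intro!: divide_right_mono)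
    then have "\<forall>\<^sub>F x in at 0. norm (gam m 1 ((norm x)\<^sup>2) / h x) \<le> (fsol m 1 + (1/2 + m/8)) / h x"
      using ev[of 1] hev by (auto elim: eventually_elim2)
    then show ?thesis by (rule Lim_null_comparison[OF _ h_inverse_tendsto])
  qed
  \<comment> \<open>Bounds \<phi> by its regularised value at the centre: 1 stands for
    \<open>h x\<close>, and the two constants divided by \<open>c\<close> stand for the power terms
    of \<open>fsol_quarter_le\<close> and \<open>gam_bounds\<close> after they are absorbed into
    \<open>h x\<close>.\<close>
  define Cg where "Cg = 1 + (4 powr (m/2) + (1/2 + m/8) * 4 powr (m/2 - 1)) / c"
  have Cg: "Cg \<ge> 0" using m2 c by (simp add: Cg_def)
  have \<phi>0: "\<phi> x y = 0" if "x \<noteq> 0" "norm x < 1" "y \<notin> cball x 1" for x y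
    using gam_diff_C2(4)[of "norm x / 2" 1 y x] that by (simp add: \<phi>_def m_eq)
  have \<phi>nn: "0 \<le> \<phi> x y" if "x \<noteq> 0" "norm x < 1" for x y
    using gam_diff_C2(3)[of "norm x / 2" 1 y x] that by (simp add: \<phi>_def m_eq)
  have \<phi>le: "\<phi> x y \<le> Cg * h x" if x: "x \<noteq> 0" "norm x < 1" "norm x < sqrt rc" "h x \<ge> 1" for x y
  proof (cases "y \<in> cball x 1")
    case True
    define s where "s = (norm x)\<^sup>2"
    have s: "s > 0" "s \<le> 1" using x by (auto simp: s_def power_le_one)
    have s4: "(norm x / 2)\<^sup>2 = s / 4" by (simp add: s_def power_divide)
    have d: "(norm (y - x))\<^sup>2 \<le> 1" using True by (auto simp: dist_norm norm_minus_commute power_le_one)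
    have "\<phi> x y \<le> gam m (s/4) ((norm (y - x))\<^sup>2)"
      unfolding \<phi>_def s4 using gam_bounds(1)[OF m2, of 1 "(norm (y - x))\<^sup>2"] d by simp
    also have "\<dots> \<le> fsol m (s/4) + (1/2 + m/8) * (s/4) powr (1 - m/2)"
      using gam_bounds(2)[OF m2, of "s/4" "(norm (y - x))\<^sup>2"] s d by simp
    also have "\<dots> \<le> fsol m s + 4 powr (m/2) * s powr (1 - m/2) + (1/2 + m/8) * (4 powr (m/2 - 1) * s powr (1 - m/2))"
    proof -
      have "4 powr (m/2 - 1) * s powr (1 - m/2) = (s/4) powr (1 - m/2)"
        using s by (simp add: powr_divide powr_diff)
      then show ?thesis using fsol_quarter_le[of m s] m2 s by simp
    qed
    also have "\<dots> = h x + (4 powr (m/2) + (1/2 + m/8) * 4 powr (m/2 - 1)) / c * (c * s powr (1 - m/2))"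
      using c by (simp add: s_def field_simps)
    also have "\<dots> \<le> h x + (4 powr (m/2) + (1/2 + m/8) * 4 powr (m/2 - 1)) / c * h x"
    proof (intro add_left_mono mult_left_mono)
      have "(norm x)\<^sup>2 < (sqrt rc)\<^sup>2" using x by (intro power_strict_mono) auto
      then show "c * s powr (1 - m/2) \<le> h x" using hc[of s] s c by (simp add: s_def)
    qed (use c m2 in auto)
    also have "\<dots> = Cg * h x" by (simp add: Cg_def algebra_simps)
    finally show ?thesis .
  next
    case False
    then show ?thesis using \<phi>0[OF x(1,2) False] Cg x(4) by simp
  qed
  \<comment> \<open>For a fixed \<open>y\<close> other than 0, \<open>\<phi> x y\<close> stays
    bounded as x tends to 0 while \<open>h x\<close> tends to infinity, so the quotient tends to 0;
    it is dominated by \<open>Cg\<close>, uniformly in \<open>x\<close> and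
    \<open>y\<close>.\<close>
  have I3: "((\<lambda>x. ?I3 x / h x) \<longlongrightarrow> 0) (at 0)"
    unfolding tendsto_at_iff_sequentially comp_def
  proof (intro allI impI)
    fix X :: "nat \<Rightarrow> real^'n" assume X0: "\<forall>i. X i \<in> UNIV - {0}" and Xl: "X \<longlonglongrightarrow> 0"
    then have Xat: "filterlim X (at 0) sequentially" by (simp add: filterlim_at)
    define r where "r = min 1 (sqrt rc)"
    have good: "\<forall>\<^sub>F x in at 0. x \<noteq> 0 \<and> norm x < 1 \<and> norm x < sqrt rc \<and> h x \<ge> 1"
      using ev[of r] hev c by (auto simp: r_def elim: eventually_elim2)
    have goodX: "\<forall>\<^sub>F i in sequentially. X i \<noteq> 0 \<and> norm (X i) < 1 \<and> norm (X i) < sqrt rc \<and> h (X i) \<ge> 1"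
      using Xat good by (rule eventually_compose_filterlim[rotated])
    then obtain i0 where i0: "\<And>i. i \<ge> i0 \<Longrightarrow> X i \<noteq> 0 \<and> norm (X i) < 1 \<and> norm (X i) < sqrt rc \<and> h (X i) \<ge> 1"
      unfolding eventually_sequentially by auto
    \<comment> \<open>The sequence is shifted so that the domination holds for every index and not
      just eventually.\<close>
    let ?Y = "\<lambda>i. X (i + i0)"
    have Y: "?Y i \<noteq> 0" "norm (?Y i) < 1" "norm (?Y i) < sqrt rc" "h (?Y i) \<ge> 1" for i using i0[of "i + i0"] by auto
    have Yat: "filterlim ?Y (at 0) sequentially"
      using Xat by (rule filterlim_compose) (rule filterlim_add_const_nat_at_top)
    have "(\<lambda>i. \<integral>y. src y * \<phi> (?Y i) y / h (?Y i) \<partial>lborel) \<longlonglongrightarrow> (\<integral>y. (0::real) \<partial>(lborel :: (real^'n) measure))"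
    proof (rule integral_dominated_convergence)
      have "integrable lborel (\<lambda>y. indicator (cball 0 2) y * src y)"
        using locally_integrable_src unfolding locally_integrable_def set_integrable_def by simp
      from integrable_abs[OF this]
      have "integrable lborel (\<lambda>y. Cg * (indicator (cball 0 2) y * \<bar>src y\<bar>))" by (intro integrable_mult_right) (simp add: abs_mult)
      then show "integrable lborel (\<lambda>y. Cg * (indicator (cball 0 2) y * \<bar>src y\<bar>))" .
      show "(\<lambda>y. src y * \<phi> (?Y i) y / h (?Y i)) \<in> borel_measurable lborel" for i
      proof -
        have "C2_on UNIV (\<phi> (?Y i))" unfolding \<phi>_def using gam_diff_C2(1)[of "norm (?Y i) / 2" 1 "?Y i"] Y[of i] by (simp add: m_eq)
        then have "\<phi> (?Y i) \<in> borel_measurable borel" by (intro borel_measurable_continuous_onI C2_onD(1))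
        then show ?thesis by simp
      qed
      show "AE y in lborel. norm (src y * \<phi> (?Y i) y / h (?Y i)) \<le> Cg * (indicator (cball 0 2) y * \<bar>src y\<bar>)" for i
      proof (rule AE_I2)
        fix y
        show "norm (src y * \<phi> (?Y i) y / h (?Y i)) \<le> Cg * (indicator (cball 0 2) y * \<bar>src y\<bar>)"
        proof (cases "y \<in> cball (?Y i) 1")
          case True
          then have "norm y \<le> 2" using Y(2)[of i] norm_triangle_ineq2[of y "?Y i"] by (simp add: dist_norm norm_minus_commute)
          have "\<phi> (?Y i) y / h (?Y i) \<le> Cg" using \<phi>le[OF Y] Y(4)[of i] by (simp add: divide_le_eq)
          moreover have "0 \<le> \<phi> (?Y i) y / h (?Y i)" using \<phi>nn[OF Y(1,2)] Y(4)[of i] by simp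
          ultimately have "\<bar>src y\<bar> * \<bar>\<phi> (?Y i) y / h (?Y i)\<bar> \<le> \<bar>src y\<bar> * Cg" by (intro mult_left_mono) auto
          then show ?thesis using \<open>norm y \<le> 2\<close> by (simp add: abs_mult mult.commute)
        next
          case False
          then show ?thesis using \<phi>0[OF Y(1,2) False] Cg by simp
        qed
      qed
      show "AE y in lborel. (\<lambda>i. src y * \<phi> (?Y i) y / h (?Y i)) \<longlonglongrightarrow> 0"
        using AE_lborel_singleton[of "0::real^'n"]
      proof eventually_elim
        case (elim y)
        have yh: "norm y / 2 > 0" using elim by simp
        define E where "E = \<bar>src y\<bar> * \<bar>fsol m ((norm y / 2)\<^sup>2)\<bar>"
        have "\<forall>\<^sub>F x in at 0. norm (src y * \<phi> x y / h x) \<le> E / h x"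
          using good ev[OF yh]
        proof (eventually_elim)
          case (elim x)
          show ?case
          proof (cases "y \<in> cball x 1")
            case True
            have ny: "norm y > 0" using yh by simp
            have n1: "norm (y - x) \<ge> norm y / 2" using elim norm_triangle_ineq2[of y x] by simp
            then have "(norm y / 2)\<^sup>2 \<le> (norm (y - x))\<^sup>2" by (intro power_mono) auto
            then have f: "fsol m ((norm (y - x))\<^sup>2) \<le> fsol m ((norm y / 2)\<^sup>2)"
              using ny by (intro fsol_antimono) auto
            have "norm x < norm y / 2" using elim by auto
            then have "norm x / 2 \<le> norm (y - x)" using n1 norm_ge_zero[of x] by linarith
            then have "(norm x / 2)\<^sup>2 \<le> (norm (y - x))\<^sup>2" by (intro power_mono) auto
            then have "\<phi> x y = fsol m ((norm (y - x))\<^sup>2) - gam m 1 ((norm (y - x))\<^sup>2)" by (simp add: \<phi>_def gam_def)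
            moreover have "(norm (y - x))\<^sup>2 \<le> 1" using True by (auto simp: dist_norm norm_minus_commute power_le_one)
            then have "0 \<le> gam m 1 ((norm (y - x))\<^sup>2)" using gam_bounds(1)[OF m2, of 1] by simp
            ultimately have "\<phi> x y \<le> \<bar>fsol m ((norm y / 2)\<^sup>2)\<bar>" using f by simp
            moreover have "0 \<le> \<phi> x y" using \<phi>nn elim by auto
            ultimately have "\<bar>src y * \<phi> x y\<bar> \<le> E" unfolding E_def abs_mult by (intro mult_left_mono) auto
            then show ?thesis using elim by (simp add: abs_divide divide_right_mono)
          next
            case False
            then show ?thesis using \<phi>0[of x y] elim by (simp add: E_def)
          qed
        qed
        then have "((\<lambda>x. src y * \<phi> x y / h x) \<longlongrightarrow> 0) (at 0)" by (rule Lim_null_comparison[OF _ h_inverse_tendsto])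
        then show ?case by (rule filterlim_compose[OF _ Yat])
      qed
    qed simp
    then have "(\<lambda>i. ?I3 (?Y i) / h (?Y i)) \<longlonglongrightarrow> 0" by simp
    then show "(\<lambda>i. ?I3 (X i) / h (X i)) \<longlonglongrightarrow> 0" by (rule LIMSEQ_offset)
  qed
  have L: "((\<lambda>x. ((m * om * u x - ?I1 x) / h x + k * (1 - gam m 1 ((norm x)\<^sup>2) / h x) + ?I2 x / h x + ?I3 x / h x) / (m * om))
     \<longlongrightarrow> (0 + k * (1 - 0) + 0 + 0) / (m * om)) (at 0)"
  proof (intro tendsto_intros A B G I3)
    have "m * om > 0" using m2 om_pos by (intro mult_pos_pos) auto
    then show "m * om \<noteq> 0" by (rule less_imp_neq[symmetric])
  qed
  have alg: "(A - I) / H + k * (1 - g / H) + J / H + K / H = A / H" if "I = k * (H - g) + J + K" "H \<ge> 1"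
    for A I H g J K :: real
    using that(2) unfolding that(1) by (simp add: field_simps)
  have "\<forall>\<^sub>F x in at 0. ((m * om * u x - ?I1 x) / h x + k * (1 - gam m 1 ((norm x)\<^sup>2) / h x) + ?I2 x / h x + ?I3 x / h x) / (m * om) = u x / h x"
    using ev[of 1, OF zero_less_one] hev
  proof (eventually_elim, goal_cases)
    case (1 x)
    then have x: "x \<noteq> 0" "norm x < 1" "h x \<ge> 1" by auto
    have "?I1 x = k * (h x - gam m 1 ((norm x)\<^sup>2)) + ?I2 x + ?I3 x"
      using representation[OF k x(1,2)] by (simp add: \<phi>_def)
    then have "(m * om * u x - ?I1 x) / h x + k * (1 - gam m 1 ((norm x)\<^sup>2) / h x) + ?I2 x / h x + ?I3 x / h x = m * om * u x / h x"
      by (rule alg[OF _ x(3)])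
    moreover have "om \<noteq> 0" "m \<noteq> 0" using om_pos m2 by (metis less_irrefl, simp)
    ultimately show ?case by simp
  qed
  from Lim_transform_eventually[OF L this] show ?thesis by simp
qed

end

section \<open>Positivity of the mass\<close>

lemma eventually_powr_less:
  assumes "a > 0" "c > 0" shows "\<forall>\<^sub>F s in at_right (0::real). B * s powr a < c"
proof -
  have "((\<lambda>s. B * s powr a) \<longlongrightarrow> B * 0) (at_right 0)"
    by (intro tendsto_intros) (use assms in real_asymp)
  then show ?thesis using assms(2) by (intro order_tendstoD(2)[of _ "B * 0"]) auto
qed

context singular_solution begin

text \<open>An interior maximum of \<open>(u - \<epsilon> * w1) / w2\<close> would contradict the strict inequality for \<open>w2\<close>.\<close>
lemma comparison:
  assumes r: "r > 0"
    and V: "\<And>x. x \<noteq> 0 \<Longrightarrow> norm x \<le> r \<Longrightarrow> 0 < u x \<and> src x \<le> V x * u x \<and> 0 \<le> V x"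
    and w1: "C2_on (- {0}) w1" "\<And>x. x \<noteq> 0 \<Longrightarrow> norm x \<le> r \<Longrightarrow> 0 < w1 x \<and> V x * w1 x \<le> - laplacian w1 x"
    and w2: "C2_on (- {0}) w2" "\<And>x. x \<noteq> 0 \<Longrightarrow> norm x \<le> r \<Longrightarrow> 1 \<le> w2 x \<and> V x * w2 x < - laplacian w2 x"
    and small: "\<And>\<epsilon>. \<epsilon> > 0 \<Longrightarrow> \<forall>\<^sub>F x in at 0. u x < \<epsilon> * w1 x"
  obtains B where "\<And>x. x \<noteq> 0 \<Longrightarrow> norm x \<le> r \<Longrightarrow> u x \<le> B * w2 x"
proof -
  have "continuous_on (sphere 0 r) u" using r by (intro continuous_on_subset[OF continuous_u]) auto
  then have "bounded (u ` sphere 0 r)" by (intro compact_imp_bounded compact_continuous_image compact_sphere)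
  then obtain B where B: "B > 0" "\<And>x. norm x = r \<Longrightarrow> u x \<le> B"
    unfolding bounded_pos by (auto simp: abs_le_iff)
  have main: "u x \<le> \<epsilon> * w1 x + B * w2 x" if x: "x \<noteq> 0" "norm x \<le> r" and \<epsilon>: "\<epsilon> > 0" for x \<epsilon>
  proof (rule ccontr)
    assume neg: "\<not> u x \<le> \<epsilon> * w1 x + B * w2 x"
    obtain d where d: "d > 0" "\<And>y. y \<noteq> 0 \<Longrightarrow> norm y < d \<Longrightarrow> u y < \<epsilon> * w1 y"
      using small[OF \<epsilon>] unfolding eventually_at by (auto simp: dist_norm)
    define d' where "d' = min (d/2) (norm x / 2)"
    have "norm x > 0" using x by simp
    then have d': "0 < d'" "d' < d" "d' < norm x" using d(1) unfolding d'_def by linarith+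
    \<comment> \<open>On the inner sphere \<open>u\<close> is below \<open>\<epsilon> * w1\<close>,
      on the outer sphere below \<open>B * w2\<close>. A quotient exceeding \<open>B\<close> must
      therefore be maximal at an interior point.\<close>
    define A where "A = cball (0::real^'n) r - ball 0 d'"
    have A: "compact A" "A \<subseteq> - {0}" using d' by (auto simp: A_def compact_diff)
    have AA: "y \<noteq> 0" "norm y \<le> r" if "y \<in> A" for y using that A by (auto simp: A_def)
    have xA: "x \<in> A" using x d' by (auto simp: A_def)
    let ?z = "\<lambda>y. (u y - \<epsilon> * w1 y) / w2 y"
    have "continuous_on A ?z"
      using w2(2)[OF AA] by (intro continuous_intros continuous_on_subset[OF continuous_u A(2)]
         continuous_on_subset[OF C2_onD(1)[OF w1(1)] A(2)] continuous_on_subset[OF C2_onD(1)[OF w2(1)] A(2)]) force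
    then obtain y where y: "y \<in> A" "\<And>y'. y' \<in> A \<Longrightarrow> ?z y' \<le> ?z y"
      using continuous_attains_sup[OF A(1), of ?z] xA by blast
    define M where "M = ?z y"
    have w2x: "w2 x \<ge> 1" and w2y: "w2 y \<ge> 1" using w2(2) x AA[OF y(1)] by auto
    have "B < ?z x" using neg w2x by (simp add: less_divide_eq)
    then have MB: "M > B" using y(2)[OF xA] by (simp add: M_def)
    have eqy: "u y = \<epsilon> * w1 y + M * w2 y" using w2y by (simp add: M_def)
    have ny: "norm y < r"
    proof (rule ccontr)
      assume "\<not> norm y < r"
      then have "norm y = r" using AA(2)[OF y(1)] by simp
      then have "u y \<le> B" by (rule B(2))
      also have "B \<le> B * w2 y" using w2y B(1) by simp
      also have "\<dots> < M * w2 y" using MB w2y by (intro mult_strict_right_mono) auto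
      also have "\<dots> < \<epsilon> * w1 y + M * w2 y" using w1(2)[OF AA[OF y(1)]] \<epsilon> by simp
      finally show False using eqy by simp
    qed
    have ny': "norm y > d'"
    proof (rule ccontr)
      assume "\<not> norm y > d'"
      then have "norm y < d" using d' by simp
      then have "u y < \<epsilon> * w1 y" using d(2) AA(1)[OF y(1)] by simp
      moreover have "0 < M * w2 y" using MB B(1) w2y by (intro mult_pos_pos) auto
      ultimately show False using eqy by simp
    qed
    define S where "S = ball (0::real^'n) r - cball 0 d'"
    have S: "open S" "y \<in> S" "S \<subseteq> A" "S \<subseteq> - {0}" using ny ny' d' by (auto simp: S_def A_def open_Diff)
    note uS = C2_on_subset[OF uC2 S(4)] and w1S = C2_on_subset[OF w1(1) S(4)] and w2S = C2_on_subset[OF w2(1) S(4)]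
    let ?g = "\<lambda>x. (u x - \<epsilon> * w1 x) - M * w2 x"
    have g1: "C2_on S (\<lambda>x. u x - \<epsilon> * w1 x)" by (intro C2_on_diff(1) C2_on_cmult(1) S(1) uS w1S)
    have g: "C2_on S ?g" by (intro C2_on_diff(1) C2_on_cmult(1) S(1) g1 w2S)
    have lg: "laplacian ?g y = laplacian u y - \<epsilon> * laplacian w1 y - M * laplacian w2 y"
      using C2_on_diff(2)[OF S(1) g1 C2_on_cmult(1)[OF S(1) w2S] S(2), of M]
        C2_on_diff(2)[OF S(1) uS C2_on_cmult(1)[OF S(1) w1S] S(2), of \<epsilon>]
        C2_on_cmult(2)[OF S(1) w1S S(2), of \<epsilon>] C2_on_cmult(2)[OF S(1) w2S S(2), of M] by simp
    have "laplacian ?g y \<le> 0"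
    proof (rule laplacian_at_local_max[OF S(1,2) g])
      fix y' assume "y' \<in> S"
      then have y'A: "y' \<in> A" using S(3) by auto
      then have "w2 y' \<ge> 1" using w2(2) AA by auto
      moreover have "?z y' \<le> M" using y(2)[OF y'A] by (simp add: M_def)
      ultimately have "u y' - \<epsilon> * w1 y' \<le> M * w2 y'" by (simp add: divide_le_eq)
      then show "?g y' \<le> ?g y" using eqy by simp
    qed
    moreover have "laplacian u y = - src y" by (rule laplacian_u[OF AA(1)[OF y(1)]])
    moreover have "src y \<le> V y * (\<epsilon> * w1 y + M * w2 y)" using V[OF AA[OF y(1)]] eqy by simp
    moreover have "\<epsilon> * (V y * w1 y) \<le> \<epsilon> * - laplacian w1 y" using w1(2)[OF AA[OF y(1)]] \<epsilon> by (intro mult_left_mono) auto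
    moreover have "M * (V y * w2 y) < M * - laplacian w2 y" using w2(2)[OF AA[OF y(1)]] MB B(1) by (intro mult_strict_left_mono) auto
    ultimately show False unfolding lg by (simp add: algebra_simps)
  qed
  show ?thesis
  proof (rule that)
    fix x :: "real^'n" assume x: "x \<noteq> 0" "norm x \<le> r"
    show "u x \<le> B * w2 x"
    proof (rule field_le_epsilon)
      fix e :: real assume "e > 0"
      have w: "w1 x > 0" using w1(2)[OF x] by simp
      then have "e / w1 x > 0" using \<open>e > 0\<close> by simp
      from main[OF x this] show "u x \<le> B * w2 x + e" using w by simp
    qed
  qed
qed

text \<open>Two positive supersolutions of -Laplace - V are needed, one comparable to
  \<open>h\<close> and one bounded. Neither \<open>h\<close> nor a constant is strictly
  superharmonic, so a small power is subtracted from each: this adds |x|^(2e-2) and a multiple of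
  |x|^(2d-2), respectively, to minus the Laplacian, enough to dominate the potential.\<close>

lemma not_little_o:
  assumes lim: "((\<lambda>x. u x / h x) \<longlongrightarrow> 0) (at 0)"
  shows False
proof -
  \<comment> \<open>The midpoint of \<open>m - 2\<close> and \<open>2 / (p - 1)\<close>;
    subcriticality is what separates these two numbers.\<close>
  define b where "b = ((m - 2) + 2 / (p - 1)) / 2"
  have mp: "m - 2 < 2 / (p - 1)"
  proof (cases "CARD('n) \<ge> 3")
    case True
    then have m: "m - 2 > 0" "p < m / (m - 2)" using pcrit by (auto simp: m_eq)
    then have "p * (m - 2) < m" by (simp add: less_divide_eq)
    then have "(m - 2) * (p - 1) < 2" by (simp add: algebra_simps)
    then show ?thesis using p1 by (simp add: less_divide_eq)
  next
    case False
    then have "m = 2" using N2 by (simp add: m_eq)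
    then show ?thesis using p1 by simp
  qed
  have b: "b > m - 2" using mp by (simp add: b_def)
  have "2 * b < 2 / (p - 1) + 2 / (p - 1)" using mp by (simp add: b_def)
  then have "b < 2 / (p - 1)" by linarith
  then have bp: "b * (p - 1) < 2" using p1 by (simp add: less_divide_eq)
  obtain r0 C where r0: "0 < r0" "0 < C" "r0 \<le> 1"
    and sr: "\<And>x. x \<noteq> 0 \<Longrightarrow> norm x < r0 \<Longrightarrow> 1 \<le> u x \<and> 0 \<le> src x \<and> src x \<le> C * norm x powr (- b * (p - 1)) * u x \<and> src x \<le> C * norm x powr (- b * p)"
    by (rule src_le_powr[OF b]) blast
  \<comment> \<open>The potential is of size |x|^(2D-2), so \<open>D > 0\<close> measures the gain
    over the scale invariant power |x|^(-2).\<close>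
  define D where "D = 1 - b * (p - 1) / 2"
  have D: "D > 0" using bp by (simp add: D_def)
  \<comment> \<open>\<open>d < D\<close> lets the corrections beat the potential. The bound 1/4
    keeps \<open>e\<close> negative for every dimension from 3 on; in dimension 2,
    \<open>e = d\<close> is positive. In both cases \<open>e\<close> is nonzero.\<close>
  define d where "d = min (D/2) (1/4)"
  have d: "0 < d" "d < D" "d \<le> 1/4" using D by (auto simp: d_def)
  define e where "e = 1 - m/2 + d"
  have e0: "e \<noteq> 0"
  proof (cases "CARD('n) \<ge> 3")
    case True
    then have "m \<ge> 3" by (simp add: m_eq)
    then have "e < 0" using d by (simp add: e_def)
    then show ?thesis by simp
  next
    case False
    then have "m = 2" using N2 by (simp add: m_eq)
    then show ?thesis using d by (simp add: e_def)
  qed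
  \<comment> \<open>The second factor equals \<open>4 * d\<close>. Dividing the power by
    \<open>ce\<close> normalises minus the Laplacian of \<open>w1\<close> to |x|^(2e-2).\<close>
  define ce where "ce = e * (4 * e - 4 + 2 * m)"
  have ce: "ce \<noteq> 0" using e0 d by (simp add: ce_def e_def)
  define W where "W = d * (4 * d - 4 + 2 * m)"
  have W: "W > 0" using d m2 by (simp add: W_def)
  \<comment> \<open>Above \<open>m - 2\<close>, as the logarithmic case demands, but by so little
    that the potential times \<open>h\<close> still carries the vanishing factor
    \<open>s powr ((D - d)/2)\<close> relative to \<open>s powr (e - 1)\<close>.\<close>
  define b' where "b' = m - 2 + (D - d)"
  obtain s1 where s1: "s1 > 0" and hs: "\<And>s. 0 < s \<Longrightarrow> s < s1 \<Longrightarrow> fsol m s \<le> s powr (- b'/2)"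
    by (rule fsol_le_powr[OF m2, of b']) (use d in \<open>auto simp: b'_def\<close>)
  obtain c s2 where c: "0 < c" "0 < s2" and hc: "\<And>s. 0 < s \<Longrightarrow> s < s2 \<Longrightarrow> c * s powr (1 - m/2) \<le> fsol m s"
    by (rule fsol_ge_powr[OF m2]) blast
  have "\<forall>\<^sub>F s in at_right (0::real). C * s powr ((D - d)/2) < 1/2 \<and> C / \<bar>ce\<bar> * s powr D < 1/2 \<and> 2 * C * s powr (D - d) < W \<and> 1 / \<bar>ce\<bar> / c * s powr d < 1/2 \<and> 1 * s powr d < 1"
    using d D W by (intro eventually_conj eventually_powr_less) auto
  then obtain s3 where s3: "s3 > 0" and S3: "\<And>s. 0 < s \<Longrightarrow> s < s3 \<Longrightarrow>
     C * s powr ((D - d)/2) < 1/2 \<and> C / \<bar>ce\<bar> * s powr D < 1/2 \<and> 2 * C * s powr (D - d) < W \<and> 1 / \<bar>ce\<bar> / c * s powr d < 1/2 \<and> s powr d < 1"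
    unfolding eventually_at_right_field by auto
  define t where "t = min (min s1 s2) (min s3 (r0\<^sup>2))"
  have t: "0 < t" "t \<le> s1" "t \<le> s2" "t \<le> s3" "t \<le> r0\<^sup>2" using s1 c s3 r0 by (auto simp: t_def)
  define r where "r = sqrt t / 2"
  have r: "r > 0" using t by (simp add: r_def)
  have sm: "0 < (norm x)\<^sup>2" "(norm x)\<^sup>2 < t" "norm x < r0" if "x \<noteq> 0" "norm x \<le> r" for x :: "real^'n"
  proof -
    show "0 < (norm x)\<^sup>2" using that by simp
    have "norm x < sqrt t" using that(2) r unfolding r_def by linarith
    then have "(norm x)\<^sup>2 < (sqrt t)\<^sup>2" by (intro power_strict_mono) auto
    then show "(norm x)\<^sup>2 < t" using t by simp
    then have "(norm x)\<^sup>2 < r0\<^sup>2" using t by simp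
    then show "norm x < r0" using r0 by (simp add: power2_less_imp_less)
  qed
  define V where "V x = C * ((norm x)\<^sup>2) powr (- 1 + D)" for x :: "real^'n"
  define w1 where "w1 x = h x - 1 / ce * ((norm x)\<^sup>2) powr e" for x :: "real^'n"
  define w2 where "w2 x = 2 - ((norm x)\<^sup>2) powr d" for x :: "real^'n"
  have hC2: "C2_on (- {0}) h" "\<And>x. x \<noteq> 0 \<Longrightarrow> laplacian h x = 0"
    using fsol_comp_C2[of "\<lambda>t. t" "\<lambda>_. 1" "\<lambda>_. 0" 1, where 'n='n, folded m_eq]
    by (auto simp: continuous_on_const intro!: derivative_eq_intros)
  note o = open_Compl[OF closed_singleton[of "0::real^'n"]]
  note pw = norm_powr_C2[where 'n='n, folded m_eq]
  have w1C: "C2_on (- {0}) w1" unfolding w1_def by (intro C2_on_diff(1) C2_on_cmult(1) o hC2(1) pw(1))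
  have w1L: "laplacian w1 x = - (((norm x)\<^sup>2) powr (e - 1))" if "x \<noteq> 0" for x
  proof -
    have "laplacian w1 x = laplacian h x - laplacian (\<lambda>x. 1 / ce * ((norm x)\<^sup>2) powr e) x"
      unfolding w1_def by (rule C2_on_diff(2)[OF o hC2(1) C2_on_cmult(1)[OF o pw(1)]]) (use that in simp)
    also have "laplacian (\<lambda>x. 1 / ce * ((norm x)\<^sup>2) powr e) x = 1 / ce * laplacian (\<lambda>x::real^'n. ((norm x)\<^sup>2) powr e) x"
      by (rule C2_on_cmult(2)[OF o pw(1)]) (use that in simp)
    finally show ?thesis using that ce by (simp add: hC2(2) pw(2) ce_def)
  qed
  have w2C: "C2_on (- {0}) w2" unfolding w2_def by (intro C2_on_diff(1) o C2_on_const pw(1))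
  have w2L: "laplacian w2 x = - (W * ((norm x)\<^sup>2) powr (d - 1))" if "x \<noteq> 0" for x
  proof -
    have k: "laplacian (\<lambda>x::real^'n. 2) x = 0"
    proof -
      have "partial i (\<lambda>_. c) = (\<lambda>_. 0)" for i :: 'n and c
        using has_pd_imp(2)[OF has_pd_const] by fastforce
      then show ?thesis by (simp add: laplacian_def)
    qed
    have "laplacian w2 x = laplacian (\<lambda>x::real^'n. 2) x - laplacian (\<lambda>x::real^'n. ((norm x)\<^sup>2) powr d) x"
      unfolding w2_def by (rule C2_on_diff(2)[OF o C2_on_const pw(1)]) (use that in simp)
    then show ?thesis using that by (simp add: k pw(2) W_def)
  qed
  have half: "\<bar>1 / ce * ((norm x)\<^sup>2) powr e\<bar> \<le> h x / 2" and hpos: "h x > 0" if "x \<noteq> 0" "norm x \<le> r" for x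
  proof -
    define s where "s = (norm x)\<^sup>2"
    have s: "0 < s" "s < t" using sm[OF that] by (auto simp: s_def)
    have hh: "c * s powr (1 - m/2) \<le> h x" using hc[of s] s t by (simp add: s_def)
    have "0 < c * s powr (1 - m/2)" using c s by simp
    then show hx: "h x > 0" using hh by linarith
    have "s powr e = s powr d * s powr (1 - m/2)" by (simp add: e_def add.commute flip: powr_add)
    then have "\<bar>1 / ce * s powr e\<bar> = (1 / \<bar>ce\<bar> / c * s powr d) * (c * s powr (1 - m/2))"
      using c by (simp add: abs_mult)
    also have "\<dots> \<le> 1/2 * h x"
      using S3[of s] s t hh c by (intro mult_mono) auto
    finally show "\<bar>1 / ce * ((norm x)\<^sup>2) powr e\<bar> \<le> h x / 2" by (simp add: s_def)
  qed
  have VV: "0 < u x \<and> src x \<le> V x * u x \<and> 0 \<le> V x" if x: "x \<noteq> 0" "norm x \<le> r" for x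
  proof -
    have "2 * (- 1 + D) = - b * (p - 1)" by (simp add: D_def)
    then have "((norm x)\<^sup>2) powr (- 1 + D) = norm x powr (- b * (p - 1))"
      using x by (simp add: powr_powr flip: powr_numeral)
    then show ?thesis using sr[OF x(1) sm(3)[OF x]] r0 by (auto simp: V_def)
  qed
  have W1: "0 < w1 x \<and> V x * w1 x \<le> - laplacian w1 x" if x: "x \<noteq> 0" "norm x \<le> r" for x
  proof
    show "0 < w1 x" using half[OF x] hpos[OF x] unfolding w1_def by linarith
    define s where "s = (norm x)\<^sup>2"
    have s: "0 < s" "s < t" using sm[OF x] by (auto simp: s_def)
    have "w1 x \<le> s powr (- b'/2) + 1 / \<bar>ce\<bar> * s powr e"
    proof -
      have "h x \<le> s powr (- b'/2)" using hs[of s] s t by (simp add: s_def)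
      moreover have "- (1 / ce * s powr e) \<le> \<bar>1 / ce * s powr e\<bar>" by linarith
      ultimately show ?thesis unfolding w1_def s_def[symmetric] abs_mult by simp
    qed
    then have "V x * w1 x \<le> C * s powr (- 1 + D) * (s powr (- b'/2) + 1 / \<bar>ce\<bar> * s powr e)"
      unfolding V_def s_def[symmetric] using r0 by (intro mult_left_mono) auto
    also have "\<dots> = C * (s powr (- 1 + D) * s powr (- b'/2)) + C / \<bar>ce\<bar> * (s powr (- 1 + D) * s powr e)"
      by (simp add: algebra_simps)
    also have "s powr (- 1 + D) * s powr (- b'/2) = s powr ((D - d)/2) * s powr (e - 1)"
    proof -
      have "- 1 + D + - b'/2 = (D - d)/2 + (e - 1)" by (simp add: b'_def e_def field_simps)
      then show ?thesis by (metis powr_add)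
    qed
    also have "s powr (- 1 + D) * s powr e = s powr D * s powr (e - 1)"
      by (simp add: algebra_simps flip: powr_add)
    also have "C * (s powr ((D - d)/2) * s powr (e - 1)) + C / \<bar>ce\<bar> * (s powr D * s powr (e - 1))
       = (C * s powr ((D - d)/2) + C / \<bar>ce\<bar> * s powr D) * s powr (e - 1)" by (simp add: algebra_simps)
    also have "\<dots> \<le> 1 * s powr (e - 1)"
    proof (rule mult_right_mono)
      have "s < s3" using s t by simp
      then show "C * s powr ((D - d)/2) + C / \<bar>ce\<bar> * s powr D \<le> 1" using S3[OF s(1)] by linarith
    qed simp
    finally show "V x * w1 x \<le> - laplacian w1 x" using w1L[OF x(1)] by (simp add: s_def)
  qed
  have W2: "1 \<le> w2 x \<and> V x * w2 x < - laplacian w2 x" if x: "x \<noteq> 0" "norm x \<le> r" for x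
  proof
    define s where "s = (norm x)\<^sup>2"
    have s: "0 < s" "s < t" using sm[OF x] by (auto simp: s_def)
    show "1 \<le> w2 x" using S3[of s] s t unfolding w2_def s_def[symmetric] by simp
    have "V x * w2 x \<le> C * s powr (- 1 + D) * 2"
      unfolding V_def w2_def s_def[symmetric] using r0 by (intro mult_left_mono) auto
    also have "\<dots> = 2 * C * s powr (D - d) * s powr (d - 1)" by (simp flip: powr_add)
    also have "\<dots> < W * s powr (d - 1)" using S3[of s] s t by (intro mult_strict_right_mono) auto
    finally show "V x * w2 x < - laplacian w2 x" using w2L[OF x(1)] by (simp add: s_def)
  qed
  have small: "\<forall>\<^sub>F x in at 0. u x < \<epsilon> * w1 x" if "\<epsilon> > 0" for \<epsilon>
  proof -
    have "\<forall>\<^sub>F x in at 0. u x / h x < \<epsilon> / 2" using that by (intro order_tendstoD(2)[OF lim]) simp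
    moreover have "\<forall>\<^sub>F x in at 0. x \<noteq> 0 \<and> norm x \<le> r" using r by (auto simp: eventually_at dist_norm intro!: exI[of _ r])
    ultimately show ?thesis
    proof eventually_elim
      case (elim x)
      then have hx: "h x > 0" and "\<bar>1 / ce * ((norm x)\<^sup>2) powr e\<bar> \<le> h x / 2" using hpos half by auto
      then have "h x / 2 \<le> w1 x" unfolding w1_def by linarith
      then have "\<epsilon> * (h x / 2) \<le> \<epsilon> * w1 x" using that by (intro mult_left_mono) auto
      moreover have "u x < \<epsilon> / 2 * h x" using elim hx by (simp add: divide_less_eq)
      ultimately show ?case by simp
    qed
  qed
  obtain B where B: "\<And>x. x \<noteq> 0 \<Longrightarrow> norm x \<le> r \<Longrightarrow> u x \<le> B * w2 x"
    by (rule comparison[OF r VV w1C W1 w2C W2 small]) blast+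
  have "u x \<le> \<bar>B\<bar> * 2" if x: "x \<noteq> 0" "norm x \<le> r" for x
  proof -
    have "w2 x \<le> 2" by (simp add: w2_def)
    moreover have "1 \<le> w2 x" using W2[OF x] by simp
    ultimately have "B * w2 x \<le> \<bar>B\<bar> * 2" by (intro mult_mono) auto
    then show ?thesis using B[OF x] by simp
  qed
  then have "\<forall>\<^sub>F x in at 0. u x \<le> \<bar>B\<bar> * 2" using r by (auto simp: eventually_at dist_norm intro!: exI[of _ r])
  moreover have "\<forall>\<^sub>F x in at 0. u x > \<bar>B\<bar> * 2" using blowup by (simp add: filterlim_at_top_dense)
  ultimately have "\<forall>\<^sub>F x::real^'n in at 0. False" by eventually_elim simp
  then show False by simp
qed

lemma singularity:
  obtains k where "k > 0" "\<And>\<xi>. C2c \<xi> \<Longrightarrow> weak \<xi> = k * \<xi> 0" "((\<lambda>x. u x / h x) \<longlongrightarrow> k / (m * om)) (at 0)"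
proof -
  obtain k where k: "\<And>\<xi>. C2c \<xi> \<Longrightarrow> weak \<xi> = k * \<xi> 0" by (rule weak_dirac) blast
  have lim: "((\<lambda>x. u x / h x) \<longlongrightarrow> k / (m * om)) (at 0)" by (rule asymptotics) (erule k)
  have "\<forall>\<^sub>F x in at 0. u x \<ge> 0" using blowup by (simp add: filterlim_at_top)
  moreover have "\<forall>\<^sub>F x in at 0. h x \<ge> 0" using h_at_top by (simp add: filterlim_at_top)
  ultimately have "\<forall>\<^sub>F x in at 0. u x / h x \<ge> 0" by eventually_elim simp
  then have "k / (m * om) \<ge> 0" by (rule tendsto_lowerbound[OF lim]) simp
  moreover have "k / (m * om) \<noteq> 0" using not_little_o lim by metis
  ultimately have "k / (m * om) > 0" by (metis less_eq_real_def)
  moreover have "m * om > 0" using m2 om_pos by (intro mult_pos_pos) auto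
  ultimately have "k > 0" by (metis less_divide_eq mult_zero_left)
  then show ?thesis using k lim by (rule that)
qed

end

section \<open>Asymptotics of the Helmholtz fundamental solution\<close>

text \<open>The half-line integrand of Y_\<nu> with \<open>sinh t\<close> replaced by
  \<open>exp t / 2\<close>. The true integrand differs by the factor
  \<open>exp (r/2 * exp (- t))\<close>, which lies between 1 and \<open>exp (r/2)\<close> and so is
  invisible in the limit.\<close>

definition Kexp :: "real \<Rightarrow> real \<Rightarrow> real \<Rightarrow> real" where
  "Kexp \<nu> r t = exp (\<nu> * t) * exp (- (r/2) * exp t)"

lemma Kexp_pos: "Kexp \<nu> r t > 0" by (simp add: Kexp_def)

text \<open>The substitution \<open>\<tau> = r/2 * exp t\<close> turns \<open>Kexp\<close> into an incomplete Gamma integral.\<close>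
lemma Kexp_gamma:
  assumes \<nu>: "\<nu> > 0" and r: "r > 0"
  shows "Kexp \<nu> r absolutely_integrable_on {0..}"
    and "(r/2) powr \<nu> * integral {0..} (Kexp \<nu> r) \<le> Gamma \<nu>"
    and "Gamma \<nu> - (r/2) powr \<nu> / \<nu> \<le> (r/2) powr \<nu> * integral {0..} (Kexp \<nu> r)"
proof -
  define f where "f t = t powr (\<nu> - 1) / exp t" for t :: real
  define g where "g t = r/2 * exp t" for t :: real
  have fG: "(f has_integral Gamma \<nu>) {0..}" unfolding f_def by (rule Gamma_integral_real[OF \<nu>])
  have f0: "f t \<ge> 0" for t by (simp add: f_def)
  have fa: "f absolutely_integrable_on {0..}"
    using fG f0 by (intro nonnegative_absolutely_integrable_1) (auto simp: has_integral_iff)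
  have fa': "f absolutely_integrable_on {r/2..}" using fa by (rule set_integrable_subset) (use r in auto)
  have im: "g ` {0..} = {r/2..}"
  proof (intro equalityI subsetI)
    fix y assume "y \<in> g ` {0..}" then show "y \<in> {r/2..}" using r by (auto simp: g_def)
  next
    fix y assume y: "y \<in> {r/2..}"
    then have "y = g (ln (y / (r/2)))" "0 \<le> ln (y / (r/2))" using r by (auto simp: g_def)
    then show "y \<in> g ` {0..}" by auto
  qed
  have eq: "\<bar>g t\<bar> * f (g t) = (r/2) powr \<nu> * Kexp \<nu> r t" for t
  proof -
    have "g t > 0" using r by (simp add: g_def)
    then have "\<bar>g t\<bar> * f (g t) = (g t) powr \<nu> * exp (- g t)" by (simp add: f_def powr_diff exp_minus field_simps)
    also have "(g t) powr \<nu> = (r/2) powr \<nu> * exp (\<nu> * t)" unfolding g_def using r by (subst powr_mult) (auto simp: exp_powr_real mult.commute)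
    finally show ?thesis by (simp add: Kexp_def g_def)
  qed
  have "(\<lambda>t. \<bar>g t\<bar> * f (g t)) absolutely_integrable_on {0..} \<and> integral {0..} (\<lambda>t. \<bar>g t\<bar> * f (g t)) = integral {r/2..} f
     \<longleftrightarrow> f absolutely_integrable_on (g ` {0..}) \<and> integral (g ` {0..}) f = integral {r/2..} f"
  proof (rule has_absolute_integral_change_of_variables_1')
    show "(g has_field_derivative g x) (at x within {0..})" for x
      unfolding g_def by (auto intro!: derivative_eq_intros)
    show "inj_on g {0..}" using r by (auto simp: g_def inj_on_def)
  qed simp
  then have K: "(\<lambda>t. (r/2) powr \<nu> * Kexp \<nu> r t) absolutely_integrable_on {0..}"
    "integral {0..} (\<lambda>t. (r/2) powr \<nu> * Kexp \<nu> r t) = integral {r/2..} f"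
    using fa' im unfolding eq by auto
  have "(\<lambda>t. (2/r) powr \<nu> * ((r/2) powr \<nu> * Kexp \<nu> r t)) absolutely_integrable_on {0..}"
    using K(1) by (rule set_integrable_mult_right)
  moreover have "(\<lambda>t. (2/r) powr \<nu> * ((r/2) powr \<nu> * Kexp \<nu> r t)) = Kexp \<nu> r"
  proof -
    have "(2/r) powr \<nu> * (r/2) powr \<nu> = 1" using r by (simp flip: powr_mult)
    then show ?thesis by (simp flip: mult.assoc)
  qed
  ultimately show "Kexp \<nu> r absolutely_integrable_on {0..}" by simp
  have KI: "(r/2) powr \<nu> * integral {0..} (Kexp \<nu> r) = integral {r/2..} f" using K(2) by simp
  have f1: "f integrable_on {0..r/2}"
    using fa by (intro set_lebesgue_integral_eq_integral(1) set_integrable_subset[OF fa]) auto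
  have f2: "f integrable_on {r/2..}" using fa' by (rule set_lebesgue_integral_eq_integral(1))
  have "(f has_integral (integral {0..r/2} f + integral {r/2..} f)) ({0..r/2} \<union> {r/2..})"
  proof (rule has_integral_Un)
    have "{0..r/2} \<inter> {r/2..} \<subseteq> {r/2}" by auto
    then show "negligible ({0..r/2} \<inter> {r/2..})" using negligible_sing negligible_subset by blast
  qed (use f1 f2 in \<open>auto simp: has_integral_integral\<close>)
  moreover have "{0..r/2} \<union> {r/2..} = {0..}" using r by auto
  ultimately have split: "Gamma \<nu> = integral {0..r/2} f + integral {r/2..} f"
    using fG has_integral_unique by metis
  have "integral {0..r/2} f \<ge> 0" using f1 f0 by (intro integral_nonneg) auto
  then show "(r/2) powr \<nu> * integral {0..} (Kexp \<nu> r) \<le> Gamma \<nu>" unfolding KI using split by simp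
  have "((\<lambda>t. t powr (\<nu> - 1)) has_integral (r/2) powr (\<nu> - 1 + 1) / (\<nu> - 1 + 1)) {0..r/2}"
    using \<nu> r by (intro has_integral_powr_from_0) auto
  then have hi: "((\<lambda>t. t powr (\<nu> - 1)) has_integral (r/2) powr \<nu> / \<nu>) {0..r/2}" by simp
  have "integral {0..r/2} f \<le> (r/2) powr \<nu> / \<nu>"
  proof (rule has_integral_le[OF _ hi])
    show "(f has_integral integral {0..r/2} f) {0..r/2}" using f1 by (simp add: has_integral_integral)
    show "f t \<le> t powr (\<nu> - 1)" if "t \<in> {0..r/2}" for t
      using that by (auto simp: f_def divide_le_eq intro!: mult_le_cancel_left1[THEN iffD2])
  qed
  then show "Gamma \<nu> - (r/2) powr \<nu> / \<nu> \<le> (r/2) powr \<nu> * integral {0..} (Kexp \<nu> r)" unfolding KI using split by simp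
qed

lemma continuous_Kexp: "continuous_on S (Kexp \<nu> r)"
  unfolding Kexp_def[abs_def] by (intro continuous_intros)

lemma integrable_dominated:
  fixes f g :: "real \<Rightarrow> real"
  assumes "continuous_on UNIV f" "g integrable_on {0..}" "\<And>t. t \<ge> 0 \<Longrightarrow> \<bar>f t\<bar> \<le> g t"
  shows "f integrable_on {0..}"
proof (rule measurable_bounded_by_integrable_imp_integrable[of _ _ g])
  show "f \<in> borel_measurable (lebesgue_on {0..})"
    by (intro continuous_imp_measurable_on_sets_lebesgue continuous_on_subset[OF assms(1)]) auto
qed (use assms in auto)

text \<open>Raising the order to \<open>\<bar>\<nu>\<bar> + 1\<close> reaches the range of the Gamma
  integral while only enlarging the integrand, so zero and negative orders are covered too.\<close>

lemma Kexp_integrable: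
  assumes "r > 0" shows "Kexp \<nu> r integrable_on {0..}"
proof (rule integrable_dominated[where g="Kexp (\<bar>\<nu>\<bar> + 1) r"])
  show "Kexp (\<bar>\<nu>\<bar> + 1) r integrable_on {0..}"
    using Kexp_gamma(1)[of "\<bar>\<nu>\<bar> + 1" r] assms by (intro set_lebesgue_integral_eq_integral(1)) auto
  show "\<bar>Kexp \<nu> r t\<bar> \<le> Kexp (\<bar>\<nu>\<bar> + 1) r t" if "t \<ge> 0" for t
  proof -
    have "\<nu> * t \<le> (\<bar>\<nu>\<bar> + 1) * t" using that by (intro mult_right_mono) auto
    then show ?thesis by (simp add: Kexp_def)
  qed
qed (rule continuous_Kexp)

text \<open>This is the exponential integral E_1(r/2). With \<open>L = ln (2/r)\<close> the
  integrand is exp (- exp (t - L)): close to 1 before \<open>L\<close> up to an error of integral at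
  most 1, and beyond \<open>L\<close> dominated by \<open>exp (L - t)\<close>.\<close>

lemma Kexp_0_bounds:
  assumes r: "0 < r" "r < 2"
  shows "integral {0..} (Kexp 0 r) \<le> ln (2/r) + 1" "ln (2/r) - 1 \<le> integral {0..} (Kexp 0 r)"
proof -
  define L where "L = ln (2/r)"
  have L: "L > 0" using r by (simp add: L_def)
  have eL: "r/2 = exp (- L)" using r by (simp add: L_def exp_minus)
  have K: "Kexp 0 r t = exp (- exp (t - L))" for t
    unfolding Kexp_def eL by (simp add: exp_diff exp_minus field_simps)
  have i: "Kexp 0 r integrable_on {0..}" using Kexp_integrable r by auto
  have c: "Kexp 0 r integrable_on {0..L}" by (intro integrable_continuous_interval continuous_Kexp)
  have 2: "((\<lambda>t. exp (- 1 * t)) has_integral exp (- 1 * L) / 1) {L..}"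
    by (rule has_integral_exp_minus_to_infinity) simp
  have c2: "Kexp 0 r integrable_on {L..}"
  proof -
    have "Kexp 0 r absolutely_integrable_on {0..}"
      by (rule nonnegative_absolutely_integrable_1[OF i]) (simp add: Kexp_pos less_imp_le)
    then have "Kexp 0 r absolutely_integrable_on {L..}" by (rule set_integrable_subset) (use L in auto)
    then show ?thesis by (rule set_lebesgue_integral_eq_integral(1))
  qed
  have "(Kexp 0 r has_integral (integral {0..L} (Kexp 0 r) + integral {L..} (Kexp 0 r))) ({0..L} \<union> {L..})"
  proof (rule has_integral_Un)
    have "{0..L} \<inter> {L..} \<subseteq> {L}" by auto
    then show "negligible ({0..L} \<inter> {L..})" using negligible_sing negligible_subset by blast
  qed (use c c2 in \<open>auto simp: has_integral_integral\<close>)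
  moreover have "{0..L} \<union> {L..} = {0..}" using L by auto
  ultimately have s: "integral {0..} (Kexp 0 r) = integral {0..L} (Kexp 0 r) + integral {L..} (Kexp 0 r)"
    by (metis integral_unique)
  have "integral {0..L} (Kexp 0 r) \<le> integral {0..L} (\<lambda>_. 1)"
    by (rule integral_le[OF c]) (auto simp: K)
  then have a: "integral {0..L} (Kexp 0 r) \<le> L" using L by simp
  have "integral {L..} (Kexp 0 r) \<le> exp L * (exp (- 1 * L) / 1)"
  proof (rule has_integral_le[OF _ has_integral_mult_right[OF 2]])
    show "(Kexp 0 r has_integral integral {L..} (Kexp 0 r)) {L..}" using c2 by (simp add: has_integral_integral)
    show "Kexp 0 r t \<le> exp L * exp (- 1 * t)" if "t \<in> {L..}" for t
    proof -
      have "t - L \<le> exp (t - L)" using exp_ge_add_one_self[of "t - L"] by linarith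
      then show ?thesis by (simp add: K flip: exp_add)
    qed
  qed
  then have "integral {L..} (Kexp 0 r) \<le> 1" by (simp flip: exp_add)
  then show "integral {0..} (Kexp 0 r) \<le> ln (2/r) + 1" using s a by (simp add: L_def)
  have "((\<lambda>t. 1 - exp (t - L)) has_integral (L - exp (L - L)) - (0 - exp (0 - L))) {0..L}"
    using L by (intro fundamental_theorem_of_calculus)
      (auto intro!: derivative_eq_intros simp flip: has_real_derivative_iff_has_vector_derivative)
  then have "(L - exp (L - L)) - (0 - exp (0 - L)) \<le> integral {0..L} (Kexp 0 r)"
  proof (rule has_integral_le)
    show "(Kexp 0 r has_integral integral {0..L} (Kexp 0 r)) {0..L}" using c by (simp add: has_integral_integral)
    show "1 - exp (t - L) \<le> Kexp 0 r t" for t using exp_ge_add_one_self[of "- exp (t - L)"] by (simp add: K)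
  qed
  moreover have "integral {L..} (Kexp 0 r) \<ge> 0" using c2 Kexp_pos by (intro integral_nonneg) (auto intro: less_imp_le)
  moreover have "exp (0 - L) > 0" by simp
  moreover have "exp (L - L) = 1" by simp
  ultimately have "L - 1 \<le> integral {0..} (Kexp 0 r)" using s by linarith
  then show "ln (2/r) - 1 \<le> integral {0..} (Kexp 0 r)" by (simp add: L_def)
qed

section \<open>The Bessel function Y_\<nu> at the origin\<close>

definition Ymain :: "real \<Rightarrow> real \<Rightarrow> real" where
  "Ymain \<nu> r = integral {0..} (\<lambda>t. exp (\<nu> * t) * exp (- r * sinh t))"

lemma sinh_split: "exp (\<nu> * t) * exp (- r * sinh t) = Kexp \<nu> r t * exp (r/2 * exp (- t))"
proof -
  have "- r * sinh t = - (r/2) * exp t + r/2 * exp (- t)" by (simp add: sinh_field_def field_simps)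
  then have "exp (- r * sinh t) = exp (- (r/2) * exp t) * exp (r/2 * exp (- t))" by (simp only: exp_add)
  then show ?thesis unfolding Kexp_def by (simp only: mult.assoc)
qed

lemma sinh_integrand_bounds:
  assumes "r > 0" "t \<ge> 0"
  shows "Kexp \<nu> r t \<le> exp (\<nu> * t) * exp (- r * sinh t)" "exp (\<nu> * t) * exp (- r * sinh t) \<le> exp (r/2) * Kexp \<nu> r t"
proof -
  have "1 \<le> exp (r/2 * exp (- t))" using assms by simp
  then show "Kexp \<nu> r t \<le> exp (\<nu> * t) * exp (- r * sinh t)"
    unfolding sinh_split using Kexp_pos[of \<nu> r t] by simp
  have "r/2 * exp (- t) \<le> r/2 * 1" using assms by (intro mult_left_mono) auto
  then have "exp (r/2 * exp (- t)) \<le> exp (r/2)" by simp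
  then have "Kexp \<nu> r t * exp (r/2 * exp (- t)) \<le> Kexp \<nu> r t * exp (r/2)"
    using Kexp_pos[of \<nu> r t] by (intro mult_left_mono) auto
  then show "exp (\<nu> * t) * exp (- r * sinh t) \<le> exp (r/2) * Kexp \<nu> r t" unfolding sinh_split by (simp add: mult.commute)
qed

lemma Ymain_bounds:
  assumes r: "r > 0"
  shows "(\<lambda>t. exp (\<nu> * t) * exp (- r * sinh t)) integrable_on {0..}"
    "integral {0..} (Kexp \<nu> r) \<le> Ymain \<nu> r" "Ymain \<nu> r \<le> exp (r/2) * integral {0..} (Kexp \<nu> r)"
proof -
  have K: "(\<lambda>t. exp (r/2) * Kexp \<nu> r t) integrable_on {0..}"
    using Kexp_integrable[OF r] by (rule integrable_on_mult_right)
  show i: "(\<lambda>t. exp (\<nu> * t) * exp (- r * sinh t)) integrable_on {0..}"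
    by (rule integrable_dominated[OF _ K]) (use sinh_integrand_bounds[OF r] in \<open>auto intro!: continuous_intros\<close>)
  show "integral {0..} (Kexp \<nu> r) \<le> Ymain \<nu> r" unfolding Ymain_def
    by (rule integral_le[OF Kexp_integrable[OF r] i]) (use sinh_integrand_bounds[OF r] in auto)
  have "Ymain \<nu> r \<le> integral {0..} (\<lambda>t. exp (r/2) * Kexp \<nu> r t)" unfolding Ymain_def
    by (rule integral_le[OF i K]) (use sinh_integrand_bounds[OF r] in auto)
  then show "Ymain \<nu> r \<le> exp (r/2) * integral {0..} (Kexp \<nu> r)" by simp
qed

text \<open>The integral over {0..pi} has an integrand bounded by 1, so after division by pi it
  contributes at most 1 in absolute value. Only the half-line integral can be singular.\<close>

lemma BesselY_split:
  assumes r: "r > 0"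
  obtains b where "\<bar>b\<bar> \<le> 1" "BesselY \<nu> r = b - (Ymain \<nu> r + cos (\<nu> * pi) * Ymain (- \<nu>) r) / pi"
proof
  let ?I = "integral {0..pi} (\<lambda>\<theta>. sin (r * sin \<theta> - \<nu> * \<theta>))"
  have "norm ?I \<le> integral {0..pi} (\<lambda>_. 1::real)"
    by (rule integral_norm_bound_integral) (auto intro!: integrable_continuous_interval continuous_intros)
  then show "\<bar>?I / pi\<bar> \<le> 1" by (simp add: divide_le_eq)
  have e: "(exp (\<nu> * t) + exp (- \<nu> * t) * cos (\<nu> * pi)) * exp (- r * sinh t)
    = exp (\<nu> * t) * exp (- r * sinh t) + cos (\<nu> * pi) * (exp (- \<nu> * t) * exp (- r * sinh t))" for t
    by (simp add: algebra_simps)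
  have "integral {0..} (\<lambda>t. (exp (\<nu> * t) + exp (- \<nu> * t) * cos (\<nu> * pi)) * exp (- r * sinh t))
     = Ymain \<nu> r + cos (\<nu> * pi) * Ymain (- \<nu>) r"
    unfolding e Ymain_def using Ymain_bounds(1)[OF r, of \<nu>] Ymain_bounds(1)[OF r, of "- \<nu>"]
    by (subst Henstock_Kurzweil_Integration.integral_add) (auto intro: integrable_on_mult_right)
  then show "BesselY \<nu> r = ?I / pi - (Ymain \<nu> r + cos (\<nu> * pi) * Ymain (- \<nu>) r) / pi"
    by (simp add: BesselY_def)
qed

text \<open>At order zero both exponentials of the half-line integral contribute equally, each like
  \<open>ln (2/r)\<close>; hence the 2 in the limit. The quotient is rewritten over the positive
  number \<open>- ln r\<close> before estimating.\<close>

lemma BesselY_0_asymp: "((\<lambda>r. BesselY 0 r / ln r) \<longlongrightarrow> 2 / pi) (at_right 0)"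
proof (rule tendsto_sandwich)
  have ev: "\<forall>\<^sub>F r in at_right (0::real). 0 < r \<and> r < 1/4"
    unfolding eventually_at_right_field by (auto intro!: exI[of _ "1/4"])
  have B: "BesselY 0 r / ln r \<ge> (2 * (ln (2/r) - 1) / pi - 1) / (- ln r) \<and> BesselY 0 r / ln r \<le> (1 + 2 * (exp (r/2) * (ln (2/r) + 1)) / pi) / (- ln r)"
    if r: "0 < r" "r < 1/4" for r
  proof -
    obtain b where b: "\<bar>b\<bar> \<le> 1" "BesselY 0 r = b - (Ymain 0 r + Ymain 0 r) / pi"
      by (rule BesselY_split[OF r(1), of 0]) simp
    have l: "ln r < 0" using r by simp
    have "ln (2/r) - 1 \<le> Ymain 0 r" using Kexp_0_bounds(2)[of r] Ymain_bounds(2)[of r 0] r by simp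
    then have 1: "2 * (ln (2/r) - 1) / pi \<le> (Ymain 0 r + Ymain 0 r) / pi" by (intro divide_right_mono) auto
    have "Ymain 0 r \<le> exp (r/2) * integral {0..} (Kexp 0 r)" using Ymain_bounds(3)[of r 0] r by simp
    also have "\<dots> \<le> exp (r/2) * (ln (2/r) + 1)" using Kexp_0_bounds(1)[of r] r by (intro mult_left_mono) auto
    finally have 2: "(Ymain 0 r + Ymain 0 r) / pi \<le> 2 * (exp (r/2) * (ln (2/r) + 1)) / pi" by (intro divide_right_mono) auto
    have "BesselY 0 r / ln r = (- BesselY 0 r) / (- ln r)" by simp
    moreover have "(2 * (ln (2/r) - 1) / pi - 1) / (- ln r) \<le> (- BesselY 0 r) / (- ln r)"
      using 1 b l by (intro divide_right_mono) auto
    moreover have "(- BesselY 0 r) / (- ln r) \<le> (1 + 2 * (exp (r/2) * (ln (2/r) + 1)) / pi) / (- ln r)"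
      using 2 b l by (intro divide_right_mono) auto
    ultimately show ?thesis by simp
  qed
  show "\<forall>\<^sub>F r in at_right 0. (2 * (ln (2/r) - 1) / pi - 1) / (- ln r) \<le> BesselY 0 r / ln r"
    using ev by eventually_elim (use B in auto)
  show "\<forall>\<^sub>F r in at_right 0. BesselY 0 r / ln r \<le> (1 + 2 * (exp (r/2) * (ln (2/r) + 1)) / pi) / (- ln r)"
    using ev by eventually_elim (use B in auto)
  show "((\<lambda>r. (2 * (ln (2/r) - 1) / pi - 1) / (- ln r)) \<longlongrightarrow> 2 / pi) (at_right (0::real))"
    by (real_asymp simp: field_simps)
  show "((\<lambda>r. (1 + 2 * (exp (r/2) * (ln (2/r) + 1)) / pi) / (- ln r)) \<longlongrightarrow> 2 / pi) (at_right (0::real))"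
    by (real_asymp simp: field_simps)
qed

text \<open>Only the half with \<open>exp (\<nu> * t)\<close> is singular, and its size is the Gamma
  integral. The half with \<open>exp (- \<nu> * t)\<close> is at most
  \<open>exp (r/2) / \<nu>\<close>, so the factor \<open>r powr \<nu>\<close> removes it together
  with the bounded term.\<close>

lemma BesselY_asymp:
  assumes \<nu>: "\<nu> > 0"
  shows "((\<lambda>r. r powr \<nu> * BesselY \<nu> r) \<longlongrightarrow> - (2 powr \<nu> * Gamma \<nu> / pi)) (at_right 0)"
proof (rule tendsto_sandwich)
  let ?G = "Gamma \<nu>"
  let ?E = "\<lambda>r. r powr \<nu> * (exp (r/2) * (1/\<nu>)) / pi"
  have ev: "\<forall>\<^sub>F r in at_right (0::real). 0 < r"
    by (rule eventually_at_right_less)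
  have B: "- (r powr \<nu>) - exp (r/2) * (2 powr \<nu> * ?G) / pi - ?E r \<le> r powr \<nu> * BesselY \<nu> r \<and>
     r powr \<nu> * BesselY \<nu> r \<le> r powr \<nu> - (2 powr \<nu> * (?G - (r/2) powr \<nu> / \<nu>)) / pi + ?E r" if r: "0 < r" for r
  proof -
    obtain b where b: "\<bar>b\<bar> \<le> 1" "BesselY \<nu> r = b - (Ymain \<nu> r + cos (\<nu> * pi) * Ymain (- \<nu>) r) / pi"
      by (rule BesselY_split[OF r(1), of \<nu>]) simp
    have rp: "r powr \<nu> = 2 powr \<nu> * (r/2) powr \<nu>" using r by (simp add: powr_divide)
    have "2 powr \<nu> * (?G - (r/2) powr \<nu> / \<nu>) \<le> 2 powr \<nu> * ((r/2) powr \<nu> * integral {0..} (Kexp \<nu> r))"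
      using Kexp_gamma(3)[OF \<nu> r] by (intro mult_left_mono) auto
    also have "\<dots> = r powr \<nu> * integral {0..} (Kexp \<nu> r)" by (simp add: rp)
    also have "\<dots> \<le> r powr \<nu> * Ymain \<nu> r" using Ymain_bounds(2)[OF r] by (intro mult_left_mono) auto
    finally have 1: "2 powr \<nu> * (?G - (r/2) powr \<nu> / \<nu>) / pi \<le> r powr \<nu> * Ymain \<nu> r / pi" by (intro divide_right_mono) auto
    have "r powr \<nu> * Ymain \<nu> r \<le> r powr \<nu> * (exp (r/2) * integral {0..} (Kexp \<nu> r))"
      using Ymain_bounds(3)[OF r] by (intro mult_left_mono) auto
    also have "\<dots> = exp (r/2) * (2 powr \<nu> * ((r/2) powr \<nu> * integral {0..} (Kexp \<nu> r)))" by (simp add: rp)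
    also have "\<dots> \<le> exp (r/2) * (2 powr \<nu> * ?G)" using Kexp_gamma(2)[OF \<nu> r] by (intro mult_left_mono) auto
    finally have 2: "r powr \<nu> * Ymain \<nu> r / pi \<le> exp (r/2) * (2 powr \<nu> * ?G) / pi" by (intro divide_right_mono) auto
    have "integral {0..} (Kexp (- \<nu>) r) \<le> exp (- \<nu> * 0) / \<nu>"
    proof (rule has_integral_le[OF _ has_integral_exp_minus_to_infinity[OF \<nu>, of 0]])
      show "(Kexp (- \<nu>) r has_integral integral {0..} (Kexp (- \<nu>) r)) {0..}"
        using Kexp_integrable[OF r] by (simp add: has_integral_integral)
      show "Kexp (- \<nu>) r t \<le> exp (- \<nu> * t)" if "t \<in> {0..}" for t
        unfolding Kexp_def using r by (intro mult_right_le_one_le) auto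
    qed
    then have "exp (r/2) * integral {0..} (Kexp (- \<nu>) r) \<le> exp (r/2) * (1/\<nu>)" by (intro mult_left_mono) auto
    then have y: "Ymain (- \<nu>) r \<le> exp (r/2) * (1/\<nu>)" using Ymain_bounds(3)[OF r, of "- \<nu>"] by simp
    have "0 \<le> integral {0..} (Kexp (- \<nu>) r)"
      using Kexp_integrable[OF r] Kexp_pos by (intro integral_nonneg) (auto intro: less_imp_le)
    then have y0: "0 \<le> Ymain (- \<nu>) r" using Ymain_bounds(2)[OF r, of "- \<nu>"] by simp
    have "\<bar>cos (\<nu> * pi) * Ymain (- \<nu>) r\<bar> \<le> 1 * (exp (r/2) * (1/\<nu>))"
      unfolding abs_mult using y y0 by (intro mult_mono) auto
    then have "r powr \<nu> * \<bar>cos (\<nu> * pi) * Ymain (- \<nu>) r\<bar> \<le> r powr \<nu> * (1 * (exp (r/2) * (1/\<nu>)))"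
      by (rule mult_left_mono) simp
    then have "\<bar>r powr \<nu> * (cos (\<nu> * pi) * Ymain (- \<nu>) r)\<bar> \<le> r powr \<nu> * (exp (r/2) * (1/\<nu>))"
      by (simp add: abs_mult)
    then have 3: "\<bar>r powr \<nu> * (cos (\<nu> * pi) * Ymain (- \<nu>) r) / pi\<bar> \<le> ?E r"
      unfolding abs_divide abs_of_pos[OF pi_gt_zero] by (rule divide_right_mono) simp
    have 4: "\<bar>r powr \<nu> * b\<bar> \<le> r powr \<nu>" using b(1) by (simp add: abs_mult mult_left_le)
    have "r powr \<nu> * BesselY \<nu> r = r powr \<nu> * b - r powr \<nu> * Ymain \<nu> r / pi - r powr \<nu> * (cos (\<nu> * pi) * Ymain (- \<nu>) r) / pi"
      unfolding b(2) by (simp add: algebra_simps add_divide_distrib)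
    then show ?thesis using 1 2 3 4 unfolding abs_le_iff by linarith
  qed
  show "\<forall>\<^sub>F r in at_right 0. - (r powr \<nu>) - exp (r/2) * (2 powr \<nu> * ?G) / pi - ?E r \<le> r powr \<nu> * BesselY \<nu> r"
    using ev by eventually_elim (use B in auto)
  show "\<forall>\<^sub>F r in at_right 0. r powr \<nu> * BesselY \<nu> r \<le> r powr \<nu> - (2 powr \<nu> * (?G - (r/2) powr \<nu> / \<nu>)) / pi + ?E r"
    using ev by eventually_elim (use B in auto)
  have p0: "((\<lambda>r. r powr \<nu>) \<longlongrightarrow> 0) (at_right (0::real))" using \<nu> by real_asymp
  have p1: "((\<lambda>r. (r/2) powr \<nu>) \<longlongrightarrow> 0) (at_right (0::real))" using \<nu> by real_asymp
  have e0: "((\<lambda>r. exp (r/2)) \<longlongrightarrow> 1) (at_right (0::real))" by real_asymp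
  have "((\<lambda>r. - (r powr \<nu>) - exp (r/2) * (2 powr \<nu> * ?G) / pi - ?E r) \<longlongrightarrow> - 0 - 1 * (2 powr \<nu> * ?G) / pi - 0 * (1 * (1/\<nu>)) / pi) (at_right (0::real))"
    by (intro tendsto_intros p0 e0) auto
  then show "((\<lambda>r. - (r powr \<nu>) - exp (r/2) * (2 powr \<nu> * ?G) / pi - ?E r) \<longlongrightarrow> - (2 powr \<nu> * ?G / pi)) (at_right (0::real))"
    by simp
  have "((\<lambda>r. r powr \<nu> - (2 powr \<nu> * (?G - (r/2) powr \<nu> / \<nu>)) / pi + ?E r) \<longlongrightarrow> 0 - (2 powr \<nu> * (?G - 0 / \<nu>)) / pi + 0 * (1 * (1/\<nu>)) / pi) (at_right (0::real))"
    using \<nu> by (intro tendsto_intros p0 p1 e0) auto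
  then show "((\<lambda>r. r powr \<nu> - (2 powr \<nu> * (?G - (r/2) powr \<nu> / \<nu>)) / pi + ?E r) \<longlongrightarrow> - (2 powr \<nu> * ?G / pi)) (at_right (0::real))"
    by simp
qed

lemma norm_at_right_0: "filterlim (\<lambda>x::'a::real_normed_vector. norm x) (at_right 0) (at 0)"
  unfolding filterlim_at by (auto intro!: tendsto_eq_intros simp: eventually_at_filter)

text \<open>The radial derivative of \<open>h\<close> is - |x|^(1-m), so its flux through spheres
  around 0 has absolute value \<open>m * om\<close>; the limit is the reciprocal of this flux. For
  \<open>m > 2\<close> the Bessel constants match it because, with \<open>\<nu> = (m - 2)/2\<close>,
  the volume of the unit ball involves Gamma (\<nu> + 2) = (\<nu> + 1) \<nu> Gamma \<nu>.\<close>

lemma Phi_asymptotics: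
  assumes N: "CARD('n::finite) \<ge> 2"
  defines "m \<equiv> real CARD('n)"
  shows "((\<lambda>x::real^'n. Phi x / fsol m ((norm x)\<^sup>2)) \<longlongrightarrow> 1 / (m * unit_ball_vol m)) (at 0)"
proof -
  have ev: "\<forall>\<^sub>F x in at (0::real^'n). x \<noteq> 0" by (simp add: eventually_at_filter)
  show ?thesis
  proof (cases "m = 2")
    case True
    have "((\<lambda>x::real^'n. 1/4 * (BesselY 0 (norm x) / ln (norm x))) \<longlongrightarrow> 1/4 * (2 / pi)) (at 0)"
      by (intro tendsto_intros filterlim_compose[OF BesselY_0_asymp norm_at_right_0])
    moreover have "\<forall>\<^sub>F x::real^'n in at 0. 1/4 * (BesselY 0 (norm x) / ln (norm x)) = Phi x / fsol m ((norm x)\<^sup>2)"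
      using ev
    proof eventually_elim
      case (elim x)
      then show ?case using True by (simp add: Phi_def fsol_def ln_realpow flip: m_def)
    qed
    ultimately have "((\<lambda>x::real^'n. Phi x / fsol m ((norm x)\<^sup>2)) \<longlongrightarrow> 1/4 * (2 / pi)) (at 0)"
      by (rule Lim_transform_eventually)
    then show ?thesis using True by (simp add: unit_ball_vol_2)
  next
    case False
    define \<nu> where "\<nu> = (m - 2) / 2"
    have m: "m > 2" using False N by (simp add: m_def)
    then have \<nu>: "\<nu> > 0" by (simp add: \<nu>_def)
    have "2 * \<nu> = m - 2" by (simp add: \<nu>_def)
    then have mn: "m = 2 * \<nu> + 2" by linarith
    have "((\<lambda>x::real^'n. - (\<nu> / 2 * (2 * pi) powr (- \<nu>)) * (norm x powr \<nu> * BesselY \<nu> (norm x))) \<longlongrightarrow>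
      - (\<nu> / 2 * (2 * pi) powr (- \<nu>)) * - (2 powr \<nu> * Gamma \<nu> / pi)) (at 0)"
      by (intro tendsto_intros filterlim_compose[OF BesselY_asymp[OF \<nu>] norm_at_right_0])
    moreover have "\<forall>\<^sub>F x::real^'n in at 0. - (\<nu> / 2 * (2 * pi) powr (- \<nu>)) * (norm x powr \<nu> * BesselY \<nu> (norm x)) = Phi x / fsol m ((norm x)\<^sup>2)"
      using ev
    proof eventually_elim
      case (elim x)
      then have r: "norm x > 0" by simp
      have P: "Phi x = - (1/4) * (2 * pi * norm x) powr (- \<nu>) * BesselY \<nu> (norm x)"
      proof -
        have e: "(2 - m) / 2 = - \<nu>" "(m - 2) / 2 = \<nu>"
          unfolding \<nu>_def by (simp_all only: minus_divide_left minus_diff_eq)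
        have "Phi x = - (1/4) * (2 * pi * norm x) powr ((2 - m) / 2) * BesselY ((m - 2) / 2) (norm x)"
          using elim by (simp add: Phi_def m_def)
        then show ?thesis by (simp only: e)
      qed
      have "2 * (1 - m/2) = 2 - m" by simp
      also have "\<dots> = - (2 * \<nu>)" using mn by simp
      finally have "2 * (1 - m/2) = - (2 * \<nu>)" .
      then have "((norm x)\<^sup>2) powr (1 - m/2) = norm x powr (- (2 * \<nu>))"
        using r by (simp add: powr_powr flip: powr_numeral)
      then have F1: "fsol m ((norm x)\<^sup>2) = norm x powr (- (2 * \<nu>)) / (2 * \<nu>)"
        using False by (simp add: fsol_def mn)
      have F2: "norm x powr (- (2 * \<nu>)) = 1 / (norm x powr \<nu> * norm x powr \<nu>)"
        using powr_minus_divide[of "norm x" "2 * \<nu>"] powr_add[of "norm x" \<nu> \<nu>] by simp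
      have F3: "(2 * pi * norm x) powr (- \<nu>) = (2 * pi) powr (- \<nu>) / norm x powr \<nu>"
        using r by (simp add: powr_mult powr_minus divide_inverse)
      have "norm x powr \<nu> > 0" using r by simp
      then show ?case unfolding P F1 F2 F3 using \<nu> by (simp add: field_simps)
    qed
    ultimately have "((\<lambda>x::real^'n. Phi x / fsol m ((norm x)\<^sup>2)) \<longlongrightarrow>
       - (\<nu> / 2 * (2 * pi) powr (- \<nu>)) * - (2 powr \<nu> * Gamma \<nu> / pi)) (at 0)"
      by (rule Lim_transform_eventually)
    moreover have "- (\<nu> / 2 * (2 * pi) powr (- \<nu>)) * - (2 powr \<nu> * Gamma \<nu> / pi) = 1 / (m * unit_ball_vol m)"
    proof -
      have g1: "Gamma (\<nu> + 1) = \<nu> * Gamma \<nu>" using \<nu> by (intro Gamma_plus1) auto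
      have g2: "Gamma (\<nu> + 1 + 1) = (\<nu> + 1) * Gamma (\<nu> + 1)" using \<nu> by (intro Gamma_plus1) auto
      have Gp: "Gamma \<nu> > 0" using \<nu> by simp
      have h: "m / 2 = \<nu> + 1" by (simp add: \<nu>_def field_simps)
      have ub: "unit_ball_vol m = pi powr (\<nu> + 1) / ((\<nu> + 1) * (\<nu> * Gamma \<nu>))"
        unfolding unit_ball_vol_def h by (simp only: g2 g1)
      have p: "(2 * pi) powr (- \<nu>) = 1 / (2 powr \<nu> * pi powr \<nu>)"
        by (simp add: powr_minus_divide powr_mult)
      have q: "pi powr (\<nu> + 1) = pi powr \<nu> * pi" by (simp add: powr_add)
      have n1: "\<nu> + 1 \<noteq> 0" and m': "m = 2 * (\<nu> + 1)" using \<nu> mn by auto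
      have "m * unit_ball_vol m = 2 * (\<nu> + 1) * (pi powr \<nu> * pi / ((\<nu> + 1) * (\<nu> * Gamma \<nu>)))"
        by (simp only: ub q m'[symmetric])
      also have "\<dots> = 2 * (pi powr \<nu> * pi) / (\<nu> * Gamma \<nu>)"
      proof -
        have "2 * c * (X / (c * Y)) = 2 * X / Y" if "c \<noteq> 0" for c X Y :: real using that by simp
        from this[OF n1] show ?thesis .
      qed
      finally have "1 / (m * unit_ball_vol m) = \<nu> * Gamma \<nu> / (2 * (pi powr \<nu> * pi))" by simp
      moreover have "- (\<nu> / 2 * (2 * pi) powr (- \<nu>)) * - (2 powr \<nu> * Gamma \<nu> / pi) = \<nu> * Gamma \<nu> / (2 * (pi powr \<nu> * pi))"
        unfolding p by simp
      ultimately show ?thesis by simp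
    qed
    ultimately show ?thesis by simp
  qed
qed

theorem theorem1p1:
  fixes u Q :: "real^'n::finite \<Rightarrow> real" and p :: real
  assumes N2: "CARD('n) \<ge> 2"
    and p1: "p > 1"
    and pcrit: "CARD('n) \<ge> 3 \<Longrightarrow> p < real CARD('n) / (real CARD('n) - 2)"
    and Qhold: "holder_continuous Q"
    and Q0: "Q 0 > 0"
    and uC2: "C2_on (- {0}) u"
    and eq: "\<And>x. x \<noteq> 0 \<Longrightarrow> - laplacian u x - u x = Q x * \<bar>u x\<bar> powr (p - 1) * u x"
    and blowup: "filterlim u at_top (at 0)"
  shows "locally_integrable u
    \<and> locally_integrable (\<lambda>x. Q x * \<bar>u x\<bar> powr (p - 1) * u x)
    \<and> (\<exists>k>0.
         (\<forall>\<xi>. test_function \<xi> \<longrightarrow>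
            (\<integral>x. u x * (- laplacian \<xi> x) - u x * \<xi> x
                  - Q x * \<bar>u x\<bar> powr (p - 1) * u x * \<xi> x \<partial>lborel) = k * \<xi> 0)
       \<and> ((\<lambda>x. u x / Phi x) \<longlongrightarrow> k) (at 0))"
proof -
  define m where "m = real CARD('n)"
  interpret singular_solution u Q p m
    by unfold_locales (fact m_def N2 p1 pcrit Qhold Q0 uC2 eq blowup | (rule pcrit eq; assumption))+
  obtain k where k: "k > 0" "\<And>\<xi>. C2c \<xi> \<Longrightarrow> weak \<xi> = k * \<xi> 0" "((\<lambda>x. u x / h x) \<longlongrightarrow> k / (m * om)) (at 0)"
    by (rule singularity) blast
  have "(\<integral>x. u x * (- laplacian \<xi> x) - u x * \<xi> x - Q x * \<bar>u x\<bar> powr (p - 1) * u x * \<xi> x \<partial>lborel) = k * \<xi> 0"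
    if "test_function \<xi>" for \<xi>
  proof -
    have w: "weak \<xi> = k * \<xi> 0" by (rule k(2)[OF test_function_C2c[OF that]])
    have e: "u x * - laplacian \<xi> x - src x * \<xi> x = u x * (- laplacian \<xi> x) - u x * \<xi> x - Q x * \<bar>u x\<bar> powr (p - 1) * u x * \<xi> x" for x
      by (simp add: src_def algebra_simps)
    show ?thesis using w unfolding weak_def e .
  qed
  moreover have "((\<lambda>x. u x / Phi x) \<longlongrightarrow> k) (at 0)"
  proof -
    have "m * om > 0" using m2 om_pos by (intro mult_pos_pos) auto
    then have mo: "m * om \<noteq> 0" by (rule less_imp_neq[symmetric])
    have P: "((\<lambda>x. Phi x / h x) \<longlongrightarrow> 1 / (m * om)) (at 0)"
      unfolding m_def by (rule Phi_asymptotics[OF N2])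
    \<comment> \<open>Both \<open>u\<close> and \<open>Phi\<close> are compared with
      \<open>h\<close>; the common factor \<open>m * om\<close> cancels, which leaves exactly the
      mass \<open>k\<close>.\<close>
    have L: "((\<lambda>x. (u x / h x) / (Phi x / h x)) \<longlongrightarrow> (k / (m * om)) / (1 / (m * om))) (at 0)"
      by (rule tendsto_divide[OF k(3) P]) (use mo in simp)
    have kk: "(k / (m * om)) / (1 / (m * om)) = k" using mo by simp
    have "\<forall>\<^sub>F x in at 0. h x > 0" using h_at_top by (simp add: filterlim_at_top_dense)
    then have "\<forall>\<^sub>F x in at 0. (u x / h x) / (Phi x / h x) = u x / Phi x" by eventually_elim simp
    from Lim_transform_eventually[OF L[unfolded kk] this] show ?thesis .
  qed
  ultimately show ?thesis
    using locally_integrable_u locally_integrable_nonlinearity k(1) by blast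
qed

end
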